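(* Let $W:\mathbb{C}\to\mathbb{R}$ be of class $C^2$ with $W(e^{i\vartheta}\psi)=W(\psi)$ for all $\vartheta\in\mathbb{R}$, $\psi\in\mathbb{C}$. For real arguments write $W(u)$, $W'(u)$, $W''(u)$ for the restriction of $W$ to $\mathbb{R}$ and its derivatives. Assume: (i) $W(u)\ge 0$ for all $u$; (ii) $W(0)=W'(0)=0$ and $W''(0)=m_0^2>0$ (with $m_0>0$); (iii) there exists $u_0\in\mathbb{R}^+$ such that $W(u_0)<\frac12 m_0^2u_0^2$. Set $$m_1=\inf\left\{m>0:\ \exists\,u\in\mathbb{R}^+,\ W(u)-\tfrac12 m^2u^2<0\right\}.$$ Then for every frequency $\omega_0\in(m_1,m_0)$ the equation $$\frac{\partial^2\psi}{\partial t^2}-\Delta\psi+W'(\psi)=0\qquad\text{on }\mathbb{R}\times\mathbb{R}^3$$ has a (nontrivial) finite energy solitary wave solution of the form $\psi_0(t,x)=u(x)e^{-i\omega_0t}$, with $u\ge0$ real valued.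
   Context: $\mathbb{R}^+$ denotes the positive reals. For $\psi=\psi_1+i\psi_2\in\mathbb{C}$, $W'(\psi)=\frac{\partial W}{\partial\psi_1}+i\frac{\partial W}{\partial\psi_2}$. Substituting $\psi_0$ into the equation, $\psi_0$ is a solution if and only if $-\Delta u+W'(u)=\omega_0^2u$ on $\mathbb{R}^3$; solutions are understood in the weak sense. The energy of a solution is $$E(\psi)=\int_{\mathbb{R}^3}\left[\frac12\left|\frac{\partial\psi}{\partial t}\right|^2+\frac12|\nabla\psi|^2+W(\psi)\right]dx ,$$ and finite energy means $u\in H^1(\mathbb{R}^3)$ and $E(\psi_0)<\infty$. *)

theory Defs
  imports "HOL-Analysis.Analysis"
begin

subsection \<open>Functions of class \<open>C\<^sup>k\<close>, test functions\<close>

definition partial :: "'a::real_normed_vector \<Rightarrow> ('a \<Rightarrow> real) \<Rightarrow> 'a \<Rightarrow> real" where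
  "partial b f x = deriv (\<lambda>s::real. f (x + s *\<^sub>R b)) 0"

text \<open>A function is \<open>C\<^sup>k\<^sup>+\<^sup>1\<close> iff it is differentiable and all its
  partial derivatives are \<open>C\<^sup>k\<close>.\<close>

primrec Ck :: "nat \<Rightarrow> ('a::euclidean_space \<Rightarrow> real) \<Rightarrow> bool" where
  "Ck 0 f \<longleftrightarrow> continuous_on UNIV f"
| "Ck (Suc k) f \<longleftrightarrow> (\<forall>x. f differentiable (at x)) \<and> (\<forall>b\<in>Basis. Ck k (partial b f))"

definition test_function :: "('a::euclidean_space \<Rightarrow> real) \<Rightarrow> bool" where
  "test_function \<phi> \<longleftrightarrow> (\<forall>k. Ck k \<phi>) \<and> compact (closure {x. \<phi> x \<noteq> 0})"

definition grad :: "(real^'n \<Rightarrow> real) \<Rightarrow> real^'n \<Rightarrow> real^'n" where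
  "grad \<phi> x = (\<chi> i. partial (axis i 1) \<phi> x)"


subsection \<open>Weak gradients and \<open>H\<^sup>1\<close>\<close>

text \<open>Functions are represented by Borel measurable representatives; every Lebesgue measurable
  function agrees almost everywhere with such a one.\<close>

definition locally_integrable ::
    "('a::euclidean_space \<Rightarrow> 'b::{banach, second_countable_topology}) \<Rightarrow> bool" where
  "locally_integrable f \<longleftrightarrow> (\<forall>K. compact K \<longrightarrow> set_integrable lborel K f)"

definition has_weak_gradient ::
    "(real^'n \<Rightarrow> 'b::{banach, second_countable_topology}) \<Rightarrow> (real^'n \<Rightarrow> 'b^'n) \<Rightarrow> bool" where
  "has_weak_gradient f G \<longleftrightarrow>
     locally_integrable f \<and>
     (\<forall>i. locally_integrable (\<lambda>x. G x $ i)) \<and>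
     (\<forall>\<phi> i. test_function \<phi> \<longrightarrow>
        (\<integral>x. partial (axis i 1) \<phi> x *\<^sub>R f x \<partial>lborel) = - (\<integral>x. \<phi> x *\<^sub>R (G x $ i) \<partial>lborel))"

definition H1 :: "(real^'n \<Rightarrow> real) set" where
  "H1 = {u. u \<in> borel_measurable lborel \<and> integrable lborel (\<lambda>x. (u x)\<^sup>2) \<and>
     (\<exists>G. has_weak_gradient u G \<and> integrable lborel (\<lambda>x. (norm (G x))\<^sup>2))}"


subsection \<open>The nonlinear wave equation\<close>

text \<open>The complex gradient \<open>W'(\<psi>) = \<partial>W/\<partial>\<psi>\<^sub>1 + i \<partial>W/\<partial>\<psi>\<^sub>2\<close>.\<close>

definition cgrad :: "(complex \<Rightarrow> real) \<Rightarrow> complex \<Rightarrow> complex" where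
  "cgrad W z = Complex (partial 1 W z) (partial \<i> W z)"

definition restrict_real :: "(complex \<Rightarrow> real) \<Rightarrow> real \<Rightarrow> real" where
  "restrict_real W s = W (complex_of_real s)"

definition wave_operator :: "(real \<times> (real^3) \<Rightarrow> real) \<Rightarrow> real \<times> (real^3) \<Rightarrow> real" where
  "wave_operator \<phi> p = partial (1, 0) (partial (1, 0) \<phi>) p
     - (\<Sum>i\<in>UNIV. partial (0, axis i 1) (partial (0, axis i 1) \<phi>) p)"

text \<open>\<open>\<psi>\<^sub>t\<^sub>t - \<Delta>\<psi> + W'(\<psi>) = 0\<close> on \<open>\<real> \<times> \<real>\<^sup>3\<close> in the sense of distributions. The wave operator
  is formally self-adjoint, and real test functions suffice by linearity.\<close>

definition weak_wave_solution :: "(complex \<Rightarrow> real) \<Rightarrow> (real \<Rightarrow> real^3 \<Rightarrow> complex) \<Rightarrow> bool" where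
  "weak_wave_solution W \<psi> \<longleftrightarrow>
     locally_integrable (\<lambda>(t, x). \<psi> t x) \<and>
     locally_integrable (\<lambda>(t, x). cgrad W (\<psi> t x)) \<and>
     (\<forall>\<phi>. test_function \<phi> \<longrightarrow>
        (\<integral>(t, x). wave_operator \<phi> (t, x) *\<^sub>R \<psi> t x + \<phi> (t, x) *\<^sub>R cgrad W (\<psi> t x) \<partial>lborel) = 0)"

text \<open>\<open>-\<Delta>u + W'(u) = \<omega>\<^sup>2 u\<close> on \<open>\<real>\<^sup>3\<close> in the weak sense, for real valued \<open>u\<close>.\<close>

definition weak_stationary_solution ::
    "(complex \<Rightarrow> real) \<Rightarrow> real \<Rightarrow> (real^3 \<Rightarrow> real) \<Rightarrow> bool" where
  "weak_stationary_solution W \<omega> u \<longleftrightarrow>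
     locally_integrable (\<lambda>x. deriv (restrict_real W) (u x)) \<and>
     (\<exists>G. has_weak_gradient u G \<and>
        (\<forall>\<phi>. test_function \<phi> \<longrightarrow>
           (\<integral>x. G x \<bullet> grad \<phi> x \<partial>lborel) + (\<integral>x. deriv (restrict_real W) (u x) * \<phi> x \<partial>lborel)
             = \<omega>\<^sup>2 * (\<integral>x. u x * \<phi> x \<partial>lborel)))"

text \<open>\<open>has_energy W \<psi> t E\<close>: at time \<open>t\<close> the energy of \<open>\<psi>\<close> is finite and equals \<open>E\<close>. It is a
  relation because the weak gradient is determined only almost everywhere; \<open>E\<close> is unique.\<close>

definition has_energy ::
    "(complex \<Rightarrow> real) \<Rightarrow> (real \<Rightarrow> real^3 \<Rightarrow> complex) \<Rightarrow> real \<Rightarrow> real \<Rightarrow> bool" where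
  "has_energy W \<psi> t E \<longleftrightarrow>
     (\<exists>\<psi>\<^sub>t G. (\<forall>x. ((\<lambda>s. \<psi> s x) has_vector_derivative \<psi>\<^sub>t x) (at t)) \<and>
        has_weak_gradient (\<psi> t) G \<and>
        has_bochner_integral lborel
          (\<lambda>x. 1/2 * (norm (\<psi>\<^sub>t x))\<^sup>2 + 1/2 * (norm (G x))\<^sup>2 + W (\<psi> t x)) E)"

definition solitary_wave :: "real \<Rightarrow> (real^3 \<Rightarrow> real) \<Rightarrow> real \<Rightarrow> real^3 \<Rightarrow> complex" where
  "solitary_wave \<omega> u t x = complex_of_real (u x) * exp (- \<i> * complex_of_real (\<omega> * t))"

end

theory Submission
  imports Defs "HOL-Complex_Analysis.Great_Picard"
begin

text \<open>Write \<open>P s = \<omega>\<^sup>2 s\<^sup>2 / 2 - W s\<close> and \<open>f = P'\<close>. Then \<open>P\<close> is even, \<open>P s \<le> - c s\<^sup>2\<close> near \<open>0\<close>, and \<open>P\<close> is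
  positive somewhere because \<open>\<omega> > m\<^sub>1\<close>; one needs a nontrivial solution of \<open>- \<Delta>u = f u\<close>.
  For radial functions put \<open>T = 1/2 \<integral> r\<^sup>2 u'\<^sup>2\<close> and \<open>V = \<integral> r\<^sup>2 P u\<close>. On a grid, \<open>T + 1 / V\<close> attains its minimum
  over \<open>V > 0\<close>; comparison with one test function bounds \<open>T\<close> and bounds \<open>V\<close> away from \<open>0\<close>, uniformly in the grid.
  Strauss' inequality \<open>u\<^sup>2 \<le> 4 T / r\<close> then bounds the mass \<open>\<integral> r\<^sup>2 u\<^sup>2\<close> and \<open>V\<close> from above, so that the
  summed Euler--Lagrange equations converge, along a subsequence, to
  \<open>r\<^sup>2 u' = - \<mu> \<integral>\<^sub>0\<^sup>r s\<^sup>2 f (u s) ds\<close> with \<open>\<mu> > 0\<close>, and the limit is not zero.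
  Rescaling \<open>r\<close> gives \<open>\<mu> = 1\<close>.

  There is no growth condition on \<open>W'\<close>, so \<open>f\<close> is first frozen beyond some \<open>\<beta>\<close>, and one has to
  show \<open>u \<le> \<beta>\<close>. If \<open>f \<beta> = 0\<close> and \<open>P \<beta> > 0\<close>, this follows since the energy \<open>u'\<^sup>2 / 2 + \<mu> P u\<close> decreases. If there is no such
  \<open>\<beta>\<close>, then \<open>P\<close> is increasing from some point on; since \<open>P s \<le> \<omega>\<^sup>2 s\<^sup>2 / 2\<close>, the energy bounds the speed after the
  maximum \<open>M\<close> by a multiple of \<open>M\<close>, so \<open>u \<ge> M / 2\<close> up to a radius independent of \<open>M\<close>, and Strauss'
  inequality bounds \<open>M\<close> independently of \<open>\<beta>\<close>.\<close>

section \<open>Discretized energies\<close>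

text \<open>Minimizing T + 1 / V rather than T under a constraint keeps \<open>V > 0\<close> an open
  condition, so every small variation is admissible. The multiplier comes out as
  \<open>1 / V^2\<close>, positive from the start, and the term 1 / V acts as a barrier against
  vanishing V. On a grid the existence of minimizers is compactness in finitely many coordinates, so
  no weak topology on a function space enters. Compactness in the limit comes from the summed
  equation: with \<open>f\<close> bounded, it bounds the slope at radius r by a multiple of r,
  uniformly in the grid. Loss of mass at infinity is the other danger. Values above
  \<open>\<epsilon>\<close> occur only inside a radius fixed by Strauss' inequality, and smaller
  ones contribute nothing positive to V, so V bounded below keeps a definite mass in a fixed ball.
  The values of the competitor do not exceed the truncation level. Hence the bound on T does not
  depend on that level, and the a priori bound on the maximum is not circular. The weak equations
  are obtained from a profile with bounded directional derivatives, by integration by parts.\<close>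

lemma continuous_bounded_on_compact:
  fixes g :: "'a::topological_space \<Rightarrow> real"
  assumes "continuous_on S g" "compact S"
  obtains K where "\<forall>x\<in>S. \<bar>g x\<bar> \<le> K"
  using compact_imp_bounded[OF compact_continuous_image[OF assms]] by (auto simp: bounded_iff)

text \<open>The right end of cell \<open>k\<close>, so that the radius is never 0 and may be divided
  by.\<close>

abbreviation node :: "real \<Rightarrow> nat \<Rightarrow> real" where
  "node h k \<equiv> real (Suc k) * h"

text \<open>Riemann sum for half the integral of r^2 u'^2: the squared difference quotient brings
  \<open>1 / h^2\<close>, the cell width brings \<open>h\<close>.\<close>

definition kin :: "real \<Rightarrow> nat \<Rightarrow> (nat \<Rightarrow> real) \<Rightarrow> real" where
  "kin h N u = (\<Sum>k<N. (node h k)\<^sup>2 * (u (Suc k) - u k)\<^sup>2) / (2 * h)"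

definition pot :: "(real \<Rightarrow> real) \<Rightarrow> real \<Rightarrow> nat \<Rightarrow> (nat \<Rightarrow> real) \<Rightarrow> real" where
  "pot P h N u = (\<Sum>k<N. h * (node h k)\<^sup>2 * P (u k))"

lemma kin_nonneg: "0 < h \<Longrightarrow> 0 \<le> kin h N u"
  unfolding kin_def by (intro divide_nonneg_pos sum_nonneg) auto

text \<open>Telescoping: \<open>2 / (j + 1) - 2 / (j + 2)\<close> has denominator
  \<open>(j + 1) (j + 2)\<close> and numerator 2, and \<open>j + 2\<close> is at most
  \<open>2 (j + 1)\<close>.\<close>

lemma sum_inverse_squares_tail:
  assumes "k \<le> N"
  shows "(\<Sum>j=k..<N. 1 / (real (Suc j))\<^sup>2) \<le> 2 / real (Suc k) - 2 / real (Suc N)"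
  using assms
proof (induction N rule: dec_induct)
  case base
  then show ?case by simp
next
  case (step N)
  have "1 / (real (Suc N))\<^sup>2 \<le> 2 / real (Suc N) - 2 / real (Suc (Suc N))"
    by (simp add: divide_simps power2_eq_square)
  with step show ?case by simp
qed

text \<open>The decrements from \<open>k\<close> to the zero at \<open>N\<close> sum up to
  \<open>u k\<close>; Cauchy-Schwarz with the weights r and 1 / r separates the kinetic energy from
  the tail of the inverse squares. Each factor contributes a 2 to the constant 4.\<close>

lemma discrete_strauss:
  assumes h: "0 < h" and k: "k < N" and uN: "u N = 0"
  shows "(u k)\<^sup>2 \<le> 4 * kin h N u / (node h k)"
proof -
  have tel: "(\<Sum>j=k..<N. u j - u (Suc j)) = u k"
    using sum_Suc_diff'[of k N "\<lambda>j. - u j"] k uN by (simp add: less_imp_le)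
  let ?a = "\<lambda>j. node h j * (u j - u (Suc j))" and ?b = "\<lambda>j. 1 / (node h j)"
  have "(\<Sum>j=k..<N. u j - u (Suc j)) = (\<Sum>j=k..<N. ?a j * ?b j)"
  proof (intro sum.cong refl)
    fix j
    have "node h j \<noteq> 0" using h by simp
    then show "u j - u (Suc j) = ?a j * ?b j" by (metis mult.commute nonzero_eq_divide_eq times_divide_eq_right mult_1_right)
  qed
  then have "(u k)\<^sup>2 = (\<Sum>j=k..<N. ?a j * ?b j)\<^sup>2" using tel by simp
  also have "\<dots> \<le> (\<Sum>j=k..<N. (?a j)\<^sup>2) * (\<Sum>j=k..<N. (?b j)\<^sup>2)"
    by (rule Cauchy_Schwarz_ineq_sum)
  also have "\<dots> \<le> (2 * h * kin h N u) * (2 / real (Suc k) / h\<^sup>2)"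
  proof (rule mult_mono)
    have "(\<Sum>j=k..<N. (?a j)\<^sup>2) \<le> (\<Sum>j<N. (?a j)\<^sup>2)"
      by (rule sum_mono2) auto
    also have "\<dots> = 2 * h * kin h N u"
      unfolding kin_def using h
      by (simp add: power_mult_distrib power2_commute)
    finally show "(\<Sum>j=k..<N. (?a j)\<^sup>2) \<le> 2 * h * kin h N u" .
    have "(\<Sum>j=k..<N. (?b j)\<^sup>2) = (\<Sum>j=k..<N. 1 / (real (Suc j))\<^sup>2) / h\<^sup>2"
      by (simp add: sum_divide_distrib power_divide power_mult_distrib)
    also have "\<dots> \<le> (2 / real (Suc k) - 2 / real (Suc N)) / h\<^sup>2"
      using sum_inverse_squares_tail[of k N] k by (intro divide_right_mono) auto
    also have "\<dots> \<le> 2 / real (Suc k) / h\<^sup>2"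
      by (intro divide_right_mono) auto
    finally show "(\<Sum>j=k..<N. (?b j)\<^sup>2) \<le> 2 / real (Suc k) / h\<^sup>2" .
  qed (use h kin_nonneg[OF h] in \<open>auto intro!: sum_nonneg mult_nonneg_nonneg\<close>)
  also have "\<dots> = 4 * kin h N u / (node h k)"
  proof -
    have "2 * h * X * (2 / a / h\<^sup>2) = 4 * X / (a * h)" for X a
      using h by (cases "a = 0") (auto simp: field_simps power2_eq_square)
    then show ?thesis .
  qed
  finally show ?thesis .
qed

text \<open>\<open>F\<close> bounds slopes independently of the grid and is what the truncation
  provides; \<open>C0\<close> limits the gain from large values; \<open>c\<close> and
  \<open>\<epsilon>\<close> make small values lower the potential energy.\<close>

locale nonlinearity =
  fixes P f :: "real \<Rightarrow> real" and C0 F c \<epsilon> :: real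
  assumes P_deriv: "\<And>s. (P has_real_derivative f s) (at s)"
    and f_cont: "continuous_on UNIV f"
    and f_bound: "\<And>s. \<bar>f s\<bar> \<le> F"
    and P_even: "\<And>s. P (- s) = P s"
    and P_0: "P 0 = 0"
    and P_le: "\<And>s. P s \<le> C0 * s\<^sup>2"
    and P_small: "\<And>s. \<bar>s\<bar> \<le> \<epsilon> \<Longrightarrow> P s \<le> - c * s\<^sup>2"
    and c_pos: "0 < c" and \<epsilon>_pos: "0 < \<epsilon>" and C0_nonneg: "0 \<le> C0"
begin

lemma P_cont: "continuous_on S P"
  using P_deriv by (meson DERIV_continuous_on has_field_derivative_at_within)

lemma F_nonneg: "0 \<le> F"
  using f_bound[of 0] by linarith

lemma P_abs: "P \<bar>s\<bar> = P s"
  using P_even[of s] by (auto simp: abs_if)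

text \<open>Where \<open>s\<close> is small, the negativity of \<open>P\<close> absorbs the
  quadratic term, so only large values remain on the right.\<close>

lemma P_split: "P s + c * s\<^sup>2 \<le> (C0 + c) * (if \<epsilon> < \<bar>s\<bar> then s\<^sup>2 else 0)"
  using P_le[of s] P_small[of s] by (auto simp: algebra_simps)

text \<open>Strauss' inequality read backwards: \<open>\<epsilon>^2 < 4 T / r\<close>. The radius
  obtained does not depend on the grid.\<close>

lemma large_values_near_origin:
  assumes h: "0 < h" and k: "k < N" and uN: "u N = 0" and large: "\<epsilon> < \<bar>u k\<bar>"
    and T: "kin h N u \<le> T"
  shows "node h k < 4 * T / \<epsilon>\<^sup>2"
proof -
  have "\<epsilon>\<^sup>2 < (u k)\<^sup>2" using large \<epsilon>_pos by (metis abs_le_square_iff abs_of_pos not_le)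
  also have "\<dots> \<le> 4 * kin h N u / (node h k)"
    using h k uN by (rule discrete_strauss)
  also have "\<dots> \<le> 4 * T / (node h k)"
    using T h by (intro divide_right_mono) auto
  finally have "\<epsilon>\<^sup>2 * (node h k) < 4 * T"
    using h by (subst (asm) pos_less_divide_eq) auto
  then show ?thesis using \<epsilon>_pos by (subst pos_less_divide_eq) (auto simp: mult.commute)
qed

text \<open>By \<open>P_split\<close> only cells with values above \<open>\<epsilon>\<close> count.
  There are at most \<open>\<rho> / h\<close> of them, and on each Strauss gives
  \<open>r^2 u^2 <= 4 T r <= 4 T \<rho>\<close>, so \<open>h\<close> cancels. The one inequality
  bounds V from above and, once V is nonnegative, also the mass.\<close>

lemma pot_mass_bound:
  assumes h: "0 < h" and uN: "u N = 0" and T: "kin h N u \<le> T"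
  shows "pot P h N u + c * (\<Sum>k<N. h * (node h k)\<^sup>2 * (u k)\<^sup>2)
           \<le> (C0 + c) * (4 * T * (4 * T / \<epsilon>\<^sup>2)\<^sup>2)"
proof -
  have T0: "0 \<le> T" using T kin_nonneg[OF h] order_trans by blast
  define \<rho> where "\<rho> = 4 * T / \<epsilon>\<^sup>2"
  have \<rho>0: "0 \<le> \<rho>" using T0 by (simp add: \<rho>_def)
  define K where "K = {k. k < N \<and> \<epsilon> < \<bar>u k\<bar>}"
  have finK: "finite K" by (auto simp: K_def)
  have K: "node h k < \<rho>" if "k \<in> K" for k
    using large_values_near_origin[OF h _ uN _ T, of k] that by (auto simp: K_def \<rho>_def)
  have "K \<subseteq> {..< nat \<lfloor>\<rho> / h\<rfloor>}"
  proof
    fix k assume "k \<in> K"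
    then have "real (Suc k) \<le> \<rho> / h" using K[of k] h by (simp add: field_simps)
    then have "int (Suc k) \<le> \<lfloor>\<rho> / h\<rfloor>" by (simp add: le_floor_iff)
    then show "k \<in> {..< nat \<lfloor>\<rho> / h\<rfloor>}" by (simp add: zless_nat_eq_int_zless)
  qed
  then have "card K \<le> nat \<lfloor>\<rho> / h\<rfloor>" by (metis card_mono card_lessThan finite_lessThan)
  then have cardK: "real (card K) \<le> \<rho> / h"
  proof -
    have "real (card K) \<le> real (nat \<lfloor>\<rho> / h\<rfloor>)" using \<open>card K \<le> _\<close> by simp
    also have "\<dots> \<le> \<rho> / h" using \<rho>0 h by simp
    finally show ?thesis .
  qed
  have "pot P h N u + c * (\<Sum>k<N. h * (node h k)\<^sup>2 * (u k)\<^sup>2)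
      = (\<Sum>k<N. h * (node h k)\<^sup>2 * (P (u k) + c * (u k)\<^sup>2))"
    unfolding pot_def by (simp add: sum_distrib_left sum.distrib algebra_simps)
  also have "\<dots> \<le> (\<Sum>k<N. h * (node h k)\<^sup>2 * ((C0 + c) * (if \<epsilon> < \<bar>u k\<bar> then (u k)\<^sup>2 else 0)))"
    using h by (intro sum_mono mult_left_mono P_split) auto
  also have "\<dots> = (C0 + c) * (\<Sum>k\<in>K. h * (node h k)\<^sup>2 * (u k)\<^sup>2)"
    unfolding sum_distrib_left
    by (rule sum.mono_neutral_cong_right) (auto simp: K_def)
  also have "(\<Sum>k\<in>K. h * (node h k)\<^sup>2 * (u k)\<^sup>2) \<le> (\<Sum>k\<in>K. h * \<rho> * (4 * T))"
  proof (rule sum_mono)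
    fix k assume k: "k \<in> K"
    then have kN: "k < N" by (simp add: K_def)
    have r0: "0 < node h k" using h by simp
    have "(node h k)\<^sup>2 * (u k)\<^sup>2 \<le> (node h k)\<^sup>2 * (4 * kin h N u / (node h k))"
      using discrete_strauss[where u=u and N=N, OF h kN uN] by (intro mult_left_mono) auto
    also have "\<dots> = (node h k) * (4 * kin h N u)"
      using r0 by (simp add: power2_eq_square)
    also have "\<dots> \<le> \<rho> * (4 * T)"
      using K[OF k] T T0 \<rho>0 r0 kin_nonneg[OF h, of N u] by (intro mult_mono) auto
    finally show "h * (node h k)\<^sup>2 * (u k)\<^sup>2 \<le> h * \<rho> * (4 * T)"
      using h by (simp add: mult.assoc)
  qed
  also have "(\<Sum>k\<in>K. h * \<rho> * (4 * T)) = real (card K) * (h * \<rho> * (4 * T))" by simp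
  also have "\<dots> \<le> \<rho> / h * (h * \<rho> * (4 * T))"
    using cardK h \<rho>0 T0 by (intro mult_right_mono) auto
  also have "\<dots> = 4 * T * \<rho>\<^sup>2" using h by (simp add: power2_eq_square)
  finally show ?thesis using C0_nonneg c_pos by (simp add: \<rho>_def mult_left_mono)
qed


lemma kin_abs: "0 < h \<Longrightarrow> kin h N (\<lambda>k. \<bar>u k\<bar>) \<le> kin h N u"
  unfolding kin_def
  by (intro divide_right_mono sum_mono mult_left_mono) (auto simp: abs_le_square_iff[symmetric] abs_triangle_ineq3)

lemma pot_abs: "pot P h N (\<lambda>k. \<bar>u k\<bar>) = pot P h N u"
  unfolding pot_def by (simp add: P_abs)

text \<open>Direct method in finitely many coordinates. On a sublevel set Strauss bounds every
  coordinate, and the bound on 1 / V confines V to the closed condition \<open>V >= 1 / C\<close>,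
  where the functional is continuous. Absolute values do not raise it, which yields a nonnegative
  minimizer.\<close>

lemma exists_minimizer:
  assumes h: "0 < h" and u0: "\<And>k. N \<le> k \<Longrightarrow> u0 k = 0" and pot_u0: "0 < pot P h N u0"
  obtains u where "\<And>k. 0 \<le> u k" "\<And>k. N \<le> k \<Longrightarrow> u k = 0" "0 < pot P h N u"
    "kin h N u + 1 / pot P h N u \<le> kin h N u0 + 1 / pot P h N u0"
    "\<And>v. (\<And>k. N \<le> k \<Longrightarrow> v k = 0) \<Longrightarrow> 0 < pot P h N v \<Longrightarrow>
       kin h N u + 1 / pot P h N u \<le> kin h N v + 1 / pot P h N v"
proof -
  define J where "J = (\<lambda>u. kin h N u + 1 / pot P h N u)"
  define C where "C = J u0"
  have C: "0 < C" using kin_nonneg[OF h, of N u0] pot_u0 by (simp add: C_def J_def add_nonneg_pos)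
  \<comment> \<open>The worst case of Strauss' inequality, at the innermost radius
    \<open>h\<close>.\<close>
  define B where "B = sqrt (4 * C / h)"
  \<comment> \<open>A box in the product topology of sequences; the coordinates from
    \<open>N\<close> on are pinned to 0, and Tychonoff makes it compact.\<close>
  define K where "K = (\<Pi>\<^sub>E k\<in>UNIV. if k < N then {0..B} else {0::real})"
  define S where "S = K \<inter> {u. 1 / C \<le> pot P h N u}"
  have coord: "continuous_on T (\<lambda>u::nat\<Rightarrow>real. u k)" for T k
    by (rule continuous_on_subset[OF continuous_on_product_coordinates]) simp
  have contP: "continuous_on T (\<lambda>u::nat\<Rightarrow>real. P (u k))" for T k
    by (rule continuous_on_compose2[where f="\<lambda>u. u k" and g=P and t=UNIV and s=T, OF P_cont coord]) simp
  have cont_pot: "continuous_on T (pot P h N)" for T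
    unfolding pot_def
    by (intro continuous_on_sum continuous_on_mult continuous_on_const contP)
  have cont_kin: "continuous_on T (kin h N)" for T
    unfolding kin_def using h
    by (intro continuous_on_divide continuous_on_sum continuous_on_mult continuous_on_power
        continuous_on_diff continuous_on_const coord) auto
  have "compactin (product_topology (\<lambda>_. euclidean) UNIV) K"
    unfolding K_def by (subst compactin_PiE) (auto simp: compactin_euclidean_iff)
  then have "compact K"
    by (simp add: euclidean_product_topology compactin_euclidean_iff)
  moreover have "closed {u. 1 / C \<le> pot P h N u}"
    by (intro closed_Collect_le continuous_on_const cont_pot)
  ultimately have S: "compact S" unfolding S_def by (rule compact_Int_closed)
  have pos: "0 < pot P h N u" if "u \<in> S" for u
    using that C unfolding S_def by (auto intro: less_le_trans[of 0 "1 / C"])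
  have cont_J: "continuous_on S J"
    unfolding J_def using pos by (intro continuous_on_add continuous_on_divide continuous_on_const cont_kin cont_pot) (auto simp: less_le)
  have J_abs: "J (\<lambda>k. \<bar>v k\<bar>) \<le> J v" for v
    unfolding J_def using kin_abs[OF h, of N v] by (simp add: pot_abs)
  have in_S: "(\<lambda>k. \<bar>v k\<bar>) \<in> S"
    if v: "\<And>k. N \<le> k \<Longrightarrow> v k = 0" and pot_v: "0 < pot P h N v" and Jv: "J v \<le> C" for v
  proof -
    have kin_v: "kin h N v \<le> C" using Jv pot_v unfolding J_def by (smt (verit) zero_less_divide_1_iff)
    have "1 / pot P h N v \<le> C" using Jv kin_nonneg[OF h, of N v] by (simp add: J_def)
    then have "1 / C \<le> pot P h N v" using C pot_v by (simp add: field_simps)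
    moreover have "\<bar>v k\<bar> \<le> B" if k: "k < N" for k
    proof -
      have "(v k)\<^sup>2 \<le> 4 * kin h N v / (node h k)"
        using h k v[of N] by (intro discrete_strauss) auto
      also have "\<dots> \<le> 4 * C / (1 * h)"
        using kin_v h C by (intro frac_le mult_left_mono mult_right_mono) auto
      finally show ?thesis unfolding B_def by (intro real_le_rsqrt) simp
    qed
    ultimately show ?thesis using v by (auto simp: S_def K_def pot_abs)
  qed
  have "S \<noteq> {}" using in_S[OF u0 pot_u0] by (auto simp: C_def)
  then obtain u where u: "u \<in> S" and min: "\<And>v. v \<in> S \<Longrightarrow> J u \<le> J v"
    using continuous_attains_inf[OF S _ cont_J] by blast
  have uK: "u k \<in> (if k < N then {0..B} else {0})" for k
    using u by (auto simp: S_def K_def PiE_iff)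
  \<comment> \<open>Competitors outside the sublevel set of \<open>u0\<close> are already worse than
    \<open>u0\<close>.\<close>
  have glob: "J u \<le> J v" if "\<And>k. N \<le> k \<Longrightarrow> v k = 0" "0 < pot P h N v" for v
  proof (cases "J v \<le> C")
    case True
    then show ?thesis using min[OF in_S[OF that]] J_abs[of v] by simp
  next
    case False
    have "J u \<le> J u0" using min[OF in_S[OF u0 pot_u0]] J_abs[of u0] by (simp add: C_def)
    then show ?thesis using False by (simp add: C_def)
  qed
  show ?thesis
  proof (rule that[of u])
    show "0 \<le> u k" for k using uK[of k] by (auto split: if_splits)
    show "u k = 0" if "N \<le> k" for k using uK[of k] that by (auto split: if_splits)
    show "0 < pot P h N u" by (rule pos[OF u])
    show "kin h N u + 1 / pot P h N u \<le> kin h N u0 + 1 / pot P h N u0"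
      using glob[OF u0 pot_u0] by (simp add: J_def)
    show "kin h N u + 1 / pot P h N u \<le> kin h N v + 1 / pot P h N v"
      if "\<And>k. N \<le> k \<Longrightarrow> v k = 0" "0 < pot P h N v" for v
      using glob[OF that] by (simp add: J_def)
  qed
qed

text \<open>Varying all the values \<open>u j\<close> with \<open>j \<le> k\<close> simultaneously gives the Euler--Lagrange equation
  already in summed form.\<close>

lemma discrete_Euler_Lagrange:
  assumes h: "0 < h" and u: "\<And>k. N \<le> k \<Longrightarrow> u k = 0" and pot_u: "0 < pot P h N u"
    and min: "\<And>v. (\<And>k. N \<le> k \<Longrightarrow> v k = 0) \<Longrightarrow> 0 < pot P h N v \<Longrightarrow>
       kin h N u + 1 / pot P h N u \<le> kin h N v + 1 / pot P h N v"
    and k: "k < N"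
  shows "(node h k)\<^sup>2 * (u (Suc k) - u k) / h
     = - (1 / (pot P h N u)\<^sup>2) * (\<Sum>i\<le>k. h * (node h i)\<^sup>2 * f (u i))"
proof -
  \<comment> \<open>Only the difference across \<open>k\<close> changes under this variation, so the
    kinetic derivative collapses to one term while the potential derivative collects all cells up to
    \<open>k\<close>.\<close>
  define v where "v = (\<lambda>j. if j \<le> k then 1 else 0 :: real)"
  define w where "w = (\<lambda>s j. u j + s * v j)"
  define V' where "V' = (\<Sum>i<N. h * (node h i)\<^sup>2 * (f (u i) * v i))"
  define T' where "T' = (\<Sum>j<N. (node h j)\<^sup>2 * (2 * (u (Suc j) - u j) * (v (Suc j) - v j))) / (2 * h)"
  have w0: "w 0 = u" by (simp add: w_def)
  have dT: "((\<lambda>s. kin h N (w s)) has_real_derivative T') (at 0)"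
    unfolding kin_def T'_def w_def
  proof (intro DERIV_cdivide DERIV_sum DERIV_cmult)
    fix j
    show "((\<lambda>s. (u (Suc j) + s * v (Suc j) - (u j + s * v j))\<^sup>2) has_real_derivative
            2 * (u (Suc j) - u j) * (v (Suc j) - v j)) (at 0)"
      by (rule derivative_eq_intros refl | simp)+
  qed
  have dP: "((\<lambda>s. P (u i + s * v i)) has_real_derivative f (u i) * v i) (at 0)" for i
    by (rule DERIV_chain2[where f=P]) (auto intro!: derivative_eq_intros P_deriv)
  have dV: "((\<lambda>s. pot P h N (w s)) has_real_derivative V') (at 0)"
    unfolding pot_def V'_def w_def
    by (intro DERIV_sum DERIV_cmult dP)
  have dJ: "((\<lambda>s. kin h N (w s) + 1 / pot P h N (w s)) has_real_derivative T' - V' / (pot P h N u)\<^sup>2) (at 0)"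
    by (rule DERIV_cong[OF DERIV_add[OF dT DERIV_divide[OF DERIV_const dV]]])
      (use pot_u in \<open>auto simp: w0 power2_eq_square\<close>)
  \<comment> \<open>Positivity of V is stable under small variations, so \<open>w s\<close> is an
    admissible competitor near \<open>s = 0\<close>.\<close>
  have "((\<lambda>s. pot P h N (w s)) \<longlongrightarrow> pot P h N (w 0)) (at 0)"
    using DERIV_isCont[OF dV] by (simp add: isCont_def)
  then have "\<forall>\<^sub>F s in at 0. 0 < pot P h N (w s)"
    using pot_u by (auto simp: w0 dest: order_tendstoD)
  then obtain d where d: "0 < d" "\<And>s. s \<noteq> 0 \<Longrightarrow> \<bar>s\<bar> < d \<Longrightarrow> 0 < pot P h N (w s)"
    by (auto simp: eventually_at dist_real_def)
  have "T' - V' / (pot P h N u)\<^sup>2 = 0"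
  proof (rule DERIV_local_min[OF dJ d(1)], intro allI impI)
    fix s assume s: "\<bar>0 - s\<bar> < d"
    have "w s j = 0" if "N \<le> j" for j using that k u by (auto simp: w_def v_def)
    moreover have "0 < pot P h N (w s)" using d(2)[of s] s pot_u by (cases "s = 0") (auto simp: w0)
    ultimately show "kin h N (w 0) + 1 / pot P h N (w 0) \<le> kin h N (w s) + 1 / pot P h N (w s)"
      unfolding w0 by (intro min) auto
  qed
  moreover have "T' = - ((node h k)\<^sup>2 * (u (Suc k) - u k) / h)"
  proof -
    have "v (Suc j) - v j = (if j = k then -1 else 0)" for j by (auto simp: v_def)
    then have "T' = (\<Sum>j<N. if j = k then - ((node h j)\<^sup>2 * (2 * (u (Suc j) - u j))) else 0) / (2 * h)"
      unfolding T'_def by (intro arg_cong2[where f="(/)"] sum.cong refl) (auto simp: algebra_simps)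
    also have "\<dots> = - ((node h k)\<^sup>2 * (2 * (u (Suc k) - u k))) / (2 * h)"
      using k by (simp only: sum.delta finite_lessThan lessThan_iff if_True)
    also have "\<dots> = - ((node h k)\<^sup>2 * (u (Suc k) - u k) / h)"
      by (metis minus_divide_left mult.left_commute mult_divide_mult_cancel_left zero_neq_numeral)
    finally show ?thesis .
  qed
  moreover have "V' = (\<Sum>i\<le>k. h * (node h i)\<^sup>2 * f (u i))"
    unfolding V'_def using k by (intro sum.mono_neutral_cong_right) (auto simp: v_def)
  ultimately show ?thesis by simp
qed

end

section \<open>A plateau as competitor, and discrete states with uniform bounds\<close>

lemma sum_squares_ge: "real m ^ 3 / 3 \<le> (\<Sum>k<m. (real (Suc k))\<^sup>2)"
proof (induction m)
  case (Suc m)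
  then show ?case by (simp add: power2_eq_square power3_eq_cube algebra_simps)
qed simp

context nonlinearity
begin

text \<open>The plateau of height \<open>\<zeta>\<close> on [0, R] gives V a gain of order R^3; the
  linear descent on [R, R + 1] loses at most a multiple of (R + 1)^2. Neither bound involves
  \<open>n\<close>.\<close>

lemma test_sequence:
  fixes n R N :: nat and \<zeta> Pm :: real
  assumes n: "0 < n" and N: "Suc R * n \<le> N" and \<zeta>: "0 < \<zeta>" and Pm: "0 \<le> Pm"
    and P\<zeta>: "0 \<le> P \<zeta>" and low: "\<And>s. 0 \<le> s \<Longrightarrow> s \<le> \<zeta> \<Longrightarrow> - Pm \<le> P s"
  obtains u where "\<And>k. N \<le> k \<Longrightarrow> u k = 0"
    "kin (1 / n) N u \<le> (real R + 1)\<^sup>2 * \<zeta>\<^sup>2 / 2"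
    "P \<zeta> * real R ^ 3 / 3 - Pm * (real R + 1)\<^sup>2 \<le> pot P (1 / n) N u"
proof -
  define u where "u = (\<lambda>k. \<zeta> * max 0 (min 1 (real R + 1 - real k / n)))"
  have u_left: "u k = \<zeta>" if "k \<le> R * n" for k
  proof -
    have "real k \<le> real R * n" using that by (metis of_nat_le_iff of_nat_mult)
    then have "real k / n \<le> R" using n by (simp add: field_simps)
    then show ?thesis by (simp add: u_def)
  qed
  have u_right: "u k = 0" if "Suc R * n \<le> k" for k
  proof -
    have "real (Suc R) * n \<le> real k" using that by (metis of_nat_le_iff of_nat_mult)
    then have "real R + 1 \<le> real k / n" using n by (simp add: field_simps)
    then show ?thesis by (simp add: u_def)
  qed
  have u_range: "0 \<le> u k" "u k \<le> \<zeta>" for k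
    using \<zeta> by (auto simp: u_def mult_le_cancel_left1)
  have step: "(u (Suc k) - u k)\<^sup>2 \<le> (\<zeta> / n)\<^sup>2" for k
  proof -
    let ?m = "\<lambda>x::real. max 0 (min 1 x)"
    have m: "\<bar>?m x - ?m y\<bar> \<le> \<bar>x - y\<bar>" for x y by auto
    have "\<bar>u (Suc k) - u k\<bar> = \<zeta> * \<bar>?m (real R + 1 - real (Suc k) / n) - ?m (real R + 1 - real k / n)\<bar>"
      using \<zeta> by (simp add: u_def abs_mult flip: right_diff_distrib)
    also have "\<dots> \<le> \<zeta> * (1 / n)"
      using \<zeta> n m[of "real R + 1 - real (Suc k) / n" "real R + 1 - real k / n"]
      by (intro mult_left_mono) (auto simp: add_divide_distrib)
    finally have "\<bar>u (Suc k) - u k\<bar> \<le> \<bar>\<zeta> / n\<bar>" using \<zeta> by simp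
    then show ?thesis by (rule abs_le_square_iff[THEN iffD1])
  qed
  \<comment> \<open>The cells of the plateau and those of the descent; beyond them the sequence is
    0.\<close>
  let ?L = "{..<R * n}" and ?M = "{R * n..<Suc R * n}"
  have rad: "(node (1 / n) k)\<^sup>2 \<le> (real R + 1)\<^sup>2" if "k \<in> ?M" for k
  proof -
    have "Suc k \<le> Suc R * n" using that by simp
    then have "real (Suc k) \<le> (real R + 1) * n" by (metis of_nat_le_iff of_nat_mult of_nat_Suc add.commute)
    then have "node (1 / n) k \<le> real R + 1" using n by (simp add: field_simps)
    then show ?thesis by (intro power_mono) auto
  qed
  show ?thesis
  proof (rule that[of u])
    show "u k = 0" if "N \<le> k" for k using that N u_right by simp
    have "kin (1 / n) N u = (\<Sum>k\<in>?M. (node (1 / n) k)\<^sup>2 * (u (Suc k) - u k)\<^sup>2) / (2 * (1 / n))"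
      unfolding kin_def using N u_left u_right
      by (intro arg_cong2[where f="(/)"] sum.mono_neutral_right) (auto simp: not_less Suc_le_eq)
    also have "\<dots> \<le> (\<Sum>k\<in>?M. (real R + 1)\<^sup>2 * (\<zeta> / n)\<^sup>2) / (2 * (1 / n))"
      using rad step by (intro divide_right_mono sum_mono mult_mono) auto
    also have "\<dots> = (real R + 1)\<^sup>2 * \<zeta>\<^sup>2 / 2"
      using n by (simp add: field_simps power2_eq_square)
    finally show "kin (1 / n) N u \<le> (real R + 1)\<^sup>2 * \<zeta>\<^sup>2 / 2" .
    let ?w = "\<lambda>k. 1 / n * (node (1 / n) k)\<^sup>2"
    have "pot P (1 / n) N u = (\<Sum>k<Suc R * n. ?w k * P (u k))"
      unfolding pot_def using N u_right
      by (intro sum.mono_neutral_right) (auto simp: not_less P_0)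
    also have "{..<Suc R * n} = ?L \<union> ?M" by auto
    also have "(\<Sum>k\<in>?L \<union> ?M. ?w k * P (u k)) = (\<Sum>k\<in>?L. ?w k * P (u k)) + (\<Sum>k\<in>?M. ?w k * P (u k))"
      by (rule sum.union_disjoint) auto
    also have "\<dots> \<ge> P \<zeta> * real R ^ 3 / 3 + - Pm * (real R + 1)\<^sup>2"
    proof (rule add_mono)
      have "P \<zeta> * real R ^ 3 / 3 = P \<zeta> * (real (R * n) ^ 3 / 3) / n ^ 3"
        using n by (simp add: power_mult_distrib)
      also have "\<dots> \<le> P \<zeta> * (\<Sum>k<R * n. (real (Suc k))\<^sup>2) / n ^ 3"
        by (intro divide_right_mono mult_left_mono sum_squares_ge P\<zeta>) auto
      also have "\<dots> = (\<Sum>k\<in>?L. ?w k * P (u k))"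
        unfolding sum_distrib_left sum_divide_distrib
        by (rule sum.cong) (auto simp: u_left power2_eq_square power3_eq_cube mult_ac)
      finally show "P \<zeta> * real R ^ 3 / 3 \<le> (\<Sum>k\<in>?L. ?w k * P (u k))" .
      have "- Pm * (real R + 1)\<^sup>2 = (\<Sum>k\<in>?M. 1 / n * (real R + 1)\<^sup>2 * (- Pm))"
        using n by (simp add: field_simps)
      also have "\<dots> \<le> (\<Sum>k\<in>?M. ?w k * P (u k))"
      proof (rule sum_mono)
        fix k assume k: "k \<in> ?M"
        have "1 / n * (real R + 1)\<^sup>2 * (- Pm) \<le> ?w k * (- Pm)"
          using rad[OF k] Pm by (intro mult_right_mono_neg mult_left_mono) auto
        also have "\<dots> \<le> ?w k * P (u k)"
          by (intro mult_left_mono low u_range) auto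
        finally show "1 / n * (real R + 1)\<^sup>2 * (- Pm) \<le> ?w k * P (u k)" .
      qed
      finally show "- Pm * (real R + 1)\<^sup>2 \<le> (\<Sum>k\<in>?M. ?w k * P (u k))" .
    qed
    finally show "P \<zeta> * real R ^ 3 / 3 - Pm * (real R + 1)\<^sup>2 \<le> pot P (1 / n) N u" by simp
  qed
qed

text \<open>Mesh \<open>1 / n\<close> with \<open>n * n\<close> cells covers [0, n], so a single
  parameter both refines the mesh and exhausts the half line.\<close>

definition discrete_state :: "real \<Rightarrow> nat \<Rightarrow> (nat \<Rightarrow> real) \<Rightarrow> bool" where
  "discrete_state C n u \<longleftrightarrow> 0 < n \<and> (\<forall>k. 0 \<le> u k) \<and> (\<forall>k\<ge>n * n. u k = 0) \<and>
     kin (1 / n) (n * n) u \<le> C \<and> 1 / C \<le> pot P (1 / n) (n * n) u \<and>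
     (\<forall>k<n * n. (node (1 / n) k)\<^sup>2 * (u (Suc k) - u k) / (1 / n)
        = - (1 / (pot P (1 / n) (n * n) u)\<^sup>2) * (\<Sum>i\<le>k. 1 / n * (node (1 / n) i)\<^sup>2 * f (u i)))"

text \<open>\<open>R < n\<close> makes room for the competitor, whose support ends at
  \<open>Suc R * n\<close>. Comparison with it gives a \<open>C\<close> free of \<open>n\<close>,
  which bounds T directly and, through 1 / V, bounds V from below.\<close>

lemma discrete_solution:
  fixes n R :: nat and \<zeta> Pm v0 :: real
  defines "C \<equiv> (real R + 1)\<^sup>2 * \<zeta>\<^sup>2 / 2 + 1 / v0"
  assumes n: "R < n" and \<zeta>: "0 < \<zeta>" and Pm: "0 \<le> Pm"
    and low: "\<And>s. 0 \<le> s \<Longrightarrow> s \<le> \<zeta> \<Longrightarrow> - Pm \<le> P s"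
    and v0: "0 < v0" "v0 \<le> P \<zeta> * real R ^ 3 / 3 - Pm * (real R + 1)\<^sup>2"
  obtains u where "discrete_state C n u"
proof -
  let ?h = "1 / real n" and ?N = "n * n"
  have h: "0 < ?h" using n by simp
  have "0 \<le> Pm * (real R + 1)\<^sup>2" using Pm by simp
  then have "0 < P \<zeta> * real R ^ 3 / 3" using v0 by linarith
  then have P\<zeta>: "0 \<le> P \<zeta>" by (simp add: zero_less_mult_iff)
  obtain u0 where u0: "\<And>k. ?N \<le> k \<Longrightarrow> u0 k = 0"
    "kin ?h ?N u0 \<le> (real R + 1)\<^sup>2 * \<zeta>\<^sup>2 / 2"
    "P \<zeta> * real R ^ 3 / 3 - Pm * (real R + 1)\<^sup>2 \<le> pot P ?h ?N u0"
    using test_sequence[of n R ?N \<zeta> Pm] n \<zeta> Pm P\<zeta> low by (metis Suc_leI gr_zeroI less_zeroE mult_le_mono1)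
  have pot_u0: "v0 \<le> pot P ?h ?N u0" using u0(3) v0 by linarith
  then have pot_u0': "0 < pot P ?h ?N u0" using v0 by linarith
  have J0: "kin ?h ?N u0 + 1 / pot P ?h ?N u0 \<le> C"
    unfolding C_def using u0(2) pot_u0 v0 by (intro add_mono divide_left_mono) auto
  obtain u where u: "\<And>k. 0 \<le> u k" "\<And>k. ?N \<le> k \<Longrightarrow> u k = 0" "0 < pot P ?h ?N u"
    "kin ?h ?N u + 1 / pot P ?h ?N u \<le> kin ?h ?N u0 + 1 / pot P ?h ?N u0"
    "\<And>v. (\<And>k. ?N \<le> k \<Longrightarrow> v k = 0) \<Longrightarrow> 0 < pot P ?h ?N v \<Longrightarrow>
       kin ?h ?N u + 1 / pot P ?h ?N u \<le> kin ?h ?N v + 1 / pot P ?h ?N v"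
    using exists_minimizer[OF h u0(1) pot_u0'] by metis
  have J: "kin ?h ?N u + 1 / pot P ?h ?N u \<le> C" using u(4) J0 by linarith
  have C: "0 < C" unfolding C_def using v0 by (intro add_nonneg_pos) auto
  have "discrete_state C n u"
    unfolding discrete_state_def
  proof (intro conjI allI impI)
    have "0 < 1 / pot P ?h ?N u" using u(3) by simp
    then show "kin ?h ?N u \<le> C" using J by linarith
    have "1 / pot P ?h ?N u \<le> C" using J kin_nonneg[OF h, of ?N u] by linarith
    then show "1 / C \<le> pot P ?h ?N u" using u(3) C by (simp add: field_simps)
  qed (use n u(1,2) discrete_Euler_Lagrange[OF h u(2,3,5)] in auto)
  then show ?thesis by (rule that)
qed

end

section \<open>Passage to the limit\<close>

text \<open>Grid sequences are read as step functions, constant on the half-open cells from k / n to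
  (k + 1) / n, so that sums over the grid are exact integrals.\<close>

definition cell :: "nat \<Rightarrow> real \<Rightarrow> nat" where
  "cell n t = nat \<lfloor>t * real n\<rfloor>"

definition radius :: "nat \<Rightarrow> real \<Rightarrow> real" where
  "radius n t = real (Suc (cell n t)) * (1 / real n)"

definition slope :: "(nat \<Rightarrow> real) \<Rightarrow> nat \<Rightarrow> real \<Rightarrow> real" where
  "slope u n t = real n * (u (Suc (cell n t)) - u (cell n t))"

lemma cell_le: "0 \<le> t \<Longrightarrow> real (cell n t) \<le> t * real n"
  unfolding cell_def by (simp add: of_nat_floor)

lemma less_Suc_cell: "t * real n < real (Suc (cell n t))"
  unfolding cell_def by linarith

lemma cell_0 [simp]: "cell n 0 = 0"
  by (simp add: cell_def)

lemma cell_mono: "t \<le> t' \<Longrightarrow> cell n t \<le> cell n t'"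
  unfolding cell_def by (intro nat_mono floor_mono mult_right_mono) auto

lemma cell_eqI: "real k \<le> t * real n \<Longrightarrow> t * real n < real k + 1 \<Longrightarrow> cell n t = k"
  unfolding cell_def by (metis floor_unique nat_int of_int_of_nat_eq)

lemma radius_bounds:
  assumes "0 < n" "0 \<le> t"
  shows "t < radius n t" "radius n t \<le> t + 1 / real n" "0 < radius n t" "radius n t \<le> t + 1"
proof -
  show 1: "t < radius n t"
    using less_Suc_cell[of t n] assms by (simp add: radius_def field_simps)
  show 2: "radius n t \<le> t + 1 / real n"
    using cell_le[of t n] assms by (simp add: radius_def field_simps)
  show "0 < radius n t" using 1 assms by linarith
  have "1 / real n \<le> 1" using assms by simp
  then show "radius n t \<le> t + 1" using 2 by linarith
qed

lemma step_has_integral: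
  fixes \<phi> :: "nat \<Rightarrow> real"
  assumes n: "0 < n"
  shows "((\<lambda>t. \<phi> (cell n t)) has_integral (\<Sum>k<m. \<phi> k) / real n) {0..real m / real n}"
proof (induction m)
  case 0
  then show ?case by (simp add: has_integral_refl)
next
  case (Suc m)
  have "((\<lambda>t. \<phi> m) has_integral (real (Suc m) / n - real m / n) *\<^sub>R \<phi> m) {real m / n..real (Suc m) / n}"
    using has_integral_const_real[of "\<phi> m" "real m / n" "real (Suc m) / n"]
    by (simp add: divide_right_mono)
  then have "((\<lambda>t. \<phi> (cell n t)) has_integral (real (Suc m) / n - real m / n) *\<^sub>R \<phi> m) {real m / n..real (Suc m) / n}"
  proof (rule has_integral_spike_finite[rotated 2])
    \<comment> \<open>The right end point belongs to the next cell, where the step function takes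
      another value.\<close>
    show "finite {real (Suc m) / n}" by simp
    fix t assume t: "t \<in> {real m / n..real (Suc m) / n} - {real (Suc m) / n}"
    then have "real m / n \<le> t" "t < real (Suc m) / n" by auto
    then have "cell n t = m" using n by (intro cell_eqI) (auto simp: field_simps)
    then show "\<phi> (cell n t) = \<phi> m" by simp
  qed
  then have "((\<lambda>t. \<phi> (cell n t)) has_integral \<phi> m / n) {real m / n..real (Suc m) / n}"
    by (simp add: diff_divide_distrib[symmetric])
  from has_integral_combine[OF _ _ Suc this]
  show ?case by (simp add: add_divide_distrib divide_right_mono)
qed

lemma step_integrable:
  fixes \<phi> :: "nat \<Rightarrow> real"
  assumes n: "0 < n" and a: "0 \<le> a"
  shows "(\<lambda>t. \<phi> (cell n t)) integrable_on {a..b}"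
proof -
  define m where "m = nat \<lceil>b * n\<rceil>"
  have "b * n \<le> m" unfolding m_def by linarith
  then have "b \<le> real m / n" using n by (simp add: field_simps)
  then have "{a..b} \<subseteq> {0..real m / n}" using a by auto
  moreover have "(\<lambda>t. \<phi> (cell n t)) integrable_on {0..real m / n}"
    using step_has_integral[OF n] by blast
  ultimately show ?thesis using integrable_on_subinterval by blast
qed

lemma integral_step:
  fixes \<phi> :: "nat \<Rightarrow> real"
  assumes n: "0 < n"
  shows "integral {0..real m / real n} (\<lambda>t. \<phi> (cell n t)) = (\<Sum>k<m. \<phi> k) / real n"
  using step_has_integral[OF n] by (rule integral_unique)

lemma abs_integral_le:
  fixes g :: "real \<Rightarrow> real"
  assumes "g integrable_on {a..b}" "a \<le> b" "\<And>x. a \<le> x \<Longrightarrow> x \<le> b \<Longrightarrow> \<bar>g x\<bar> \<le> B"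
  shows "\<bar>integral {a..b} g\<bar> \<le> B * (b - a)"
proof -
  have "0 \<le> B" using assms(2) assms(3)[of a] by linarith
  then show ?thesis
    using has_integral_bound_real[OF _ _ integrable_integral[OF assms(1)], of B "{}"] assms by auto
qed

section \<open>Estimates on discrete states that are uniform in the grid\<close>

context nonlinearity
begin

text \<open>The derivative of 1 / V with respect to V, up to sign; in the limit it becomes the
  Lagrange multiplier.\<close>

definition multiplier :: "nat \<Rightarrow> (nat \<Rightarrow> real) \<Rightarrow> real" where
  "multiplier n u = 1 / (pot P (1 / n) (n * n) u)\<^sup>2"

definition mass_bound :: "real \<Rightarrow> real" where
  "mass_bound C = (C0 + c) * (4 * C * (4 * C / \<epsilon>\<^sup>2)\<^sup>2)"

context
  fixes C :: real and n :: nat and u :: "nat \<Rightarrow> real"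
  assumes C: "0 < C" and u: "discrete_state C n u"
begin

private lemma n: "0 < n" and u0: "0 \<le> u k" and uN: "n * n \<le> k \<Longrightarrow> u k = 0"
  and kinC: "kin (1 / n) (n * n) u \<le> C" and potC: "1 / C \<le> pot P (1 / n) (n * n) u"
  using u by (auto simp: discrete_state_def)

private lemma h: "0 < 1 / real n"
  using n by simp

lemma discrete_mass:
  "pot P (1 / n) (n * n) u + c * (\<Sum>k<n * n. 1 / n * (node (1 / n) k)\<^sup>2 * (u k)\<^sup>2) \<le> mass_bound C"
  unfolding mass_bound_def by (rule pot_mass_bound[OF h uN kinC]) simp

text \<open>V lies between \<open>1 / C\<close> and \<open>mass_bound C\<close>. The lower bound on
  the multiplier survives the limit and makes \<open>\<mu>\<close> positive.\<close>

lemma multiplier_bounds: "0 < multiplier n u" "multiplier n u \<le> C\<^sup>2" "1 / (mass_bound C)\<^sup>2 \<le> multiplier n u" "0 < mass_bound C"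
proof -
  have p: "0 < pot P (1 / n) (n * n) u" using potC C by (meson less_le_trans zero_less_divide_1_iff)
  then show "0 < multiplier n u" by (simp add: multiplier_def)
  have "1 / pot P (1 / n) (n * n) u \<le> C" using potC C p by (simp add: field_simps)
  then have "(1 / pot P (1 / n) (n * n) u)\<^sup>2 \<le> C\<^sup>2" using p by (intro power_mono) auto
  then show "multiplier n u \<le> C\<^sup>2" by (simp add: multiplier_def power_divide)
  have "0 \<le> c * (\<Sum>k<n * n. 1 / n * (node (1 / n) k)\<^sup>2 * (u k)\<^sup>2)"
    using c_pos by (intro mult_nonneg_nonneg sum_nonneg) auto
  then have le: "pot P (1 / n) (n * n) u \<le> mass_bound C" using discrete_mass by linarith
  then show "0 < mass_bound C" using p by linarith
  show "1 / (mass_bound C)\<^sup>2 \<le> multiplier n u"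
    unfolding multiplier_def using le p by (intro divide_left_mono power_mono) auto
qed

lemma increment_eq:
  assumes "k < n * n"
  shows "real n * (u (Suc k) - u k) = - multiplier n u / (node (1 / n) k)\<^sup>2 *
     ((\<Sum>i<Suc k. (node (1 / n) i)\<^sup>2 * f (u i)) / n)"
proof -
  let ?r = "node (1 / n) k"
  have r: "0 < ?r\<^sup>2" using n by simp
  have "?r\<^sup>2 * (u (Suc k) - u k) / (1 / n) = - multiplier n u * (\<Sum>i\<le>k. 1 / n * (node (1 / n) i)\<^sup>2 * f (u i))"
    using u assms unfolding discrete_state_def multiplier_def by blast
  also have "(\<Sum>i\<le>k. 1 / n * (node (1 / n) i)\<^sup>2 * f (u i))
      = (\<Sum>i<Suc k. (node (1 / n) i)\<^sup>2 * f (u i)) / n"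
    by (simp add: sum_divide_distrib lessThan_Suc_atMost del: sum.lessThan_Suc)
  finally have "?r\<^sup>2 * (real n * (u (Suc k) - u k))
      = - multiplier n u * ((\<Sum>i<Suc k. (node (1 / n) i)\<^sup>2 * f (u i)) / n)"
    by (simp add: mult_ac)
  then have "real n * (u (Suc k) - u k)
      = - multiplier n u * ((\<Sum>i<Suc k. (node (1 / n) i)\<^sup>2 * f (u i)) / n) / ?r\<^sup>2"
    using r by (metis less_irrefl nonzero_mult_div_cancel_left)
  then show ?thesis by simp
qed

text \<open>The \<open>k + 1\<close> summands are at most \<open>r^2 F\<close> each and
  \<open>(k + 1) / n\<close> is r itself, so division by \<open>r^2\<close> leaves one factor r.
  Slopes are thus bounded on bounded intervals, and at the origin they are of the size of the
  mesh.\<close>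

lemma increment_bound: "real n * \<bar>u (Suc k) - u k\<bar> \<le> C\<^sup>2 * F * (node (1 / n) k)"
proof (cases "k < n * n")
  case True
  let ?r = "node (1 / n) k"
  have r: "0 < ?r" using n by simp
  have "\<bar>\<Sum>i<Suc k. (node (1 / n) i)\<^sup>2 * f (u i)\<bar> \<le> (\<Sum>i<Suc k. ?r\<^sup>2 * F)"
  proof (rule order_trans[OF sum_abs sum_mono])
    fix i assume "i \<in> {..<Suc k}"
    then have "(node (1 / n) i)\<^sup>2 \<le> ?r\<^sup>2"
      by (intro power_mono mult_right_mono) auto
    then show "\<bar>(node (1 / n) i)\<^sup>2 * f (u i)\<bar> \<le> ?r\<^sup>2 * F"
      unfolding abs_mult using f_bound[of "u i"] by (intro mult_mono) auto
  qed
  also have "\<dots> / n = ?r\<^sup>2 * (F * ?r)" by simp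
  finally have S: "\<bar>\<Sum>i<Suc k. (node (1 / n) i)\<^sup>2 * f (u i)\<bar> / n \<le> ?r\<^sup>2 * (F * ?r)"
    by (simp add: divide_right_mono)
  have "real n * \<bar>u (Suc k) - u k\<bar> = \<bar>real n * (u (Suc k) - u k)\<bar>" by (simp add: abs_mult)
  also have "\<dots> = multiplier n u / ?r\<^sup>2 * (\<bar>\<Sum>i<Suc k. (node (1 / n) i)\<^sup>2 * f (u i)\<bar> / n)"
    unfolding increment_eq[OF True] using multiplier_bounds by (simp add: abs_mult del: sum.lessThan_Suc)
  also have "\<dots> \<le> multiplier n u / ?r\<^sup>2 * (?r\<^sup>2 * (F * ?r))"
    using multiplier_bounds by (intro mult_left_mono S) auto
  also have "\<dots> = multiplier n u * (F * ?r)" using r by simp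
  also have "\<dots> \<le> C\<^sup>2 * (F * ?r)"
    using multiplier_bounds F_nonneg r by (intro mult_right_mono) auto
  finally show ?thesis by (simp add: mult_ac)
next
  case False
  then show ?thesis using uN[of k] uN[of "Suc k"] F_nonneg by simp
qed

lemma slope_bound: "0 \<le> t \<Longrightarrow> \<bar>slope u n t\<bar> \<le> C\<^sup>2 * F * radius n t"
  using increment_bound[of "cell n t"] by (simp add: slope_def radius_def abs_mult)

text \<open>The restriction \<open>t < n\<close> keeps the cell of \<open>t\<close> inside the grid,
  where the Euler--Lagrange equation is available.\<close>

lemma slope_eq:
  assumes t: "0 \<le> t" "t < real n"
  shows "slope u n t = - multiplier n u / (radius n t)\<^sup>2 *
    integral {0..radius n t} (\<lambda>x. (radius n x)\<^sup>2 * f (u (cell n x)))"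
proof -
  have "real (cell n t) < real n * real n"
    using cell_le[OF t(1), of n] t n by (smt (verit) mult_strict_right_mono of_nat_0_less_iff)
  then have "cell n t < n * n" by (metis of_nat_less_iff of_nat_mult)
  from increment_eq[OF this] show ?thesis
    using integral_step[OF n, of "Suc (cell n t)" "\<lambda>k. (node (1 / n) k)\<^sup>2 * f (u k)"]
    by (simp add: slope_def radius_def del: sum.lessThan_Suc)
qed

lemma increment_integral:
  "u (cell n t) = u 0 + integral {0..real (cell n t) / n} (slope u n)"
proof -
  have "integral {0..real (cell n t) / n} (slope u n) = (\<Sum>k<cell n t. real n * (u (Suc k) - u k)) / n"
    unfolding slope_def by (rule integral_step[OF n, of "cell n t" "\<lambda>k. real n * (u (Suc k) - u k)"])
  also have "\<dots> = (\<Sum>k<cell n t. u (Suc k) - u k)"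
    using n by (simp add: sum_distrib_left[symmetric])
  finally show ?thesis by (simp add: sum_lessThan_telescope)
qed

text \<open>Equicontinuity up to one mesh width: step functions jump, which costs the extra
  \<open>1 / n\<close>.\<close>

lemma step_lipschitz:
  assumes t: "0 \<le> t" "t \<le> t'"
  shows "\<bar>u (cell n t') - u (cell n t)\<bar> \<le> C\<^sup>2 * F * t' * (t' - t + 1 / n)"
proof -
  have le: "cell n t \<le> cell n t'" using t by (intro cell_mono)
  have c': "real (cell n t') \<le> t' * n" using t by (intro cell_le) auto
  have t'0: "0 \<le> t'" using t by linarith
  have "\<bar>u (cell n t') - u (cell n t)\<bar> = \<bar>\<Sum>k=cell n t..<cell n t'. u (Suc k) - u k\<bar>"
    using sum_Suc_diff'[OF le, of u] by simp
  also have "\<dots> \<le> (\<Sum>k=cell n t..<cell n t'. C\<^sup>2 * F * t' / n)"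
  proof (rule order_trans[OF sum_abs sum_mono])
    fix k assume "k \<in> {cell n t..<cell n t'}"
    then have "real (Suc k) \<le> t' * n" using c' by simp
    then have "node (1 / n) k \<le> t'" using n by (simp add: field_simps)
    then have "real n * \<bar>u (Suc k) - u k\<bar> \<le> C\<^sup>2 * F * t'"
      using order_trans[OF increment_bound mult_left_mono] F_nonneg by simp
    then show "\<bar>u (Suc k) - u k\<bar> \<le> C\<^sup>2 * F * t' / n" using n by (simp add: field_simps)
  qed
  also have "\<dots> = real (cell n t' - cell n t) * (C\<^sup>2 * F * t' / n)" by simp
  also have "\<dots> \<le> (n * (t' - t) + 1) * (C\<^sup>2 * F * t' / n)"
  proof (rule mult_right_mono)
    show "real (cell n t' - cell n t) \<le> n * (t' - t) + 1"
      using c' less_Suc_cell[of t n] le by (simp add: of_nat_diff algebra_simps)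
  qed (use F_nonneg t'0 in auto)
  also have "\<dots> = C\<^sup>2 * F * t' * (t' - t + 1 / n)" using n by (simp add: field_simps)
  finally show ?thesis .
qed

lemma step_decay: "0 \<le> t \<Longrightarrow> (u (cell n t))\<^sup>2 \<le> 4 * C / radius n t"
proof (cases "cell n t < n * n")
  case True
  assume t: "0 \<le> t"
  have "(u (cell n t))\<^sup>2 \<le> 4 * kin (1 / n) (n * n) u / (real (Suc (cell n t)) * (1 / n))"
    by (rule discrete_strauss[OF h True]) (simp add: uN)
  also have "\<dots> \<le> 4 * C / (real (Suc (cell n t)) * (1 / n))"
    using kinC n by (intro divide_right_mono) auto
  finally show ?thesis by (simp add: radius_def)
next
  case False
  assume "0 \<le> t"
  then show ?thesis using False uN[of "cell n t"] C radius_bounds(3)[OF n, of t] by simp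
qed

text \<open>Strauss' inequality degenerates at the origin; it bounds the value at 1, and
  \<open>step_lipschitz\<close> carries that bound back to [0, 1].\<close>

lemma step_bound: "0 \<le> t \<Longrightarrow> \<bar>u (cell n t)\<bar> \<le> sqrt (4 * C) + 2 * C\<^sup>2 * F"
proof -
  have far: "\<bar>u (cell n x)\<bar> \<le> sqrt (4 * C)" if "1 \<le> x" for x
  proof -
    have "(u (cell n x))\<^sup>2 \<le> 4 * C / radius n x" using that by (intro step_decay) auto
    also have "\<dots> \<le> 4 * C / 1"
      using radius_bounds(1)[OF n, of x] that C by (intro divide_left_mono) auto
    finally show ?thesis by (intro real_le_rsqrt) simp
  qed
  assume t: "0 \<le> t"
  show ?thesis
  proof (cases "1 \<le> t")
    case True
    then show ?thesis using far[OF True] F_nonneg by (simp add: add_increasing2)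
  next
    case False
    then have "\<bar>u (cell n 1) - u (cell n t)\<bar> \<le> C\<^sup>2 * F * 1 * (1 - t + 1 / n)"
      using t by (intro step_lipschitz) auto
    also have "\<dots> \<le> C\<^sup>2 * F * 1 * 2"
    proof -
      have "1 / real n \<le> 1" using n by simp
      then show ?thesis using t F_nonneg by (intro mult_left_mono) auto
    qed
    finally show ?thesis using far[of 1] by simp
  qed
qed

lemma sum_le_total:
  fixes \<phi> :: "nat \<Rightarrow> real"
  assumes "\<And>k. 0 \<le> \<phi> k" "\<And>k. n * n \<le> k \<Longrightarrow> \<phi> k = 0"
  shows "(\<Sum>k<m. \<phi> k) \<le> (\<Sum>k<n * n. \<phi> k)"
proof -
  have "(\<Sum>k<m. \<phi> k) = (\<Sum>k\<in>{..<m} \<inter> {..<n * n}. \<phi> k)"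
    using assms(2) by (intro sum.mono_neutral_right) (auto simp: not_less intro: leI)
  also have "\<dots> \<le> (\<Sum>k<n * n. \<phi> k)" using assms(1) by (intro sum_mono2) auto
  finally show ?thesis .
qed

lemma step_mass: "integral {0..real X} (\<lambda>x. (radius n x)\<^sup>2 * (u (cell n x))\<^sup>2) \<le> mass_bound C / c"
proof -
  let ?\<phi> = "\<lambda>k. (node (1 / n) k)\<^sup>2 * (u k)\<^sup>2"
  have "integral {0..real X} (\<lambda>x. ?\<phi> (cell n x)) = (\<Sum>k<X * n. ?\<phi> k) / n"
    using integral_step[OF n, of "X * n" ?\<phi>] n by simp
  also have "\<dots> \<le> (\<Sum>k<n * n. ?\<phi> k) / n"
    using uN by (intro divide_right_mono sum_le_total) auto
  also have "\<dots> = (\<Sum>k<n * n. 1 / n * (node (1 / n) k)\<^sup>2 * (u k)\<^sup>2)"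
    by (simp add: sum_divide_distrib)
  also have "\<dots> \<le> mass_bound C / c"
  proof -
    have "0 \<le> pot P (1 / n) (n * n) u" using potC C by (meson less_imp_le less_le_trans zero_less_divide_1_iff)
    then have "c * (\<Sum>k<n * n. 1 / n * (node (1 / n) k)\<^sup>2 * (u k)\<^sup>2) \<le> mass_bound C"
      using discrete_mass by linarith
    then show ?thesis using c_pos by (simp add: pos_le_divide_eq mult.commute)
  qed
  finally show ?thesis by (simp add: radius_def)
qed

lemma step_kin: "integral {0..real X} (\<lambda>x. (radius n x)\<^sup>2 * (slope u n x)\<^sup>2) \<le> 2 * C"
proof -
  let ?\<phi> = "\<lambda>k. (node (1 / n) k)\<^sup>2 * (real n * (u (Suc k) - u k))\<^sup>2"
  have "integral {0..real X} (\<lambda>x. ?\<phi> (cell n x)) = (\<Sum>k<X * n. ?\<phi> k) / n"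
    using integral_step[OF n, of "X * n" ?\<phi>] n by simp
  also have "\<dots> \<le> (\<Sum>k<n * n. ?\<phi> k) / n"
    using uN by (intro divide_right_mono sum_le_total) auto
  also have "\<dots> = 2 * kin (1 / n) (n * n) u"
    unfolding kin_def sum_divide_distrib sum_distrib_left
    using n by (intro sum.cong refl) (simp add: field_simps power2_eq_square)
  also have "\<dots> \<le> 2 * C" using kinC by simp
  finally show ?thesis by (simp add: radius_def slope_def)
qed

text \<open>Beyond \<open>X\<close> all values are at most \<open>\<epsilon>\<close> and add nothing
  positive to V, so \<open>V >= 1 / C\<close> forces mass into a fixed ball. This prevents the limit
  from being 0.\<close>

lemma step_nontrivial:
  assumes X: "4 * C / \<epsilon>\<^sup>2 \<le> real X"
  shows "1 / C \<le> (C0 + c) * integral {0..real X} (\<lambda>x. (radius n x)\<^sup>2 * (u (cell n x))\<^sup>2)"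
proof -
  let ?\<phi> = "\<lambda>k. (node (1 / n) k)\<^sup>2 * (u k)\<^sup>2"
  let ?w = "\<lambda>k. 1 / n * (node (1 / n) k)\<^sup>2"
  have small: "\<bar>u k\<bar> \<le> \<epsilon>" if "\<not> k < X * n" for k
  proof (rule ccontr)
    assume large: "\<not> \<bar>u k\<bar> \<le> \<epsilon>"
    have "k < n * n"
    proof (rule ccontr)
      assume "\<not> k < n * n"
      then have "u k = 0" using uN by simp
      with large \<epsilon>_pos show False by simp
    qed
    then have "node (1 / n) k < 4 * C / \<epsilon>\<^sup>2"
      using large kinC uN by (intro large_values_near_origin[OF h]) auto
    then have "node (1 / n) k < real X" using X by linarith
    then have "real (Suc k) < real X * real n" using n by (simp add: field_simps)
    then have "Suc k < X * n" by (metis of_nat_less_iff of_nat_mult)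
    with that show False by simp
  qed
  have "1 / C \<le> pot P (1 / n) (n * n) u" by (rule potC)
  also have "\<dots> \<le> (\<Sum>k<n * n. ?w k * (if k < X * n then (C0 + c) * (u k)\<^sup>2 else 0))"
    unfolding pot_def
  proof (intro sum_mono mult_left_mono)
    fix k
    have "0 \<le> c * (u k)\<^sup>2" "0 \<le> (C0 + c) * (u k)\<^sup>2" using c_pos C0_nonneg by auto
    then show "P (u k) \<le> (if k < X * n then (C0 + c) * (u k)\<^sup>2 else 0)"
      using P_split[of "u k"] small[of k] by (auto split: if_splits)
  qed auto
  also have "\<dots> = (\<Sum>k\<in>{..<n * n} \<inter> {..<X * n}. (C0 + c) / n * ?\<phi> k)"
    by (rule sum.mono_neutral_cong_right) auto
  also have "\<dots> \<le> (\<Sum>k<X * n. (C0 + c) / n * ?\<phi> k)"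
    using c_pos C0_nonneg by (intro sum_mono2) auto
  also have "\<dots> = (C0 + c) * integral {0..real X} (\<lambda>x. ?\<phi> (cell n x))"
    using integral_step[OF n, of "X * n" ?\<phi>] n by (simp add: sum_distrib_left sum_divide_distrib)
  finally show ?thesis by (simp add: radius_def)
qed

end

end

text \<open>The equation is kept in integral form because that is what passes to the limit;
  derivatives are recovered afterwards. At \<open>r = 0\<close> division by zero makes
  \<open>v_eq\<close> say \<open>v 0 = 0\<close>.\<close>

locale radial_flow =
  fixes P f u v :: "real \<Rightarrow> real" and \<mu> F :: real
  assumes \<mu>: "0 < \<mu>"
    and P_der: "\<And>s. (P has_real_derivative f s) (at s)"
    and f_continuous: "continuous_on UNIV f"
    and f_le: "\<And>s. \<bar>f s\<bar> \<le> F"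
    and u_cont: "continuous_on {0..} u"
    and v_eq: "\<And>r. 0 \<le> r \<Longrightarrow> v r = - \<mu> / r\<^sup>2 * integral {0..r} (\<lambda>s. s\<^sup>2 * f (u s))"
    and u_eq: "\<And>r. 0 \<le> r \<Longrightarrow> u r = u 0 + integral {0..r} v"

text \<open>The a priori bounds that the limit inherits. The mass bounds live on bounded intervals
  with a common \<open>B\<close>, the form in which dominated convergence delivers them.\<close>

locale decaying_flow = radial_flow +
  fixes C B :: real
  assumes \<mu>_le: "\<mu> \<le> C\<^sup>2"
    and u_nonneg: "\<And>r. 0 \<le> r \<Longrightarrow> 0 \<le> u r"
    and u_decay: "\<And>r. 0 < r \<Longrightarrow> (u r)\<^sup>2 \<le> 4 * C / r"
    and u_mass: "\<And>X::nat. integral {0..real X} (\<lambda>r. r\<^sup>2 * (u r)\<^sup>2) \<le> B"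
    and v_mass: "\<And>X::nat. integral {0..real X} (\<lambda>r. r\<^sup>2 * (v r)\<^sup>2) \<le> B"
    and u_nontrivial: "\<exists>r\<ge>0. u r \<noteq> 0"

section \<open>Extraction of a limit profile\<close>

context nonlinearity
begin

theorem radial_limit:
  fixes R :: nat and \<zeta> Pm v0 :: real
  defines "C \<equiv> (real R + 1)\<^sup>2 * \<zeta>\<^sup>2 / 2 + 1 / v0"
  assumes \<zeta>: "0 < \<zeta>" and Pm: "0 \<le> Pm"
    and low: "\<And>s. 0 \<le> s \<Longrightarrow> s \<le> \<zeta> \<Longrightarrow> - Pm \<le> P s"
    and v0: "0 < v0" "v0 \<le> P \<zeta> * real R ^ 3 / 3 - Pm * (real R + 1)\<^sup>2"
  obtains u v \<mu> B where "decaying_flow P f u v \<mu> F C B"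
proof -
  have C: "0 < C" unfolding C_def using v0 by (intro add_nonneg_pos) auto
  \<comment> \<open>Shifted so that every grid satisfies \<open>R < n\<close>.\<close>
  define nn where "nn = (\<lambda>m. m + Suc R)"
  have "\<exists>w. discrete_state C (nn m) w" for m
    by (rule discrete_solution[OF _ \<zeta> Pm _ v0, folded C_def, of "nn m"])
      (use low in \<open>auto simp: nn_def\<close>)
  then obtain U where U: "\<And>m. discrete_state C (nn m) (U m)" by metis
  have nn: "0 < nn m" for m by (simp add: nn_def)
  define st where "st = (\<lambda>m t. U m (cell (nn m) t))"
  define M where "M = sqrt (4 * C) + 2 * C\<^sup>2 * F"
  define L where "L = C\<^sup>2 * F"
  have L0: "0 \<le> L" using F_nonneg by (simp add: L_def)
  have st_bound: "\<bar>st m t\<bar> \<le> M" if "0 \<le> t" for m t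
    unfolding st_def M_def by (rule step_bound[OF C U that])
  have multiplier_abs: "\<bar>multiplier (nn m) (U m)\<bar> \<le> C\<^sup>2" for m
    using multiplier_bounds(1,2)[OF C U, of m] by simp
  \<comment> \<open>The multipliers ride along at negative arguments, so one diagonal extraction
    over the rationals makes both them and the step functions converge.\<close>
  define Fs where "Fs = (\<lambda>m x. if x < 0 then multiplier (nn m) (U m) else st m x)"
  have "norm (Fs m x) \<le> max M (C\<^sup>2)" for m x
    using st_bound[of x m] multiplier_abs[of m] by (auto simp: Fs_def)
  then obtain \<kappa> where \<kappa>: "strict_mono (\<kappa>::nat\<Rightarrow>nat)" and \<kappa>_conv: "\<And>x. x \<in> \<rat> \<Longrightarrow> \<exists>l. (\<lambda>m. Fs (\<kappa> m) x) \<longlonglongrightarrow> l"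
    using function_convergent_subsequence[OF countable_rat, of Fs "max M (C\<^sup>2)"] by metis
  define N where "N = (\<lambda>m. nn (\<kappa> m))"
  define s where "s = (\<lambda>m. st (\<kappa> m))"
  define lam where "lam = (\<lambda>m. multiplier (N m) (U (\<kappa> m)))"
  have state: "discrete_state C (N m) (U (\<kappa> m))" for m unfolding N_def by (rule U)
  have N0: "0 < N m" for m unfolding N_def by (rule nn)
  have "filterlim N at_top sequentially"
  proof (rule filterlim_at_top_mono[OF filterlim_ident])
    have "m \<le> \<kappa> m" for m using \<kappa> by (rule strict_mono_imp_increasing)
    then show "\<forall>\<^sub>F m in sequentially. m \<le> N m"
      by (intro always_eventually allI) (auto simp: N_def nn_def intro: le_SucI trans_le_add1)
  qed
  then have N_top: "filterlim (\<lambda>m. real (N m)) at_top sequentially"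
    by (rule filterlim_compose[OF filterlim_real_sequentially])
  have N_inv: "(\<lambda>m. 1 / real (N m)) \<longlonglongrightarrow> 0"
    using tendsto_divide_0[OF tendsto_const filterlim_at_top_imp_at_infinity[OF N_top]] by simp
  obtain \<mu> where lam: "lam \<longlonglongrightarrow> \<mu>"
    using \<kappa>_conv[of "-1"] by (auto simp: Fs_def lam_def N_def)
  have s_rat: "convergent (\<lambda>m. s m q)" if "q \<in> \<rat>" "0 \<le> q" for q
    using \<kappa>_conv[OF that(1)] that(2) by (auto simp: Fs_def s_def convergent_def)
  have s_lip: "\<bar>s m t' - s m t\<bar> \<le> L * t' * (t' - t + 1 / N m)" if "0 \<le> t" "t \<le> t'" for m t t'
    using step_lipschitz[OF C state that] by (simp add: s_def st_def N_def L_def)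
  \<comment> \<open>A rational point slightly to the right of \<open>t\<close> carries the
    convergence over, by the approximate equicontinuity \<open>s_lip\<close>.\<close>
  have s_conv: "convergent (\<lambda>m. s m t)" if t: "0 \<le> t" for t
  proof -
    have "Cauchy (\<lambda>m. s m t)"
    proof (rule CauchyI')
      fix e :: real assume e: "0 < e"
      define D where "D = L * (t + 1) + 1"
      have D: "0 < D" "L * (t + 1) \<le> D" unfolding D_def using L0 t by (auto intro: add_nonneg_pos)
      \<comment> \<open>The error at \<open>q\<close> is at most
        \<open>L * (t + 1) * (2 * \<delta>)\<close>, one \<open>\<delta>\<close> for the distance
        and one for the mesh; the 8 makes this at most \<open>e / 4\<close>.\<close>
      define \<delta> where "\<delta> = min 1 (e / (8 * D))"
      have \<delta>: "0 < \<delta>" "\<delta> \<le> 1" "\<delta> \<le> e / (8 * D)" using e D by (auto simp: \<delta>_def)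
      have "L * (t + 1) * \<delta> \<le> D * (e / (8 * D))"
        using D \<delta> by (intro mult_mono) auto
      also have "\<dots> = e / 8" using D by simp
      finally have L\<delta>: "L * (t + 1) * \<delta> \<le> e / 8" .
      obtain q where q: "q \<in> \<rat>" "t < q" "q < t + \<delta>"
        using Rats_dense_in_real[of t "t + \<delta>"] \<delta>(1) by auto
      have close: "\<bar>s m q - s m t\<bar> \<le> e / 4" if "1 / N m \<le> \<delta>" for m
      proof -
        have "\<bar>s m q - s m t\<bar> \<le> L * q * (q - t + 1 / N m)" using t q by (intro s_lip) auto
        also have "\<dots> \<le> L * (t + 1) * (2 * \<delta>)"
          using q t L0 that \<delta> by (intro mult_mono) auto
        finally show ?thesis using L\<delta> by simp
      qed
      have "\<forall>\<^sub>F m in sequentially. 1 / N m < \<delta>" using order_tendstoD(2)[OF N_inv \<delta>(1)] .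
      then obtain M1 where M1: "\<And>m. M1 \<le> m \<Longrightarrow> 1 / N m < \<delta>"
        unfolding eventually_sequentially by blast
      have "Cauchy (\<lambda>m. s m q)" using s_rat[OF q(1)] q t by (simp add: convergent_Cauchy)
      then obtain M2 where M2: "\<And>m n. M2 \<le> m \<Longrightarrow> M2 \<le> n \<Longrightarrow> \<bar>s m q - s n q\<bar> < e / 4"
        using e unfolding Cauchy_def dist_real_def by (metis divide_pos_pos zero_less_numeral)
      have "dist (s m t) (s n t) < e" if "max M1 M2 \<le> m" "m < n" for m n
      proof -
        have "M1 \<le> m" "M2 \<le> m" "M1 \<le> n" "M2 \<le> n" using that by auto
        then show ?thesis unfolding dist_real_def
          using close[OF less_imp_le[OF M1], of m] close[OF less_imp_le[OF M1], of n] M2[of m n] by linarith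
      qed
      then show "\<exists>M. \<forall>m\<ge>M. \<forall>n>m. dist (s m t) (s n t) < e" by blast
    qed
    then show ?thesis by (simp add: Cauchy_convergent_iff)
  qed
  define u where "u = (\<lambda>t. lim (\<lambda>m. s m t))"
  have u_lim: "(\<lambda>m. s m t) \<longlonglongrightarrow> u t" if "0 \<le> t" for t
    using s_conv[OF that] by (simp add: u_def convergent_LIMSEQ_iff)
  \<comment> \<open>The mesh error disappears in the limit, so \<open>u\<close> is locally
    Lipschitz.\<close>
  have u_lip: "\<bar>u t' - u t\<bar> \<le> L * t' * (t' - t)" if "0 \<le> t" "t \<le> t'" for t t'
  proof (rule LIMSEQ_le)
    show "(\<lambda>m. \<bar>s m t' - s m t\<bar>) \<longlonglongrightarrow> \<bar>u t' - u t\<bar>"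
      using that by (intro tendsto_intros u_lim) auto
    have "(\<lambda>m. L * t' * (t' - t + 1 / N m)) \<longlonglongrightarrow> L * t' * (t' - t + 0)"
      by (intro tendsto_intros N_inv)
    then show "(\<lambda>m. L * t' * (t' - t + 1 / N m)) \<longlonglongrightarrow> L * t' * (t' - t)" by simp
    show "\<exists>M. \<forall>m\<ge>M. \<bar>s m t' - s m t\<bar> \<le> L * t' * (t' - t + 1 / N m)"
      using s_lip[OF that] by blast
  qed
  have u_cont: "continuous_on {0..} u"
    unfolding continuous_on_eq_continuous_within continuous_within
  proof
    fix t :: real assume t: "t \<in> {0..}"
    have lip: "\<bar>u x - u t\<bar> \<le> L * (t + 1) * \<bar>x - t\<bar>" if x: "0 \<le> x" "x < t + 1" for x
    proof (cases "x \<le> t")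
      case True
      have "\<bar>u t - u x\<bar> \<le> L * t * (t - x)" using x True by (intro u_lip) auto
      also have "\<dots> \<le> L * (t + 1) * (t - x)" using True L0 t by (intro mult_mono) auto
      finally show ?thesis using True by simp
    next
      case False
      have "\<bar>u x - u t\<bar> \<le> L * x * (x - t)" using t False by (intro u_lip) auto
      also have "\<dots> \<le> L * (t + 1) * (x - t)" using False L0 t x by (intro mult_mono) auto
      finally show ?thesis using False by simp
    qed
    have "((\<lambda>x. u x - u t) \<longlongrightarrow> 0) (at t within {0..})"
    proof (rule Lim_null_comparison)
      show "\<forall>\<^sub>F x in at t within {0..}. norm (u x - u t) \<le> L * (t + 1) * \<bar>x - t\<bar>"
        using lip by (auto simp: eventually_at dist_real_def intro!: exI[of _ 1])
      have "((\<lambda>x. L * (t + 1) * \<bar>x - t\<bar>) \<longlongrightarrow> L * (t + 1) * \<bar>t - t\<bar>) (at t within {0..})"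
        by (intro tendsto_intros)
      then show "((\<lambda>x. L * (t + 1) * \<bar>x - t\<bar>) \<longlongrightarrow> 0) (at t within {0..})" by simp
    qed
    then show "(u \<longlongrightarrow> u t) (at t within {0..})" by (rule LIM_zero_cancel)
  qed
  have lam_bounds: "0 < lam m" "lam m \<le> C\<^sup>2" "1 / (mass_bound C)\<^sup>2 \<le> lam m" "0 < mass_bound C" for m
    using multiplier_bounds[OF C state[of m]] by (auto simp: lam_def)
  have "1 / (mass_bound C)\<^sup>2 \<le> \<mu>" by (rule LIMSEQ_le_const[OF lam]) (use lam_bounds in auto)
  moreover have "0 < 1 / (mass_bound C)\<^sup>2" using lam_bounds(4) by simp
  ultimately have \<mu>_pos: "0 < \<mu>" by linarith
  have \<mu>_le: "\<mu> \<le> C\<^sup>2" by (rule LIMSEQ_le_const2[OF lam]) (use lam_bounds in auto)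
  define A where "A = (\<lambda>m. radius (N m))"
  have A: "t < A m t" "A m t \<le> t + 1 / N m" "0 < A m t" "A m t \<le> t + 1" if "0 \<le> t" for m t
    using radius_bounds[OF N0 that] by (auto simp: A_def)
  have A_lim: "(\<lambda>m. A m t) \<longlonglongrightarrow> t" if "0 \<le> t" for t
  proof (rule tendsto_sandwich[OF _ _ tendsto_const])
    show "\<forall>\<^sub>F m in sequentially. t \<le> A m t" "\<forall>\<^sub>F m in sequentially. A m t \<le> t + 1 / N m"
      using A[OF that] by (auto simp: less_imp_le)
    show "(\<lambda>m. t + 1 / N m) \<longlonglongrightarrow> t" using tendsto_add[OF tendsto_const N_inv, of t] by simp
  qed
  define g where "g = (\<lambda>m. slope (U (\<kappa> m)) (N m))"
  define I where "I = (\<lambda>t. integral {0..t} (\<lambda>x. x\<^sup>2 * f (u x)))"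
  define v where "v = (\<lambda>t. - \<mu> / t\<^sup>2 * I t)"
  have f_lim: "(\<lambda>m. f (s m x)) \<longlonglongrightarrow> f (u x)" if "0 \<le> x" for x
    using continuous_on_tendsto_compose[OF f_cont u_lim[OF that]] by simp
  let ?\<phi> = "\<lambda>m x. (A m x)\<^sup>2 * f (s m x)"
  have \<phi>_int: "?\<phi> m integrable_on {a..b}" if "0 \<le> a" for m a b
    unfolding A_def s_def st_def radius_def N_def
    using step_integrable[OF N0[of m, unfolded N_def] that, of "\<lambda>k. (real (Suc k) * (1 / nn (\<kappa> m)))\<^sup>2 * f (U (\<kappa> m) k)"] .
  \<comment> \<open>The upper end \<open>A m t\<close> moves with \<open>m\<close>: dominated
    convergence handles [0, t], and the remaining piece has length at most
    \<open>1 / N m\<close>.\<close>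
  have I_lim: "(\<lambda>m. integral {0..A m t} (?\<phi> m)) \<longlonglongrightarrow> I t" if t: "0 \<le> t" for t
  proof -
    have 1: "(\<lambda>m. integral {0..t} (?\<phi> m)) \<longlonglongrightarrow> I t"
      unfolding I_def
    proof (rule dominated_convergence(2))
      show "(\<lambda>x. (t + 1)\<^sup>2 * F) integrable_on {0..t}" by (rule integrable_const_ivl)
      show "norm (?\<phi> m x) \<le> (t + 1)\<^sup>2 * F" if "x \<in> {0..t}" for m x
      proof -
        have "0 \<le> x" "x \<le> t" using that by auto
        then have "(A m x)\<^sup>2 \<le> (t + 1)\<^sup>2" using A[of x m] by (intro power_mono) auto
        then show ?thesis unfolding real_norm_def abs_mult
          using f_bound[of "s m x"] by (intro mult_mono) auto
      qed
      show "(\<lambda>m. ?\<phi> m x) \<longlonglongrightarrow> x\<^sup>2 * f (u x)" if "x \<in> {0..t}" for x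
        using that by (intro tendsto_intros A_lim f_lim) auto
    qed (simp add: \<phi>_int)
    have 2: "(\<lambda>m. integral {t..A m t} (?\<phi> m)) \<longlonglongrightarrow> 0"
    proof (rule Lim_null_comparison)
      show "(\<lambda>m. (t + 2)\<^sup>2 * F * (1 / N m)) \<longlonglongrightarrow> 0"
        using tendsto_mult_right_zero[OF N_inv] .
      show "\<forall>\<^sub>F m in sequentially. norm (integral {t..A m t} (?\<phi> m)) \<le> (t + 2)\<^sup>2 * F * (1 / N m)"
      proof (intro always_eventually allI)
        fix m
        have "\<bar>integral {t..A m t} (?\<phi> m)\<bar> \<le> (t + 2)\<^sup>2 * F * (A m t - t)"
        proof (rule abs_integral_le[OF \<phi>_int[OF t]])
          fix x assume x: "t \<le> x" "x \<le> A m t"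
          have "0 \<le> A m x" "A m x \<le> t + 2" using A[of x m] A[OF t, of m] x t by auto
          then have "(A m x)\<^sup>2 \<le> (t + 2)\<^sup>2" by (intro power_mono) auto
          then show "\<bar>?\<phi> m x\<bar> \<le> (t + 2)\<^sup>2 * F" unfolding abs_mult
            using f_bound[of "s m x"] by (intro mult_mono) auto
        qed (use A[OF t, of m] in auto)
        also have "\<dots> \<le> (t + 2)\<^sup>2 * F * (1 / N m)"
          using A[OF t, of m] F_nonneg by (intro mult_left_mono) auto
        finally show "norm (integral {t..A m t} (?\<phi> m)) \<le> (t + 2)\<^sup>2 * F * (1 / N m)" by simp
      qed
    qed
    have "integral {0..t} (?\<phi> m) + integral {t..A m t} (?\<phi> m) = integral {0..A m t} (?\<phi> m)" for m
      using A[OF t, of m] t by (intro Henstock_Kurzweil_Integration.integral_combine \<phi>_int) auto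
    then show ?thesis using tendsto_add[OF 1 2] by simp
  qed
  have g_bound: "\<bar>g m t\<bar> \<le> L * (t + 1)" "\<bar>g m t\<bar> \<le> L * A m t" if "0 \<le> t" for m t
  proof -
    show "\<bar>g m t\<bar> \<le> L * A m t"
      using slope_bound[OF C state that] by (simp add: g_def A_def L_def)
    also have "\<dots> \<le> L * (t + 1)" using A[OF that, of m] L0 by (intro mult_left_mono) auto
    finally show "\<bar>g m t\<bar> \<le> L * (t + 1)" .
  qed
  have g_bound': "\<bar>g m x\<bar> \<le> L * (t + 1)" if "0 \<le> x" "x \<le> t" for m x t
  proof -
    have "\<bar>g m x\<bar> \<le> L * (x + 1)" using that(1) by (rule g_bound)
    also have "\<dots> \<le> L * (t + 1)" using that L0 by (intro mult_left_mono) auto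
    finally show ?thesis .
  qed
  \<comment> \<open>At the origin the formula divides by 0; there the bound by the radius alone
    forces the limit 0, which is also the value of \<open>v 0\<close>.\<close>
  have g_lim: "(\<lambda>m. g m t) \<longlonglongrightarrow> v t" if t: "0 \<le> t" for t
  proof (cases "t = 0")
    case True
    have "(\<lambda>m. g m 0) \<longlonglongrightarrow> 0"
    proof (rule Lim_null_comparison)
      show "\<forall>\<^sub>F m in sequentially. norm (g m 0) \<le> L * A m 0"
        using g_bound(2)[of 0] by (intro always_eventually allI) simp
      show "(\<lambda>m. L * A m 0) \<longlonglongrightarrow> 0" using tendsto_mult_right_zero[OF A_lim[of 0]] by simp
    qed
    then show ?thesis using True by (simp add: v_def)
  next
    case False
    \<comment> \<open>\<open>slope_eq\<close> holds only inside the grid, which eventually contains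
      \<open>t\<close>.\<close>
    have "\<forall>\<^sub>F m in sequentially. t < real (N m)"
      using N_top by (simp add: filterlim_at_top_dense)
    then have ev: "\<forall>\<^sub>F m in sequentially. - lam m / (A m t)\<^sup>2 * integral {0..A m t} (?\<phi> m) = g m t"
    proof eventually_elim
      case (elim m)
      then show ?case
        using slope_eq[OF C state t] by (simp add: g_def A_def lam_def s_def st_def N_def)
    qed
    have "(\<lambda>m. - lam m / (A m t)\<^sup>2 * integral {0..A m t} (?\<phi> m)) \<longlonglongrightarrow> - \<mu> / t\<^sup>2 * I t"
      using False t by (intro tendsto_intros lam A_lim I_lim) auto
    then show ?thesis unfolding v_def by (rule Lim_transform_eventually[OF _ ev])
  qed
  have g_int: "g m integrable_on {a..b}" if "0 \<le> a" for m a b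
    unfolding g_def slope_def
    using step_integrable[OF N0[of m] that, of "\<lambda>k. N m * (U (\<kappa> m) (Suc k) - U (\<kappa> m) k)"] .
  \<comment> \<open>The increments sum up only to the left end of the cell of \<open>t\<close>; the
    missing piece is at most one mesh width long.\<close>
  have u_eq: "u t = u 0 + integral {0..t} v" if t: "0 \<le> t" for t
  proof -
    let ?k = "\<lambda>m. real (cell (N m) t) / N m"
    have k: "0 \<le> ?k m" "?k m \<le> t" "t - ?k m \<le> 1 / N m" for m
    proof -
      have N': "0 < real (N m)" using N0[of m] by simp
      show "0 \<le> ?k m" by simp
      show "?k m \<le> t" using cell_le[OF t, of "N m"] N' by (simp add: pos_divide_le_eq)
      have "t < (real (cell (N m) t) + 1) / N m"
        using less_Suc_cell[of t "N m"] N' by (simp add: pos_less_divide_eq)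
      then show "t - ?k m \<le> 1 / N m" by (simp add: add_divide_distrib)
    qed
    have 1: "(\<lambda>m. integral {0..t} (g m)) \<longlonglongrightarrow> integral {0..t} v"
    proof (rule dominated_convergence(2))
      show "(\<lambda>x. L * (t + 1)) integrable_on {0..t}" by (rule integrable_const_ivl)
      show "norm (g m x) \<le> L * (t + 1)" if "x \<in> {0..t}" for m x
        using g_bound'[of x _ m] that by auto
    qed (use g_int g_lim in auto)
    have 2: "(\<lambda>m. integral {?k m..t} (g m)) \<longlonglongrightarrow> 0"
    proof (rule Lim_null_comparison)
      show "(\<lambda>m. L * (t + 1) * (1 / N m)) \<longlonglongrightarrow> 0"
        using tendsto_mult_right_zero[OF N_inv] .
      show "\<forall>\<^sub>F m in sequentially. norm (integral {?k m..t} (g m)) \<le> L * (t + 1) * (1 / N m)"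
      proof (intro always_eventually allI)
        fix m
        have "\<bar>integral {?k m..t} (g m)\<bar> \<le> L * (t + 1) * (t - ?k m)"
        proof (rule abs_integral_le[OF g_int[OF k(1)] k(2)])
          fix x assume x: "?k m \<le> x" "x \<le> t"
          have "0 \<le> x" using k(1)[of m] x by linarith
          then show "\<bar>g m x\<bar> \<le> L * (t + 1)" using x(2) by (rule g_bound')
        qed
        also have "\<dots> \<le> L * (t + 1) * (1 / N m)" using k(3)[of m] L0 t by (intro mult_left_mono) auto
        finally show "norm (integral {?k m..t} (g m)) \<le> L * (t + 1) * (1 / N m)" by simp
      qed
    qed
    have s_eq: "s m 0 + (integral {0..t} (g m) - integral {?k m..t} (g m)) = s m t" for m
    proof -
      have "integral {0..?k m} (g m) + integral {?k m..t} (g m) = integral {0..t} (g m)"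
        using k[of m] by (intro Henstock_Kurzweil_Integration.integral_combine g_int) auto
      moreover have "s m t = s m 0 + integral {0..?k m} (g m)"
        using increment_integral[OF C state, of m t] by (simp add: s_def st_def g_def N_def)
      ultimately show ?thesis by simp
    qed
    have "(\<lambda>m. s m 0 + (integral {0..t} (g m) - integral {?k m..t} (g m))) \<longlonglongrightarrow> u 0 + (integral {0..t} v - 0)"
      by (intro tendsto_intros u_lim 1 2) simp
    then have "(\<lambda>m. s m t) \<longlonglongrightarrow> u 0 + integral {0..t} v" by (simp add: s_eq)
    with u_lim[OF t] show ?thesis by (rule LIMSEQ_unique)
  qed
  have mass_lim: "(\<lambda>m. integral {0..real X} (\<lambda>x. (A m x)\<^sup>2 * (s m x)\<^sup>2))
      \<longlonglongrightarrow> integral {0..real X} (\<lambda>x. x\<^sup>2 * (u x)\<^sup>2)" for X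
  proof (rule dominated_convergence(2))
    show "(\<lambda>x. (A m x)\<^sup>2 * (s m x)\<^sup>2) integrable_on {0..real X}" for m
      unfolding A_def s_def st_def radius_def N_def
      using step_integrable[OF N0[of m, unfolded N_def], of 0 "\<lambda>k. (real (Suc k) * (1 / nn (\<kappa> m)))\<^sup>2 * (U (\<kappa> m) k)\<^sup>2"]
      by simp
    show "(\<lambda>x. (real X + 1)\<^sup>2 * M\<^sup>2) integrable_on {0..real X}" by (rule integrable_const_ivl)
    show "norm ((A m x)\<^sup>2 * (s m x)\<^sup>2) \<le> (real X + 1)\<^sup>2 * M\<^sup>2" if "x \<in> {0..real X}" for m x
    proof -
      have "(A m x)\<^sup>2 \<le> (real X + 1)\<^sup>2" using A[of x m] that by (intro power_mono) auto
      moreover have "\<bar>s m x\<bar>\<^sup>2 \<le> M\<^sup>2" using st_bound[of x "\<kappa> m"] that unfolding s_def by (intro power_mono) auto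
      ultimately show ?thesis by (simp add: abs_mult mult_mono)
    qed
    show "(\<lambda>m. (A m x)\<^sup>2 * (s m x)\<^sup>2) \<longlonglongrightarrow> x\<^sup>2 * (u x)\<^sup>2" if "x \<in> {0..real X}" for x
      using that by (intro tendsto_intros A_lim u_lim) auto
  qed
  have kin_lim: "(\<lambda>m. integral {0..real X} (\<lambda>x. (A m x)\<^sup>2 * (g m x)\<^sup>2))
      \<longlonglongrightarrow> integral {0..real X} (\<lambda>x. x\<^sup>2 * (v x)\<^sup>2)" for X
  proof (rule dominated_convergence(2))
    show "(\<lambda>x. (A m x)\<^sup>2 * (g m x)\<^sup>2) integrable_on {0..real X}" for m
      unfolding A_def g_def slope_def radius_def
      using step_integrable[OF N0[of m], of 0 "\<lambda>k. (real (Suc k) * (1 / N m))\<^sup>2 * (N m * (U (\<kappa> m) (Suc k) - U (\<kappa> m) k))\<^sup>2"]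
      by simp
    show "(\<lambda>x. (real X + 1)\<^sup>2 * (L * (real X + 1))\<^sup>2) integrable_on {0..real X}" by (rule integrable_const_ivl)
    show "norm ((A m x)\<^sup>2 * (g m x)\<^sup>2) \<le> (real X + 1)\<^sup>2 * (L * (real X + 1))\<^sup>2" if "x \<in> {0..real X}" for m x
    proof -
      have "(A m x)\<^sup>2 \<le> (real X + 1)\<^sup>2" using A[of x m] that by (intro power_mono) auto
      moreover have "\<bar>g m x\<bar> \<le> L * (real X + 1)"
        using g_bound'[of x _ m] that by auto
      then have "\<bar>g m x\<bar>\<^sup>2 \<le> (L * (real X + 1))\<^sup>2" by (intro power_mono) auto
      ultimately show ?thesis by (simp add: abs_mult mult_mono)
    qed
    show "(\<lambda>m. (A m x)\<^sup>2 * (g m x)\<^sup>2) \<longlonglongrightarrow> x\<^sup>2 * (v x)\<^sup>2" if "x \<in> {0..real X}" for x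
      using that by (intro tendsto_intros A_lim g_lim) auto
  qed
  have sU: "s m x = U (\<kappa> m) (cell (N m) x)" for m x by (simp add: s_def st_def N_def)
  have mass: "integral {0..real X} (\<lambda>x. x\<^sup>2 * (u x)\<^sup>2) \<le> mass_bound C / c" for X
    by (rule LIMSEQ_le_const2[OF mass_lim]) (use step_mass[OF C state] in \<open>auto simp: sU A_def\<close>)
  have kin: "integral {0..real X} (\<lambda>x. x\<^sup>2 * (v x)\<^sup>2) \<le> 2 * C" for X
    by (rule LIMSEQ_le_const2[OF kin_lim]) (use step_kin[OF C state] in \<open>auto simp: g_def A_def\<close>)
  \<comment> \<open>The radius beyond which no value exceeds \<open>\<epsilon>\<close>; on the fixed
    interval up to it the lower mass bound survives the limit.\<close>
  obtain X0 :: nat where X0: "4 * C / \<epsilon>\<^sup>2 \<le> real X0" using real_arch_simple by blast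
  have "1 / C \<le> (C0 + c) * integral {0..real X0} (\<lambda>x. x\<^sup>2 * (u x)\<^sup>2)"
  proof (rule LIMSEQ_le_const)
    show "(\<lambda>m. (C0 + c) * integral {0..real X0} (\<lambda>x. (A m x)\<^sup>2 * (s m x)\<^sup>2))
      \<longlonglongrightarrow> (C0 + c) * integral {0..real X0} (\<lambda>x. x\<^sup>2 * (u x)\<^sup>2)"
      by (intro tendsto_intros mass_lim)
  qed (use step_nontrivial[OF C state X0] in \<open>auto simp: sU A_def\<close>)
  then have pos: "integral {0..real X0} (\<lambda>x. x\<^sup>2 * (u x)\<^sup>2) \<noteq> 0"
    using C by (metis mult_zero_right not_le zero_less_divide_1_iff)
  have "decaying_flow P f u v \<mu> F C (max (mass_bound C / c) (2 * C))"
  proof unfold_locales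
    show "0 \<le> u r" if "0 \<le> r" for r
      using state by (intro LIMSEQ_le_const[OF u_lim[OF that]]) (auto simp: sU discrete_state_def)
    show "(u r)\<^sup>2 \<le> 4 * C / r" if "0 < r" for r
    proof (rule LIMSEQ_le)
      show "(\<lambda>m. (s m r)\<^sup>2) \<longlonglongrightarrow> (u r)\<^sup>2" using that by (intro tendsto_intros u_lim) auto
      show "(\<lambda>m. 4 * C / A m r) \<longlonglongrightarrow> 4 * C / r" using that by (intro tendsto_intros A_lim) auto
      show "\<exists>M. \<forall>m\<ge>M. (s m r)\<^sup>2 \<le> 4 * C / A m r"
        using step_decay[OF C state] that by (auto simp: sU A_def)
    qed
    show "\<exists>r\<ge>0. u r \<noteq> 0"
    proof (rule ccontr)
      assume "\<not> (\<exists>r\<ge>0. u r \<noteq> 0)"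
      then have "integral {0..real X0} (\<lambda>x. x\<^sup>2 * (u x)\<^sup>2) = integral {0..real X0} (\<lambda>x. 0)"
        by (intro Henstock_Kurzweil_Integration.integral_cong) auto
      with pos show False by simp
    qed
    show "integral {0..real X} (\<lambda>r. r\<^sup>2 * (u r)\<^sup>2) \<le> max (mass_bound C / c) (2 * C)" for X
      using mass[of X] by simp
    show "integral {0..real X} (\<lambda>r. r\<^sup>2 * (v r)\<^sup>2) \<le> max (mass_bound C / c) (2 * C)" for X
      using kin[of X] by simp
    show "v r = - \<mu> / r\<^sup>2 * integral {0..r} (\<lambda>s. s\<^sup>2 * f (u s))" for r
      by (simp add: v_def I_def)
  qed (rule \<mu>_pos \<mu>_le P_deriv f_cont f_bound u_cont u_eq | assumption)+
  then show ?thesis by (rule that)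
qed

end

section \<open>The radial ordinary differential equation\<close>

context radial_flow
begin

lemma v_0: "v 0 = 0"
  using v_eq[of 0] by simp

lemma integrand_cont: "continuous_on {0..} (\<lambda>s. s\<^sup>2 * f (u s))"
  by (intro continuous_intros continuous_on_compose2[OF f_continuous u_cont]) auto

lemma integrand_integrable: "0 \<le> a \<Longrightarrow> (\<lambda>s. s\<^sup>2 * f (u s)) integrable_on {a..b}"
  by (intro integrable_continuous_real continuous_on_subset[OF integrand_cont]) auto

lemma abs_v_le: "0 \<le> r \<Longrightarrow> \<bar>v r\<bar> \<le> \<mu> * F * r"
proof (cases "r = 0")
  case False
  assume "0 \<le> r"
  with False have r: "0 < r" by simp
  have "\<bar>integral {0..r} (\<lambda>s. s\<^sup>2 * f (u s))\<bar> \<le> r\<^sup>2 * F * (r - 0)"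
  proof (rule abs_integral_le)
    fix x assume "0 \<le> x" "x \<le> r"
    then show "\<bar>x\<^sup>2 * f (u x)\<bar> \<le> r\<^sup>2 * F"
      using f_le[of "u x"] by (simp add: abs_mult mult_mono power_mono)
  qed (use r integrand_integrable in auto)
  then have "\<mu> / r\<^sup>2 * \<bar>integral {0..r} (\<lambda>s. s\<^sup>2 * f (u s))\<bar> \<le> \<mu> / r\<^sup>2 * (r\<^sup>2 * F * (r - 0))"
    using \<mu> by (intro mult_left_mono) auto
  also have "\<dots> = \<mu> * F * r" using r by simp
  finally show ?thesis using v_eq[of r] r \<mu> by (simp add: abs_mult)
qed (simp add: v_0)

text \<open>With \<open>v\<close> the derivative of \<open>u\<close>, this is the radial Laplacian:
  u'' + 2 u' / r = - \<mu> f(u).\<close>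

lemma v_deriv:
  assumes r: "0 < r"
  shows "(v has_real_derivative - 2 * v r / r - \<mu> * f (u r)) (at r)"
proof -
  define I where "I = (\<lambda>r. integral {0..r} (\<lambda>s. s\<^sup>2 * f (u s)))"
  have "(I has_real_derivative r\<^sup>2 * f (u r)) (at r within {0..r + 1})"
    unfolding I_def
    by (rule integral_has_real_derivative[OF continuous_on_subset[OF integrand_cont]]) (use r in auto)
  then have I: "(I has_real_derivative r\<^sup>2 * f (u r)) (at r)"
    using r by (simp add: at_within_Icc_at)
  have "((\<lambda>r. - \<mu> / r\<^sup>2 * I r) has_real_derivative - 2 * v r / r - \<mu> * f (u r)) (at r)"
  proof -
    have "((\<lambda>r. - \<mu> / r\<^sup>2) has_real_derivative 2 * \<mu> / r ^ 3) (at r)"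
      using r by (auto intro!: derivative_eq_intros simp: field_simps power2_eq_square power3_eq_cube)
    from DERIV_mult[OF this I] show ?thesis
      by (rule DERIV_cong) (use r in \<open>simp add: v_eq I_def field_simps power2_eq_square power3_eq_cube\<close>)
  qed
  then show ?thesis
    by (rule has_field_derivative_transform_within_open[where S="{0<..}"])
      (use r in \<open>auto simp: v_eq I_def\<close>)
qed

lemma v_cont: "continuous_on {0..} v"
  unfolding continuous_on_eq_continuous_within
proof
  fix r :: real assume "r \<in> {0..}"
  then consider "r = 0" | "0 < r" by fastforce
  then show "continuous (at r within {0..}) v"
  proof cases
    case 1
    have "(v \<longlongrightarrow> 0) (at 0 within {0..})"
    proof (rule Lim_null_comparison)
      show "\<forall>\<^sub>F x in at 0 within {0..}. norm (v x) \<le> \<mu> * F * x"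
        using abs_v_le by (auto simp: eventually_at_filter)
      have "((\<lambda>x. \<mu> * F * x) \<longlongrightarrow> \<mu> * F * 0) (at 0 within {0..})" by (intro tendsto_intros)
      then show "((\<lambda>x. \<mu> * F * x) \<longlongrightarrow> 0) (at 0 within {0..})" by simp
    qed
    then show ?thesis using 1 by (simp add: continuous_within v_0)
  next
    case 2
    then show ?thesis using DERIV_isCont[OF v_deriv[OF 2]] continuous_at_imp_continuous_at_within by blast
  qed
qed

lemma u_deriv:
  assumes r: "0 < r"
  shows "(u has_real_derivative v r) (at r)"
proof -
  have "((\<lambda>x. integral {0..x} v) has_real_derivative v r) (at r within {0..r + 1})"
    by (rule integral_has_real_derivative[OF continuous_on_subset[OF v_cont]]) (use r in auto)
  then have "((\<lambda>x. integral {0..x} v) has_real_derivative v r) (at r)"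
    using r by (simp add: at_within_Icc_at)
  then have "((\<lambda>x. u 0 + integral {0..x} v) has_real_derivative v r) (at r)"
    using DERIV_add[OF DERIV_const[of "u 0"]] by fastforce
  then show ?thesis
    by (rule has_field_derivative_transform_within_open[where S="{0<..}"])
      (use r in \<open>auto intro!: u_eq[symmetric]\<close>)
qed

text \<open>\<open>v r / r\<close> is \<open>- \<mu>\<close> times the integral of
  \<open>f (u s)\<close> against the weight \<open>s^2 / r^3\<close>, whose total mass is 1 / 3. The
  limit supplies the second derivatives at the origin.\<close>

lemma v_quotient_limit: "((\<lambda>r. v r / r) \<longlongrightarrow> - \<mu> * f (u 0) / 3) (at_right 0)"
proof (rule tendstoI)
  fix e :: real assume e: "0 < e"
  define d where "d = e / (2 * \<mu>)"
  have d: "0 < d" using e \<mu> by (simp add: d_def)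
  have "continuous_on {0..} (\<lambda>s. f (u s))"
    by (rule continuous_on_compose2[OF f_continuous u_cont]) auto
  then obtain \<delta> where \<delta>: "0 < \<delta>" "\<And>s. 0 \<le> s \<Longrightarrow> s < \<delta> \<Longrightarrow> \<bar>f (u s) - f (u 0)\<bar> < d"
    using d unfolding continuous_on_iff dist_real_def
    by (metis abs_of_nonneg atLeast_iff diff_zero order_refl)
  have "dist (v r / r) (- \<mu> * f (u 0) / 3) < e" if r: "0 < r" "r < \<delta>" for r
  proof -
    have cube: "((\<lambda>s. s\<^sup>2) has_integral r ^ 3 / 3) {0..r}"
    proof -
      have "((\<lambda>s. s\<^sup>2) has_integral r ^ 3 / 3 - 0 ^ 3 / 3) {0..r}"
        by (rule fundamental_theorem_of_calculus)
          (use r in \<open>auto intro!: derivative_eq_intros simp: has_real_derivative_iff_has_vector_derivative[symmetric] power2_eq_square\<close>)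
      then show ?thesis by simp
    qed
    have "integral {0..r} (\<lambda>s. s\<^sup>2 * f (u s)) - f (u 0) * (r ^ 3 / 3)
        = integral {0..r} (\<lambda>s. s\<^sup>2 * f (u s) - f (u 0) * s\<^sup>2)"
      using has_integral_diff[OF integrable_integral[OF integrand_integrable[of 0 r]]
          has_integral_mult_right[OF cube, of "f (u 0)"]]
      by (simp add: integral_unique)
    moreover have "\<bar>integral {0..r} (\<lambda>s. s\<^sup>2 * f (u s) - f (u 0) * s\<^sup>2)\<bar> \<le> r\<^sup>2 * d * (r - 0)"
    proof (rule abs_integral_le)
      show "(\<lambda>s. s\<^sup>2 * f (u s) - f (u 0) * s\<^sup>2) integrable_on {0..r}"
        by (intro integrable_diff integrand_integrable has_integral_integrable[OF has_integral_mult_right[OF cube]]) simp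
      fix x assume x: "0 \<le> x" "x \<le> r"
      have "x\<^sup>2 * f (u x) - f (u 0) * x\<^sup>2 = x\<^sup>2 * (f (u x) - f (u 0))" by (simp add: algebra_simps)
      then have "\<bar>x\<^sup>2 * f (u x) - f (u 0) * x\<^sup>2\<bar> = x\<^sup>2 * \<bar>f (u x) - f (u 0)\<bar>"
        by (simp only: abs_mult abs_power2)
      also have "\<dots> \<le> r\<^sup>2 * d"
        using x r \<delta>(2)[of x] by (intro mult_mono power_mono) auto
      finally show "\<bar>x\<^sup>2 * f (u x) - f (u 0) * x\<^sup>2\<bar> \<le> r\<^sup>2 * d" .
    qed (use r in auto)
    ultimately have I: "\<bar>integral {0..r} (\<lambda>s. s\<^sup>2 * f (u s)) - f (u 0) * (r ^ 3 / 3)\<bar> \<le> r ^ 3 * d"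
      by (simp add: power2_eq_square power3_eq_cube mult_ac)
    have "v r / r - - \<mu> * f (u 0) / 3
        = - (\<mu> / r ^ 3) * (integral {0..r} (\<lambda>s. s\<^sup>2 * f (u s)) - f (u 0) * (r ^ 3 / 3))"
      unfolding v_eq[OF less_imp_le[OF r(1)]] using r(1)
      by (simp add: divide_simps power2_eq_square power3_eq_cube) (simp add: algebra_simps)
    then have "\<bar>v r / r - - \<mu> * f (u 0) / 3\<bar>
        = \<mu> / r ^ 3 * \<bar>integral {0..r} (\<lambda>s. s\<^sup>2 * f (u s)) - f (u 0) * (r ^ 3 / 3)\<bar>"
      using \<mu> r by (simp add: abs_mult)
    also have "\<dots> \<le> \<mu> / r ^ 3 * (r ^ 3 * d)"
      using I \<mu> r by (intro mult_left_mono) auto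
    also have "\<dots> = e / 2" using r \<mu> by (simp add: d_def)
    finally show ?thesis using e by (simp add: dist_real_def)
  qed
  then show "\<forall>\<^sub>F r in at_right 0. dist (v r / r) (- \<mu> * f (u 0) / 3) < e"
    using \<delta>(1) by (auto simp: eventually_at_right_field)
qed

text \<open>The derivative is \<open>- 2 v^2 / r\<close>: the first-order term of the radial
  equation acts as friction.\<close>

lemma energy_antimono:
  assumes "0 \<le> a" "a \<le> b"
  shows "(v b)\<^sup>2 / 2 + \<mu> * P (u b) \<le> (v a)\<^sup>2 / 2 + \<mu> * P (u a)"
proof (rule DERIV_nonpos_imp_decreasing_open[OF assms(2)])
  have Pc: "continuous_on UNIV P"
    using P_der by (meson DERIV_continuous_on has_field_derivative_at_within)
  show "continuous_on {a..b} (\<lambda>r. (v r)\<^sup>2 / 2 + \<mu> * P (u r))"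
    using assms
    by (intro continuous_intros continuous_on_compose2[OF Pc]
        continuous_on_subset[OF v_cont] continuous_on_subset[OF u_cont]) auto
  fix r assume "a < r" "r < b"
  then have r: "0 < r" using assms by simp
  have "((\<lambda>r. (v r)\<^sup>2 / 2 + \<mu> * P (u r)) has_real_derivative
      v r * (- 2 * v r / r - \<mu> * f (u r)) + \<mu> * (f (u r) * v r)) (at r)"
    using v_deriv[OF r] u_deriv[OF r]
    by (auto intro!: derivative_eq_intros DERIV_chain2[OF P_der])
  moreover have "v r * (- 2 * v r / r - \<mu> * f (u r)) + \<mu> * (f (u r) * v r) = - 2 * (v r)\<^sup>2 / r"
    using r by (simp add: field_simps power2_eq_square)
  moreover have "- 2 * (v r)\<^sup>2 / r \<le> 0" using r by (simp add: divide_nonpos_pos)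
  ultimately show "\<exists>y. ((\<lambda>r. (v r)\<^sup>2 / 2 + \<mu> * P (u r)) has_real_derivative y) (at r) \<and> y \<le> 0"
    by auto
qed

text \<open>The energy decreases; this bounds the speed after the maximum, hence the time needed to descend.\<close>

lemma descent_time:
  assumes rM: "0 \<le> rM" and max: "\<And>r. 0 \<le> r \<Longrightarrow> u r \<le> u rM"
    and r1: "rM < r1" and hit: "u r1 = m" and above: "\<And>r. rM \<le> r \<Longrightarrow> r < r1 \<Longrightarrow> m < u r"
    and p: "\<And>s. m \<le> s \<Longrightarrow> s \<le> u rM \<Longrightarrow> p \<le> P s"
  shows "u rM - m \<le> sqrt (2 * \<mu> * (P (u rM) - p)) * (r1 - rM)"
proof -
  have v_rM: "v rM = 0"
  proof (cases "rM = 0")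
    case False
    then have pos: "0 < rM" using rM by simp
    show ?thesis
      by (rule DERIV_local_max[OF u_deriv[OF pos] pos]) (use max in auto)
  qed (simp add: v_0)
  \<comment> \<open>The mean value theorem picks a point where the slope is the average slope of the
    descent; there \<open>u\<close> still exceeds \<open>m\<close>, so the energy bounds that
    slope.\<close>
  obtain z where z: "rM < z" "z < r1" "u r1 - u rM = (r1 - rM) * v z"
  proof -
    have "u differentiable (at x)" if "rM < x" for x
      using u_deriv[of x] that rM by (auto simp: real_differentiable_def)
    then obtain l z where z: "rM < z" "z < r1" "(u has_real_derivative l) (at z)" "u r1 - u rM = (r1 - rM) * l"
      using MVT[OF r1, of u] continuous_on_subset[OF u_cont, of "{rM..r1}"] rM by auto
    moreover have "l = v z" using DERIV_unique[OF z(3) u_deriv] z(1) rM by simp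
    ultimately have "\<exists>z>rM. z < r1 \<and> u r1 - u rM = (r1 - rM) * v z" by blast
    then show ?thesis using that by blast
  qed
  have "(v z)\<^sup>2 / 2 + \<mu> * P (u z) \<le> \<mu> * P (u rM)"
    using energy_antimono[of rM z] rM z v_rM by simp
  moreover have "\<mu> * p \<le> \<mu> * P (u z)"
    using p[of "u z"] above[of z] max[of z] z rM \<mu> by simp
  ultimately have "(v z)\<^sup>2 \<le> 2 * \<mu> * (P (u rM) - p)" by (simp add: algebra_simps)
  then have "\<bar>v z\<bar> \<le> sqrt (2 * \<mu> * (P (u rM) - p))" by (rule real_le_rsqrt[of "\<bar>v z\<bar>", simplified])
  then have "(r1 - rM) * (- v z) \<le> (r1 - rM) * sqrt (2 * \<mu> * (P (u rM) - p))"
    using r1 by (intro mult_left_mono) auto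
  then show ?thesis using z(3) hit by (simp add: algebra_simps)
qed

end

text \<open>The least point of the compact set where \<open>u\<close> is at most \<open>m\<close>;
  by the intermediate value theorem \<open>u\<close> cannot already be below \<open>m\<close>
  there.\<close>

lemma first_hit:
  fixes u :: "real \<Rightarrow> real"
  assumes cont: "continuous_on {a..b} u" and ab: "a \<le> b" and ua: "m < u a" and ub: "u b \<le> m"
  obtains r where "a < r" "r \<le> b" "u r = m" "\<And>x. a \<le> x \<Longrightarrow> x < r \<Longrightarrow> m < u x"
proof -
  define S where "S = {a..b} \<inter> u -` {..m}"
  have "closed S" unfolding S_def by (rule continuous_closed_preimage[OF cont]) auto
  then have "compact S" unfolding S_def by (metis Int_lower1 bounded_closed_interval bounded_subset compact_eq_bounded_closed)
  moreover have "b \<in> S" using ab ub by (auto simp: S_def)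
  ultimately obtain r where r: "r \<in> S" and least: "\<And>x. x \<in> S \<Longrightarrow> r \<le> x"
    using compact_attains_inf[of S] by blast
  have "u r = m"
  proof (rule ccontr)
    assume "u r \<noteq> m"
    then have "u r < m" using r by (auto simp: S_def)
    then obtain x where x: "a \<le> x" "x \<le> r" "u x = m"
      using IVT2'[of u r m a] ua r continuous_on_subset[OF cont, of "{a..r}"] by (auto simp: S_def)
    then have "x \<in> S" using r by (auto simp: S_def)
    then have "r = x" using least x by force
    then show False using x \<open>u r < m\<close> by simp
  qed
  moreover have "m < u x" if "a \<le> x" "x < r" for x
    using least[of x] that r by (cases "u x \<le> m") (auto simp: S_def)
  ultimately show ?thesis using that[of r] r ua by (auto simp: S_def le_less)
qed

text \<open>Equal one-sided derivatives make a derivative. This serves at \<open>\<beta>\<close>,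
  where the truncation sets in.\<close>

lemma DERIV_glue:
  fixes g h k :: "real \<Rightarrow> real"
  assumes "(g has_real_derivative D) (at b)" "(h has_real_derivative D) (at b)"
    and "\<And>x. x \<le> b \<Longrightarrow> k x = g x" "\<And>x. b \<le> x \<Longrightarrow> k x = h x"
  shows "(k has_real_derivative D) (at b)"
proof -
  have "(k has_real_derivative D) (at b within {..b})"
    by (rule has_field_derivative_transform_within[OF has_field_derivative_at_within[OF assms(1)], of 1]) (use assms(3) in auto)
  moreover have "(k has_real_derivative D) (at b within {b..})"
    by (rule has_field_derivative_transform_within[OF has_field_derivative_at_within[OF assms(2)], of 1]) (use assms(4) in auto)
  moreover have "at b = sup (at b within {..b}) (at b within {b..})"
  proof -
    have "{..b} \<union> {b..} = UNIV" by auto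
    then show ?thesis using at_within_union[of b "{..b}" "{b..}"] by simp
  qed
  ultimately show ?thesis
    unfolding has_field_derivative_iff by (simp add: filterlim_sup)
qed

section \<open>Truncation of the nonlinearity\<close>

definition clip :: "real \<Rightarrow> real \<Rightarrow> real" where
  "clip \<beta> s = max (- \<beta>) (min \<beta> s)"

text \<open>The primitive of \<open>f\<close> frozen outside [- \<beta>, \<beta>]: \<open>P\<close>
  continued by its tangent lines at the two end points.\<close>

definition extension :: "(real \<Rightarrow> real) \<Rightarrow> (real \<Rightarrow> real) \<Rightarrow> real \<Rightarrow> real \<Rightarrow> real" where
  "extension P f \<beta> s = P (clip \<beta> s) + f (clip \<beta> s) * (s - clip \<beta> s)"

lemma clip_id: "\<bar>s\<bar> \<le> \<beta> \<Longrightarrow> clip \<beta> s = s"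
  and clip_above: "0 < \<beta> \<Longrightarrow> \<beta> \<le> s \<Longrightarrow> clip \<beta> s = \<beta>"
  and clip_minus: "0 < \<beta> \<Longrightarrow> clip \<beta> (- s) = - clip \<beta> s"
  by (auto simp: clip_def)

locale potential =
  fixes P f :: "real \<Rightarrow> real" and K c \<epsilon> :: real
  assumes P_der: "\<And>s. (P has_real_derivative f s) (at s)"
    and f_continuous: "continuous_on UNIV f"
    and P_even: "\<And>s. P (- s) = P s"
    and P_zero: "P 0 = 0"
    and K_pos: "0 < K" and P_upper: "\<And>s. P s \<le> K * s\<^sup>2"
    and P_small: "\<And>s. \<bar>s\<bar> \<le> \<epsilon> \<Longrightarrow> P s \<le> - c * s\<^sup>2"
    and c_pos: "0 < c" and \<epsilon>_pos: "0 < \<epsilon>"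
begin

lemma f_odd: "f (- s) = - f s"
proof -
  have "((\<lambda>x. P (- x)) has_real_derivative f (- s) * (- 1)) (at s)"
    by (rule DERIV_chain2[OF P_der]) (auto intro!: derivative_eq_intros)
  then have "(P has_real_derivative - f (- s)) (at s)" by (simp add: P_even)
  from DERIV_unique[OF this P_der] show ?thesis by simp
qed

lemma P_continuous: "continuous_on S P"
  using P_der by (meson DERIV_continuous_on has_field_derivative_at_within)

lemma extension_even: "0 < \<beta> \<Longrightarrow> extension P f \<beta> (- s) = extension P f \<beta> s"
  by (simp add: extension_def clip_minus P_even f_odd algebra_simps)

lemma extension_eq: "\<bar>s\<bar> \<le> \<beta> \<Longrightarrow> extension P f \<beta> s = P s"
  by (simp add: extension_def clip_id)

lemma extension_above: "0 < \<beta> \<Longrightarrow> \<beta> \<le> s \<Longrightarrow> extension P f \<beta> s = P \<beta> + f \<beta> * (s - \<beta>)"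
  by (simp add: extension_def clip_above)

text \<open>At \<open>\<beta>\<close> the graph of \<open>P\<close> meets its tangent with equal
  slope; negative arguments follow because the extension is even and \<open>f\<close> is
  odd.\<close>

lemma extension_deriv:
  assumes \<beta>: "0 < \<beta>"
  shows "(extension P f \<beta> has_real_derivative f (clip \<beta> s)) (at s)"
proof -
  have aff: "((\<lambda>s. P \<beta> + f \<beta> * (s - \<beta>)) has_real_derivative f \<beta>) (at s)" for s
    by (auto intro!: derivative_eq_intros)
  have nonneg: "(extension P f \<beta> has_real_derivative f (clip \<beta> s)) (at s)" if s: "0 \<le> s" for s
  proof -
    consider "s < \<beta>" | "s = \<beta>" | "\<beta> < s" by linarith
    then show ?thesis
    proof cases
      case 1
      have "(extension P f \<beta> has_real_derivative f s) (at s)"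
        by (rule has_field_derivative_transform_within_open[OF P_der[of s], where S="{- \<beta><..<\<beta>}"])
          (use s \<beta> 1 in \<open>auto simp: extension_eq\<close>)
      then show ?thesis using s 1 by (simp add: clip_id)
    next
      case 2
      have "(extension P f \<beta> has_real_derivative f \<beta>) (at \<beta>)"
      proof (rule DERIV_glue)
        \<comment> \<open>\<open>DERIV_glue\<close> wants agreement on all of the half line left of
          \<open>\<beta>\<close>; below \<open>- \<beta>\<close> the extension is no longer
          \<open>P\<close>, so the left branch is adapted there.\<close>
        let ?g = "\<lambda>s. if - \<beta> < s then P s else extension P f \<beta> s"
        show "(?g has_real_derivative f \<beta>) (at \<beta>)"
          by (rule has_field_derivative_transform_within_open[OF P_der[of \<beta>], where S="{- \<beta><..}"])
            (use \<beta> in auto)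
        show "extension P f \<beta> x = ?g x" if "x \<le> \<beta>" for x
          using that by (simp add: extension_eq)
      qed (use \<beta> aff extension_above in auto)
      then show ?thesis using 2 \<beta> by (simp add: clip_id)
    next
      case 3
      have "(extension P f \<beta> has_real_derivative f \<beta>) (at s)"
        by (rule has_field_derivative_transform_within_open[OF aff, where S="{\<beta><..}"])
          (use 3 \<beta> in \<open>auto simp: extension_above\<close>)
      then show ?thesis using 3 \<beta> by (simp add: clip_above)
    qed
  qed
  show ?thesis
  proof (cases "0 \<le> s")
    case False
    have "((\<lambda>x. extension P f \<beta> (- x)) has_real_derivative f (clip \<beta> (- s)) * (- 1)) (at s)"
      by (rule DERIV_chain2[OF nonneg]) (use False in \<open>auto intro!: derivative_eq_intros\<close>)
    then show ?thesis using \<beta> by (simp add: extension_even clip_minus f_odd)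
  qed (rule nonneg)
qed

text \<open>Beyond \<open>\<beta>\<close> the tangent stays below \<open>4 K \<beta> s\<close>, and
  \<open>\<beta> s <= s^2\<close>. The constant is the same for all \<open>\<beta>\<close>, on which
  the bound for the maximum relies.\<close>

lemma extension_upper:
  assumes \<beta>: "0 < \<beta>" and f\<beta>: "f \<beta> \<le> 4 * K * \<beta>"
  shows "extension P f \<beta> s \<le> 4 * K * s\<^sup>2"
proof -
  have nonneg: "extension P f \<beta> s \<le> 4 * K * s\<^sup>2" if s: "0 \<le> s" for s
  proof (cases "s \<le> \<beta>")
    case True
    have "P s \<le> K * s\<^sup>2" by (rule P_upper)
    also have "\<dots> \<le> 4 * K * s\<^sup>2" using K_pos by simp
    finally show ?thesis using s True by (simp add: extension_eq)
  next
    case False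
    have "f \<beta> * (s - \<beta>) \<le> 4 * K * \<beta> * (s - \<beta>)"
      using f\<beta> False by (intro mult_right_mono) auto
    then have "P \<beta> + f \<beta> * (s - \<beta>) \<le> K * \<beta>\<^sup>2 + 4 * K * \<beta> * (s - \<beta>)"
      using P_upper[of \<beta>] by linarith
    also have "\<dots> \<le> 4 * K * (\<beta> * s)"
      using K_pos by (simp add: algebra_simps power2_eq_square)
    also have "\<dots> \<le> 4 * K * s\<^sup>2"
      using K_pos False \<beta> by (intro mult_left_mono) (auto simp: power2_eq_square)
    finally show ?thesis using \<beta> False by (simp add: extension_above)
  qed
  show ?thesis
  proof (cases "0 \<le> s")
    case False
    then show ?thesis using nonneg[of "- s"] by (simp add: extension_even[OF \<beta>])
  qed (rule nonneg)
qed

text \<open>The radius becomes \<open>min \<epsilon> \<beta>\<close> because the extension is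
  \<open>P\<close> only inside the truncation range. \<open>F\<close> depends on
  \<open>\<beta>\<close>, but the constant \<open>C\<close> obtained from the competitor does not
  involve \<open>F\<close>.\<close>

lemma truncated_nonlinearity:
  assumes \<beta>: "0 < \<beta>" and f\<beta>: "f \<beta> \<le> 4 * K * \<beta>"
  obtains F where "nonlinearity (extension P f \<beta>) (\<lambda>s. f (clip \<beta> s)) (4 * K) F c (min \<epsilon> \<beta>)"
proof -
  obtain F where F: "\<forall>s\<in>{- \<beta>..\<beta>}. \<bar>f s\<bar> \<le> F"
    by (rule continuous_bounded_on_compact[OF continuous_on_subset[OF f_continuous]]) auto
  have "nonlinearity (extension P f \<beta>) (\<lambda>s. f (clip \<beta> s)) (4 * K) F c (min \<epsilon> \<beta>)"
  proof
    show "continuous_on UNIV (\<lambda>s. f (clip \<beta> s))"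
      unfolding clip_def
      by (rule continuous_on_compose2[OF f_continuous]) (auto intro!: continuous_intros)
    show "\<bar>f (clip \<beta> s)\<bar> \<le> F" for s
    proof -
      have "clip \<beta> s \<in> {- \<beta>..\<beta>}" using \<beta> by (auto simp: clip_def)
      then show ?thesis using F by blast
    qed
    show "extension P f \<beta> s \<le> - c * s\<^sup>2" if "\<bar>s\<bar> \<le> min \<epsilon> \<beta>" for s
      using that P_small[of s] by (simp add: extension_eq)
  qed (use \<beta> c_pos \<epsilon>_pos K_pos P_zero in \<open>auto simp: extension_deriv extension_even
        extension_eq extension_upper[OF \<beta> f\<beta>]\<close>)
  then show ?thesis by (rule that)
qed

text \<open>If \<open>f \<zeta>\<close> were negative, the maximum of \<open>P\<close> on
  [0, \<zeta>] would be interior, hence a critical point with positive value. If \<open>f\<close>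
  vanished later, \<open>P\<close> would have grown up to the first zero, again a forbidden critical
  point.\<close>

lemma truncation_cases:
  assumes \<zeta>: "0 < \<zeta>" "0 < P \<zeta>" and none: "\<And>\<beta>. 0 < \<beta> \<Longrightarrow> 0 < P \<beta> \<Longrightarrow> f \<beta> \<noteq> 0"
  shows "\<zeta> \<le> s \<Longrightarrow> 0 < f s \<and> P \<zeta> \<le> P s"
proof -
  have f\<zeta>: "0 < f \<zeta>"
  proof (rule ccontr)
    assume "\<not> 0 < f \<zeta>"
    then have neg: "f \<zeta> < 0" using none[OF \<zeta>] by linarith
    then obtain d where d: "0 < d" "\<And>h. 0 < h \<Longrightarrow> h < d \<Longrightarrow> P \<zeta> < P (\<zeta> - h)"
      using DERIV_neg_dec_left[OF P_der, of \<zeta>] by blast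
    obtain x where x: "x \<in> {0..\<zeta>}" "\<And>y. y \<in> {0..\<zeta>} \<Longrightarrow> P y \<le> P x"
      using continuous_attains_sup[of "{0..\<zeta>}" P] P_continuous \<zeta> by auto
    have Px: "0 < P x" using x(2)[of \<zeta>] \<zeta> by auto
    have x0: "0 < x" using x(1) Px P_zero by (cases "x = 0") auto
    have "x \<noteq> \<zeta>"
    proof
      assume "x = \<zeta>"
      define h where "h = min (d / 2) \<zeta>"
      have "0 < h" "h < d" "h \<le> \<zeta>" using d \<zeta> by (auto simp: h_def)
      then show False using d(2)[of h] x(2)[of "\<zeta> - h"] \<open>x = \<zeta>\<close> by auto
    qed
    then have "x < \<zeta>" using x by auto
    then have "f x = 0"
      by (intro DERIV_local_max[OF P_der, of "min x (\<zeta> - x)"]) (use x x0 in \<open>auto intro!: x(2)\<close>)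
    then show False using none[OF x0 Px] by simp
  qed
  have mono: "P a \<le> P b" if "a \<le> b" "\<And>x. a < x \<Longrightarrow> x < b \<Longrightarrow> 0 < f x" for a b
    by (rule DERIV_nonneg_imp_increasing_open[OF that(1)]) (use that P_der P_continuous less_imp_le in blast)+
  have fpos: "0 < f s" if s: "\<zeta> \<le> s" for s
  proof (rule ccontr)
    assume "\<not> 0 < f s"
    then obtain r where r: "\<zeta> < r" "f r = 0" "\<And>x. \<zeta> \<le> x \<Longrightarrow> x < r \<Longrightarrow> 0 < f x"
      using first_hit[of \<zeta> s f 0] s f\<zeta> continuous_on_subset[OF f_continuous] by (metis not_less subset_UNIV)
    have "P \<zeta> \<le> P r" using r by (intro mono) auto
    then show False using none[of r] r \<zeta> by auto
  qed
  assume s: "\<zeta> \<le> s"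
  then show ?thesis using fpos mono[of \<zeta> s] by auto
qed

text \<open>Mean value theorem on [b, 2 b]: the average slope is at most
  \<open>K (2 b)^2 / b = 4 K b\<close>, the origin of the factor 4.\<close>

lemma exists_moderate_slope:
  assumes pos: "\<And>s. b \<le> s \<Longrightarrow> 0 \<le> P s" and b: "0 < b"
  obtains \<beta> where "b \<le> \<beta>" "f \<beta> \<le> 4 * K * \<beta>"
proof -
  have "\<exists>l z. b < z \<and> z < 2 * b \<and> (P has_real_derivative l) (at z) \<and> P (2 * b) - P b = (2 * b - b) * l"
    by (rule MVT) (use b P_continuous P_der in \<open>auto simp: real_differentiable_def\<close>)
  then obtain z where z: "b < z" "P (2 * b) - P b = b * f z"
    using DERIV_unique[OF P_der] by force
  have "b * f z \<le> K * (2 * b)\<^sup>2" using z(2) P_upper[of "2 * b"] pos[of b] by simp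
  also have "\<dots> = b * (4 * K * b)" by (simp add: power2_eq_square)
  finally have "f z \<le> 4 * K * b" using b by simp
  also have "\<dots> \<le> 4 * K * z" using z K_pos by simp
  finally show ?thesis using that[of z] z by simp
qed

lemma bounded_below_on:
  obtains Pm where "0 \<le> Pm" "\<And>s. 0 \<le> s \<Longrightarrow> s \<le> \<zeta> \<Longrightarrow> - Pm \<le> P s"
proof -
  obtain B where "\<forall>s\<in>{0..\<zeta>}. \<bar>P s\<bar> \<le> B"
    by (rule continuous_bounded_on_compact[OF P_continuous]) auto
  then have "- \<bar>B\<bar> \<le> P s" if "0 \<le> s" "s \<le> \<zeta>" for s
    using that by (auto dest!: bspec[of _ _ s])
  then show ?thesis using that[of "\<bar>B\<bar>"] by simp
qed

text \<open>The cubic gain beats the quadratic loss: for R >= 1 one has (R + 1)^2 <= 4 R^2, so it is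
  enough that \<open>P \<zeta> R / 3 >= 4 Pm + 1\<close>.\<close>

lemma exists_test_radius:
  assumes "0 < P \<zeta>" "0 \<le> Pm"
  obtains R :: nat where "1 \<le> P \<zeta> * real R ^ 3 / 3 - Pm * (real R + 1)\<^sup>2"
proof -
  obtain R :: nat where R: "max 1 (3 * (4 * Pm + 1) / P \<zeta>) \<le> real R" using real_arch_simple by blast
  then have R1: "1 \<le> real R" and "3 * (4 * Pm + 1) / P \<zeta> \<le> real R" by auto
  then have *: "4 * Pm + 1 \<le> P \<zeta> * real R / 3" using assms by (simp add: field_simps)
  have "(real R + 1)\<^sup>2 \<le> (2 * real R)\<^sup>2" using R1 by (intro power_mono) auto
  then have "Pm * (real R + 1)\<^sup>2 \<le> Pm * (4 * (real R)\<^sup>2)" using assms by (intro mult_left_mono) (auto simp: power_mult_distrib)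
  moreover have "1 \<le> (real R)\<^sup>2" using R1 by simp
  moreover have "(4 * Pm + 1) * (real R)\<^sup>2 \<le> (P \<zeta> * real R / 3) * (real R)\<^sup>2"
    using * by (intro mult_right_mono) auto
  ultimately have "1 \<le> P \<zeta> * real R ^ 3 / 3 - Pm * (real R + 1)\<^sup>2"
    by (simp add: power2_eq_square power3_eq_cube algebra_simps)
  then show ?thesis by (rule that)
qed


text \<open>The competitor takes values in [0, \<zeta>], where the truncation is invisible, so
  \<open>C\<close> does not involve \<open>\<beta>\<close>; a large \<open>\<beta>\<close> may be
  chosen in terms of \<open>C\<close>. Taking 1 as lower bound for its V produces the summand
  1.\<close>

lemma truncated_solution:
  fixes R :: nat and \<beta> \<zeta> Pm :: real
  defines "C \<equiv> (real R + 1)\<^sup>2 * \<zeta>\<^sup>2 / 2 + 1"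
  assumes \<beta>: "0 < \<beta>" "f \<beta> \<le> 4 * K * \<beta>" and \<zeta>: "0 < \<zeta>" "\<zeta> \<le> \<beta>"
    and Pm: "0 \<le> Pm" "\<And>s. 0 \<le> s \<Longrightarrow> s \<le> \<zeta> \<Longrightarrow> - Pm \<le> P s"
    and R: "1 \<le> P \<zeta> * real R ^ 3 / 3 - Pm * (real R + 1)\<^sup>2"
  obtains u v \<mu> F B where "decaying_flow (extension P f \<beta>) (\<lambda>s. f (clip \<beta> s)) u v \<mu> F C B"
proof -
  obtain F where nl: "nonlinearity (extension P f \<beta>) (\<lambda>s. f (clip \<beta> s)) (4 * K) F c (min \<epsilon> \<beta>)"
    using truncated_nonlinearity[OF \<beta>] by blast
  interpret N: nonlinearity "extension P f \<beta>" "\<lambda>s. f (clip \<beta> s)" "4 * K" F c "min \<epsilon> \<beta>"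
    by (rule nl)
  have ext: "extension P f \<beta> s = P s" if "0 \<le> s" "s \<le> \<zeta>" for s
    using that \<zeta> by (simp add: extension_eq)
  have low: "- Pm \<le> extension P f \<beta> s" if "0 \<le> s" "s \<le> \<zeta>" for s
    using ext[OF that] Pm(2)[OF that] by simp
  have R': "1 \<le> extension P f \<beta> \<zeta> * real R ^ 3 / 3 - Pm * (real R + 1)\<^sup>2"
    using R ext[of \<zeta>] \<zeta> by simp
  show ?thesis
    by (rule N.radial_limit[of \<zeta> Pm 1 R, OF \<zeta>(1) Pm(1) _ zero_less_one R', unfolded div_by_1, folded C_def],
        erule (1) low, rule that)
qed

end

section \<open>Maximum and descent of a decaying profile\<close>

context decaying_flow
begin

text \<open>Beyond \<open>X\<close> the decay pushes \<open>u\<close> below its value at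
  \<open>r0\<close>, so the maximum over [0, X] is global.\<close>

lemma attains_max:
  obtains rM where "0 \<le> rM" "\<And>r. 0 \<le> r \<Longrightarrow> u r \<le> u rM" "0 < u rM"
proof -
  obtain r0 where r0: "0 \<le> r0" "u r0 \<noteq> 0" using u_nontrivial by blast
  have pos: "0 < u r0" using u_nonneg[OF r0(1)] r0(2) by linarith
  \<comment> \<open>The locale does not fix the sign of \<open>C\<close>, hence the absolute value
    of \<open>D\<close> in what follows.\<close>
  define D where "D = 4 * C"
  define X where "X = max r0 (\<bar>D\<bar> / (u r0)\<^sup>2) + 1"
  have X: "r0 \<le> X" "\<bar>D\<bar> / (u r0)\<^sup>2 \<le> X" "0 < X" using r0 by (auto simp: X_def)
  have "\<exists>x\<in>{0..X}. \<forall>y\<in>{0..X}. u y \<le> u x"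
    by (rule continuous_attains_sup) (use X continuous_on_subset[OF u_cont] in auto)
  then obtain rM where rM: "rM \<in> {0..X}" "\<And>y. y \<in> {0..X} \<Longrightarrow> u y \<le> u rM" by blast
  have M: "u r0 \<le> u rM" using rM(2)[of r0] r0 X by simp
  have "u r \<le> u rM" if "0 \<le> r" for r
  proof (cases "r \<le> X")
    case False
    then have r: "0 < r" "X < r" using X by auto
    have "(u r)\<^sup>2 \<le> D / r" unfolding D_def using r by (intro u_decay)
    also have "\<dots> \<le> \<bar>D\<bar> / X" using r X by (intro frac_le) auto
    also have "\<dots> \<le> (u r0)\<^sup>2" using X pos by (simp add: field_simps)
    finally have "u r \<le> u r0" by (rule power2_le_imp_le) (use pos in simp)
    then show ?thesis using M by simp
  qed (use rM that in auto)
  then show ?thesis using that[of rM] rM M pos by auto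
qed

lemma descends:
  assumes a: "0 \<le> a" and m: "0 < m" "m < u a"
  obtains r where "a < r" "u r = m" "\<And>x. a \<le> x \<Longrightarrow> x < r \<Longrightarrow> m < u x"
proof -
  define D where "D = 4 * C"
  define X where "X = max a (\<bar>D\<bar> / m\<^sup>2) + 1"
  have X: "a \<le> X" "\<bar>D\<bar> / m\<^sup>2 \<le> X" "0 < X" using a by (auto simp: X_def)
  have "(u X)\<^sup>2 \<le> D / X" unfolding D_def using X by (intro u_decay)
  also have "\<dots> \<le> \<bar>D\<bar> / X" using X by (intro divide_right_mono) auto
  also have "\<dots> \<le> m\<^sup>2" using X m by (simp add: field_simps)
  finally have "u X \<le> m" by (rule power2_le_imp_le) (use m in simp)
  then show ?thesis
    using first_hit[of a X u m] that continuous_on_subset[OF u_cont, of "{a..X}"] X a m by auto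
qed

end

text \<open>The interface between the ordinary differential equation and space: multiplier and
  truncation are gone, and \<open>v_lim\<close> records what second derivatives at the origin
  need.\<close>

locale radial_solution =
  fixes f w v :: "real \<Rightarrow> real" and M L B :: real
  assumes f_cont: "continuous_on UNIV f"
    and w_range: "\<And>r. 0 \<le> r \<Longrightarrow> 0 \<le> w r \<and> w r \<le> M"
    and w_cont: "continuous_on {0..} w"
    and w_deriv: "\<And>r. 0 < r \<Longrightarrow> (w has_real_derivative v r) (at r)"
    and v_deriv: "\<And>r. 0 < r \<Longrightarrow> (v has_real_derivative - 2 * v r / r - f (w r)) (at r)"
    and v_le: "\<And>r. 0 \<le> r \<Longrightarrow> \<bar>v r\<bar> \<le> L * r"
    and v_lim: "((\<lambda>r. v r / r) \<longlongrightarrow> - f (w 0) / 3) (at_right 0)"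
    and w_mass: "\<And>X::nat. integral {0..real X} (\<lambda>r. r\<^sup>2 * (w r)\<^sup>2) \<le> B"
    and v_mass: "\<And>X::nat. integral {0..real X} (\<lambda>r. r\<^sup>2 * (v r)\<^sup>2) \<le> B"

context potential
begin

lemma bounded_truncated_solution:
  assumes \<zeta>: "0 < \<zeta>" "0 < P \<zeta>"
  obtains \<beta> u v \<mu> F C B where
    "decaying_flow (extension P f \<beta>) (\<lambda>s. f (clip \<beta> s)) u v \<mu> F C B"
    "\<And>r. 0 \<le> r \<Longrightarrow> u r \<le> \<beta>"
proof (cases "\<exists>\<beta>>0. 0 < P \<beta> \<and> f \<beta> = 0")
  case True
  then obtain \<beta> where \<beta>: "0 < \<beta>" "0 < P \<beta>" "f \<beta> = 0" by blast
  obtain Pm where Pm: "0 \<le> Pm" "\<And>s. 0 \<le> s \<Longrightarrow> s \<le> \<beta> \<Longrightarrow> - Pm \<le> P s"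
    using bounded_below_on by blast
  obtain R where R: "1 \<le> P \<beta> * real R ^ 3 / 3 - Pm * (real R + 1)\<^sup>2"
    using exists_test_radius[OF \<beta>(2) Pm(1)] by blast
  have f\<beta>: "f \<beta> \<le> 4 * K * \<beta>" using \<beta> K_pos by simp
  define C where "C = (real R + 1)\<^sup>2 * \<beta>\<^sup>2 / 2 + 1"
  obtain u v \<mu> F B where
    flow: "decaying_flow (extension P f \<beta>) (\<lambda>s. f (clip \<beta> s)) u v \<mu> F C B"
    by (rule truncated_solution[OF \<beta>(1) f\<beta> \<beta>(1) order_refl Pm(1) _ R, folded C_def],
        erule (1) Pm(2), rule that)
  interpret decaying_flow "extension P f \<beta>" "\<lambda>s. f (clip \<beta> s)" u v \<mu> F C B by (rule flow)
  obtain rM where rM: "0 \<le> rM" "\<And>r. 0 \<le> r \<Longrightarrow> u r \<le> u rM" "0 < u rM"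
    by (rule attains_max) (rule that)
  have "u rM \<le> \<beta>"
  proof (rule ccontr)
    assume "\<not> u rM \<le> \<beta>"
    then have M: "\<beta> < u rM" by simp
    obtain r1 where r1: "rM < r1" "u r1 = \<beta>" "\<And>x. rM \<le> x \<Longrightarrow> x < r1 \<Longrightarrow> \<beta> < u x"
      by (rule descends[OF rM(1) \<beta>(1) M]) (rule that)
    \<comment> \<open>With \<open>f \<beta> = 0\<close> the extension is constant beyond
      \<open>\<beta>\<close>, so no potential energy is released and the descent to
      \<open>\<beta>\<close> could not happen.\<close>
    have "u rM - \<beta> \<le> sqrt (2 * \<mu> * (extension P f \<beta> (u rM) - P \<beta>)) * (r1 - rM)"
      by (rule descent_time[OF rM(1,2) r1]) (use \<beta> extension_above in auto)
    also have "extension P f \<beta> (u rM) - P \<beta> = 0"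
      using \<beta> M by (simp add: extension_above)
    finally show False using M by simp
  qed
  then have "u r \<le> \<beta>" if "0 \<le> r" for r using rM(2)[OF that] by simp
  with flow show ?thesis by (rule that)
next
  case False
  then have none: "\<And>\<beta>. 0 < \<beta> \<Longrightarrow> 0 < P \<beta> \<Longrightarrow> f \<beta> \<noteq> 0" by blast
  have increasing: "0 < f s \<and> P \<zeta> \<le> P s" if "\<zeta> \<le> s" for s
    by (rule truncation_cases[OF \<zeta> _ that]) (rule none)
  obtain Pm where Pm: "0 \<le> Pm" "\<And>s. 0 \<le> s \<Longrightarrow> s \<le> \<zeta> \<Longrightarrow> - Pm \<le> P s"
    using bounded_below_on by blast
  obtain R where R: "1 \<le> P \<zeta> * real R ^ 3 / 3 - Pm * (real R + 1)\<^sup>2"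
    using exists_test_radius[OF \<zeta>(2) Pm(1)] by blast
  define C where "C = (real R + 1)\<^sup>2 * \<zeta>\<^sup>2 / 2 + 1"
  have C: "0 < C" unfolding C_def by (intro add_nonneg_pos) auto
  \<comment> \<open>The root is the bound on the maximum reached at the end:
    \<open>1 / r1 <= 2 sqrt (8 K) C\<close> in Strauss' inequality at height \<open>M / 2\<close>
    gives \<open>M^2 <= 32 C^2 sqrt (8 K)\<close>. The entry \<open>2 * \<zeta>\<close> keeps
    \<open>M / 2\<close> above \<open>\<zeta>\<close>, where the extension is nonnegative.\<close>
  define b where "b = max (2 * \<zeta>) (sqrt (32 * C\<^sup>2 * sqrt (8 * K)))"
  have P_nonneg: "0 \<le> P s" if "\<zeta> \<le> s" for s using increasing[OF that] \<zeta> by simp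
  have b: "0 < b" "\<zeta> \<le> b" using \<zeta> by (auto simp: b_def less_max_iff_disj le_max_iff_disj)
  then have Pb: "0 \<le> P s" if "b \<le> s" for s using that by (intro P_nonneg) simp
  obtain \<beta> where \<beta>: "b \<le> \<beta>" "f \<beta> \<le> 4 * K * \<beta>"
    by (rule exists_moderate_slope[of b], erule Pb, rule b, rule that)
  have \<beta>0: "0 < \<beta>" "\<zeta> \<le> \<beta>" "2 * \<zeta> \<le> \<beta>" and \<beta>_big: "sqrt (32 * C\<^sup>2 * sqrt (8 * K)) \<le> \<beta>"
    using \<beta> \<zeta> by (auto simp: b_def)
  obtain u v \<mu> F B where
    flow: "decaying_flow (extension P f \<beta>) (\<lambda>s. f (clip \<beta> s)) u v \<mu> F C B"
    by (rule truncated_solution[OF \<beta>0(1) \<beta>(2) \<zeta>(1) \<beta>0(2) Pm(1) _ R, folded C_def],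
        erule (1) Pm(2), rule that)
  interpret decaying_flow "extension P f \<beta>" "\<lambda>s. f (clip \<beta> s)" u v \<mu> F C B by (rule flow)
  obtain rM where rM: "0 \<le> rM" "\<And>r. 0 \<le> r \<Longrightarrow> u r \<le> u rM" "0 < u rM"
    by (rule attains_max) (rule that)
  have "u rM \<le> \<beta>"
  proof (rule ccontr)
    assume "\<not> u rM \<le> \<beta>"
    then have M: "\<beta> < u rM" by simp
    let ?M = "u rM"
    obtain r1 where r1: "rM < r1" "u r1 = ?M / 2" "\<And>x. rM \<le> x \<Longrightarrow> x < r1 \<Longrightarrow> ?M / 2 < u x"
      by (rule descends[OF rM(1), of "?M / 2"]) (use rM(3) that in auto)
    have ext_nonneg: "0 \<le> extension P f \<beta> s" if "?M / 2 \<le> s" for s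
    proof -
      have s: "\<zeta> \<le> s" using that M \<beta>0 by simp
      show ?thesis
      proof (cases "s \<le> \<beta>")
        case True
        then show ?thesis using P_nonneg[OF s] s \<zeta> by (simp add: extension_eq)
      next
        case False
        then show ?thesis using P_nonneg[OF \<beta>0(2)] increasing[OF \<beta>0(2)] \<beta>0
          by (simp add: extension_above)
      qed
    qed
    have r1_pos: "0 < r1" using r1 rM by linarith
    have "?M - ?M / 2 \<le> sqrt (2 * \<mu> * (extension P f \<beta> ?M - 0)) * (r1 - rM)"
      by (rule descent_time[OF rM(1,2) r1]) (use ext_nonneg in auto)
    also have "\<dots> \<le> sqrt (2 * C\<^sup>2 * (4 * K * ?M\<^sup>2)) * r1"
    proof (rule mult_mono)
      have "2 * \<mu> * (extension P f \<beta> ?M - 0) \<le> 2 * C\<^sup>2 * (4 * K * ?M\<^sup>2)"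
        using \<mu>_le \<mu> extension_upper[OF \<beta>0(1) \<beta>(2), of ?M] ext_nonneg[of ?M] rM(3)
        by (intro mult_mono) auto
      then show "sqrt (2 * \<mu> * (extension P f \<beta> ?M - 0)) \<le> sqrt (2 * C\<^sup>2 * (4 * K * ?M\<^sup>2))" by simp
    qed (use r1 rM K_pos in auto)
    also have "2 * C\<^sup>2 * (4 * K * ?M\<^sup>2) = 8 * K * (C * ?M)\<^sup>2" by (simp add: power_mult_distrib)
    also have "sqrt (8 * K * (C * ?M)\<^sup>2) = sqrt (8 * K) * (C * ?M)"
      using C rM(3) K_pos by (simp add: real_sqrt_mult)
    finally have "?M * (1 / 2) \<le> ?M * (sqrt (8 * K) * C * r1)" by (simp add: mult_ac)
    then have "1 / 2 \<le> sqrt (8 * K) * C * r1" using rM(3) by (simp only: mult_le_cancel_left_pos)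
    then have inv: "1 / r1 \<le> 2 * (sqrt (8 * K) * C)" using r1_pos by (simp add: field_simps)
    have "(?M / 2)\<^sup>2 \<le> 4 * C / r1" using u_decay[OF r1_pos] r1(2) by simp
    also have "\<dots> = 4 * C * (1 / r1)" by simp
    also have "\<dots> \<le> 4 * C * (2 * (sqrt (8 * K) * C))"
      using inv C by (intro mult_left_mono) auto
    finally have "?M\<^sup>2 \<le> 32 * C\<^sup>2 * sqrt (8 * K)" by (simp add: power2_eq_square field_simps)
    then have "?M \<le> sqrt (32 * C\<^sup>2 * sqrt (8 * K))" by (rule real_le_rsqrt)
    then show False using \<beta>_big M by simp
  qed
  then have "u r \<le> \<beta>" if "0 \<le> r" for r using rM(2)[OF that] by simp
  with flow show ?thesis by (rule that)
qed

text \<open>The dilation \<open>r \<mapsto> r / \<surd>\<mu>\<close> removes the Lagrange multiplier.\<close>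

theorem radial_profile:
  assumes \<zeta>: "0 < \<zeta>" "0 < P \<zeta>"
  obtains w v M L B where "radial_solution f w v M L B" "\<exists>r\<ge>0. w r \<noteq> 0"
proof -
  obtain \<beta> u v \<mu> F C B where
    flow: "decaying_flow (extension P f \<beta>) (\<lambda>s. f (clip \<beta> s)) u v \<mu> F C B" and
    u_le: "\<And>r. 0 \<le> r \<Longrightarrow> u r \<le> \<beta>"
    by (rule bounded_truncated_solution[OF \<zeta>]) (rule that)
  note f_cont = f_continuous
  interpret decaying_flow "extension P f \<beta>" "\<lambda>s. f (clip \<beta> s)" u v \<mu> F C B by (rule flow)
  have u_range: "0 \<le> u r \<and> u r \<le> \<beta>" if "0 \<le> r" for r using u_nonneg[OF that] u_le[OF that] by simp
  have clip_u: "clip \<beta> (u r) = u r" if "0 \<le> r" for r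
    using u_range[OF that] by (intro clip_id) auto
  define k where "k = 1 / sqrt \<mu>"
  have k: "0 < k" "k\<^sup>2 * \<mu> = 1" using \<mu> by (auto simp: k_def power_divide)
  define w where "w = (\<lambda>r. u (k * r))"
  define z where "z = (\<lambda>r. k * v (k * r))"
  \<comment> \<open>The substitution costs \<open>k^3\<close>: two factors from the weight
    \<open>r^2\<close>, one from dr. Rounding \<open>k X\<close> up to a natural \<open>Y\<close> is
    harmless since the integrand is nonnegative.\<close>
  have bound: "integral {0..real X} (\<lambda>r. r\<^sup>2 * (g (k * r))\<^sup>2) \<le> B / k ^ 3"
    if g: "continuous_on {0..} g" and B: "\<And>X::nat. integral {0..real X} (\<lambda>r. r\<^sup>2 * (g r)\<^sup>2) \<le> B" for g B X
  proof -
    let ?q = "\<lambda>r. r\<^sup>2 * (g r)\<^sup>2"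
    have int: "?q integrable_on {0..b}" for b
      by (intro integrable_continuous_real continuous_intros continuous_on_subset[OF g]) auto
    obtain Y :: nat where Y: "k * real X \<le> real Y" using real_arch_simple by blast
    have "((\<lambda>x. ?q (k * x)) has_integral integral {0..k * real X} ?q / k) {0..real X}"
      using has_integral_stretch_real[OF integrable_integral[OF int[of "k * real X"]], of k] k by simp
    then have "((\<lambda>x. k\<^sup>2 * (x\<^sup>2 * (g (k * x))\<^sup>2)) has_integral integral {0..k * real X} ?q / k) {0..real X}"
      by (simp add: power_mult_distrib mult.assoc)
    from has_integral_mult_right[OF this, of "1 / k\<^sup>2"]
    have "((\<lambda>x. x\<^sup>2 * (g (k * x))\<^sup>2) has_integral integral {0..k * real X} ?q / k ^ 3) {0..real X}"
      using k by (simp add: power2_eq_square power3_eq_cube field_simps)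
    then have "integral {0..real X} (\<lambda>r. r\<^sup>2 * (g (k * r))\<^sup>2) = integral {0..k * real X} ?q / k ^ 3"
      by (rule integral_unique)
    also have "\<dots> \<le> integral {0..real Y} ?q / k ^ 3"
      using Y k int by (intro divide_right_mono integral_subset_le) auto
    also have "\<dots> \<le> B / k ^ 3" using B[of Y] k by (intro divide_right_mono) auto
    finally show ?thesis .
  qed
  have "radial_solution f w z \<beta> F (max (B / k ^ 3) (k\<^sup>2 * (B / k ^ 3)))"
  proof unfold_locales
    show "continuous_on UNIV f" by (rule f_cont)
    show "0 \<le> w r \<and> w r \<le> \<beta>" if "0 \<le> r" for r
      using u_range[of "k * r"] that k by (simp add: w_def)
    show "continuous_on {0..} w"
      unfolding w_def using k by (intro continuous_on_compose2[OF u_cont] continuous_intros) auto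
    fix r :: real
    {
      assume r: "0 < r"
      then have kr: "0 < k * r" using k by simp
      have k_deriv: "((\<lambda>r. k * r) has_real_derivative k) (at r)"
        by (auto intro!: derivative_eq_intros)
      show "(w has_real_derivative z r) (at r)"
        using DERIV_chain2[OF u_deriv[OF kr] k_deriv] by (simp add: w_def z_def mult.commute)
      have "(z has_real_derivative k * ((- 2 * v (k * r) / (k * r) - \<mu> * f (clip \<beta> (u (k * r)))) * k)) (at r)"
        unfolding z_def by (rule DERIV_cmult[OF DERIV_chain2[OF v_deriv[OF kr] k_deriv]])
      moreover have "k * ((- 2 * v (k * r) / (k * r) - \<mu> * f (clip \<beta> (u (k * r)))) * k)
          = - 2 * z r / r - (k\<^sup>2 * \<mu>) * f (clip \<beta> (u (k * r)))"
        using r k(1) by (simp add: z_def field_simps power2_eq_square)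
      ultimately show "(z has_real_derivative - 2 * z r / r - f (w r)) (at r)"
        using k(2) clip_u[of "k * r"] kr by (simp add: w_def)
    }
    show "\<bar>z r\<bar> \<le> F * r" if "0 \<le> r"
    proof -
      have "\<bar>z r\<bar> = k * \<bar>v (k * r)\<bar>" using k by (simp add: z_def abs_mult)
      also have "\<dots> \<le> k * (\<mu> * F * (k * r))"
        using that k by (intro mult_left_mono abs_v_le) auto
      also have "\<dots> = (k\<^sup>2 * \<mu>) * F * r" by (simp add: power2_eq_square mult_ac)
      finally show ?thesis using k(2) by simp
    qed
  next
    have "filterlim (\<lambda>r. k * r) (at_right 0) (at_right 0)"
      using filterlim_times_pos[OF filterlim_ident k(1), of 0 0] by simp
    from filterlim_compose[OF v_quotient_limit this]
    have "((\<lambda>r. k\<^sup>2 * (v (k * r) / (k * r))) \<longlongrightarrow> k\<^sup>2 * (- \<mu> * f (clip \<beta> (u 0)) / 3)) (at_right 0)"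
      by (intro tendsto_mult tendsto_const)
    moreover have "k\<^sup>2 * (v (k * r) / (k * r)) = z r / r" for r
      using k(1) by (simp add: z_def power2_eq_square)
    moreover have "k\<^sup>2 * (- \<mu> * f (clip \<beta> (u 0)) / 3) = - (k\<^sup>2 * \<mu>) * f (u 0) / 3"
      by (simp add: clip_u)
    ultimately show "((\<lambda>r. z r / r) \<longlongrightarrow> - f (w 0) / 3) (at_right 0)"
      unfolding k(2) by (simp add: w_def)
    show "integral {0..real X} (\<lambda>r. r\<^sup>2 * (w r)\<^sup>2) \<le> max (B / k ^ 3) (k\<^sup>2 * (B / k ^ 3))" for X
      using bound[OF u_cont u_mass, of X] by (simp add: w_def)
    show "integral {0..real X} (\<lambda>r. r\<^sup>2 * (z r)\<^sup>2) \<le> max (B / k ^ 3) (k\<^sup>2 * (B / k ^ 3))" for X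
    proof -
      have "integral {0..real X} (\<lambda>r. r\<^sup>2 * (z r)\<^sup>2) = integral {0..real X} (\<lambda>r. k\<^sup>2 * (r\<^sup>2 * (v (k * r))\<^sup>2))"
        by (simp add: z_def power_mult_distrib mult_ac)
      also have "\<dots> = k\<^sup>2 * integral {0..real X} (\<lambda>r. r\<^sup>2 * (v (k * r))\<^sup>2)" by simp
      also have "\<dots> \<le> k\<^sup>2 * (B / k ^ 3)"
        using bound[OF v_cont v_mass, of X] by (intro mult_left_mono) auto
      finally show ?thesis by simp
    qed
  qed
  moreover obtain r where r: "0 \<le> r" "u r \<noteq> 0" using u_nontrivial by blast
  then have "w (r / k) \<noteq> 0" using k by (simp add: w_def)
  then have "\<exists>r\<ge>0. w r \<noteq> 0" using r k by (intro exI[of _ "r / k"]) auto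
  ultimately show ?thesis by (rule that)
qed

end

section \<open>Integration by parts and polar coordinates\<close>

lemma bounded_support_integrable:
  fixes g :: "'a::euclidean_space \<Rightarrow> real"
  assumes "g \<in> borel_measurable borel" "\<And>x. \<bar>g x\<bar> \<le> K" "\<And>x. R \<le> norm x \<Longrightarrow> g x = 0"
  shows "integrable lborel g"
proof (rule Bochner_Integration.integrable_bound)
  show "integrable lborel (\<lambda>x. K * indicator (cball 0 R) x :: real)"
    by (intro integrable_mult_right integrable_real_indicator emeasure_lborel_cball_finite) auto
  have K: "0 \<le> K" using assms(2)[of undefined] by linarith
  show "AE x in lborel. norm (g x) \<le> norm (K * indicator (cball 0 R) x :: real)"
    using assms(2,3) K by (intro AE_I2) (auto simp: indicator_def not_le)
qed (use assms in auto)

lemma continuous_bounded_if_support: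
  fixes g :: "'a::euclidean_space \<Rightarrow> real"
  assumes "continuous_on UNIV g" "\<And>x. R \<le> norm x \<Longrightarrow> g x = 0"
  obtains K where "\<And>x. \<bar>g x\<bar> \<le> K"
proof -
  obtain K where K: "\<forall>x\<in>cball 0 R. \<bar>g x\<bar> \<le> K"
    by (rule continuous_bounded_on_compact[OF continuous_on_subset[OF assms(1) subset_UNIV] compact_cball]) (rule that)
  have "\<bar>g x\<bar> \<le> \<bar>K\<bar>" for x
    using K assms(2)[of x] by (cases "R \<le> norm x") (auto dest!: bspec[of _ _ x])
  then show ?thesis by (rule that)
qed

text \<open>Difference quotients have integral zero by translation invariance of Lebesgue measure.\<close>

lemma integral_directional_derivative:
  fixes g g' :: "'a::euclidean_space \<Rightarrow> real"
  assumes deriv: "\<And>x. ((\<lambda>s. g (x + s *\<^sub>R e)) has_real_derivative g' x) (at 0)"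
    and K: "\<And>x. \<bar>g' x\<bar> \<le> K" and cont: "continuous_on UNIV g"
    and supp: "\<And>x. R \<le> norm x \<Longrightarrow> g x = 0"
  shows "g' \<in> borel_measurable borel" "integrable lborel g'" "integral\<^sup>L lborel g' = 0"
proof -
  have g_meas: "g \<in> borel_measurable borel" using cont by (rule borel_measurable_continuous_onI)
  obtain A where A: "\<And>x. \<bar>g x\<bar> \<le> A" using continuous_bounded_if_support[OF cont supp] by blast
  have g_int: "integrable lborel g" using g_meas A supp by (rule bounded_support_integrable)
  define D where "D = (\<lambda>n x. real (Suc n) * (g (x + (1 / real (Suc n)) *\<^sub>R e) - g x))"
  have D_meas: "D n \<in> borel_measurable borel" for n
    unfolding D_def using g_meas by measurable
  have D_lim: "(\<lambda>n. D n x) \<longlonglongrightarrow> g' x" for x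
  proof -
    have "((\<lambda>h. (g (x + h *\<^sub>R e) - g x) / h) \<longlongrightarrow> g' x) (at 0)"
      using deriv[of x] by (simp add: DERIV_def)
    moreover have "filterlim (\<lambda>n. 1 / real (Suc n)) (at 0) sequentially"
      using LIMSEQ_inverse_real_of_nat by (auto simp: filterlim_at inverse_eq_divide)
    ultimately have "(\<lambda>n. (g (x + (1 / real (Suc n)) *\<^sub>R e) - g x) / (1 / real (Suc n))) \<longlonglongrightarrow> g' x"
      by (rule filterlim_compose)
    then show ?thesis by (simp add: D_def mult.commute)
  qed
  \<comment> \<open>The hypothesis at every base point gives differentiability along the whole line,
    so the mean value theorem bounds the difference quotients by \<open>K\<close>.\<close>
  have deriv_at: "((\<lambda>s. g (x + s *\<^sub>R e)) has_real_derivative g' (x + t *\<^sub>R e)) (at t)" for x t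
    using deriv[of "x + t *\<^sub>R e"] DERIV_shift[of "\<lambda>s. g (x + s *\<^sub>R e)" "g' (x + t *\<^sub>R e)" 0 t]
    by (simp add: algebra_simps)
  have D_bound: "\<bar>D n x\<bar> \<le> K" for n x
  proof -
    have "\<exists>l z. 0 < z \<and> z < 1 / real (Suc n) \<and> ((\<lambda>s. g (x + s *\<^sub>R e)) has_real_derivative l) (at z) \<and>
        g (x + (1 / real (Suc n)) *\<^sub>R e) - g (x + 0 *\<^sub>R e) = (1 / real (Suc n) - 0) * l"
    proof (rule MVT)
      show "continuous_on {0..1 / real (Suc n)} (\<lambda>s. g (x + s *\<^sub>R e))"
        by (intro continuous_on_compose2[OF cont] continuous_intros) auto
      show "(\<lambda>s. g (x + s *\<^sub>R e)) differentiable at z" for z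
        using deriv_at real_differentiable_def by blast
    qed simp
    then obtain z where "g (x + (1 / real (Suc n)) *\<^sub>R e) - g x = 1 / real (Suc n) * g' (x + z *\<^sub>R e)"
      using DERIV_unique[OF deriv_at] by fastforce
    then have "D n x = g' (x + z *\<^sub>R e)" by (simp add: D_def)
    then show ?thesis using K by simp
  qed
  \<comment> \<open>All shifts have length at most \<open>norm e\<close>, so one ball contains every
    support and yields an integrable majorant.\<close>
  have D_supp: "D n x = 0" if x: "\<bar>R\<bar> + norm e \<le> norm x" for n x
  proof -
    have "norm ((1 / real (Suc n)) *\<^sub>R e) \<le> norm e"
      by (simp add: field_simps)
    then have "R \<le> norm (x + (1 / real (Suc n)) *\<^sub>R e)"
      using x norm_triangle_ineq4[of "x + (1 / real (Suc n)) *\<^sub>R e" "(1 / real (Suc n)) *\<^sub>R e"] by simp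
    moreover have "R \<le> norm x" using x norm_ge_zero[of e] by linarith
    ultimately show ?thesis by (simp add: D_def supp)
  qed
  have transl: "integrable lborel (\<lambda>x. g (x + c))" "(\<integral>x. g (x + c) \<partial>lborel) = integral\<^sup>L lborel g" for c
    using lborel_distr_plus[of c] g_meas g_int
      integrable_distr_eq[of "(+) c" lborel borel g] integral_distr[of "(+) c" lborel borel g]
    by (simp_all add: add.commute)
  have D_int: "integral\<^sup>L lborel (D n) = 0" for n
    unfolding D_def using transl g_int by simp
  let ?w = "\<lambda>x. K * indicator (cball 0 (\<bar>R\<bar> + norm e)) x :: real"
  have K0: "0 \<le> K" using K[of undefined] by linarith
  have w: "integrable lborel ?w"
    by (intro integrable_mult_right integrable_real_indicator emeasure_lborel_cball_finite) auto
  show meas: "g' \<in> borel_measurable borel"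
    by (rule borel_measurable_LIMSEQ_real[OF D_lim D_meas])
  have dom: "AE x in lborel. norm (D n x) \<le> ?w x" for n
    using D_bound[of n] D_supp[of _ n] K0 by (intro AE_I2) (auto simp: indicator_def not_le)
  show "integrable lborel g'"
    by (rule integrable_dominated_convergence[where s=D and w="?w", OF _ _ w _ dom]) (use meas D_meas D_lim in auto)
  have "(\<lambda>n. integral\<^sup>L lborel (D n)) \<longlonglongrightarrow> integral\<^sup>L lborel g'"
    by (rule integral_dominated_convergence[where s=D and w="?w", OF _ _ w _ dom]) (use meas D_meas D_lim in auto)
  then show "integral\<^sup>L lborel g' = 0" unfolding D_int by (simp add: LIMSEQ_const_iff)
qed

text \<open>Product rule, then \<open>integral_directional_derivative\<close> applied to the
  product, which vanishes wherever \<open>a\<close> does.\<close>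

lemma integration_by_parts:
  fixes a a' b b' :: "'a::euclidean_space \<Rightarrow> real"
  assumes a: "\<And>x. ((\<lambda>s. a (x + s *\<^sub>R e)) has_real_derivative a' x) (at 0)" "continuous_on UNIV a"
      "\<And>x. R \<le> norm x \<Longrightarrow> a x = 0" "\<And>x. R \<le> norm x \<Longrightarrow> a' x = 0"
      "\<And>x. \<bar>a' x\<bar> \<le> K" "a' \<in> borel_measurable borel"
    and b: "\<And>x. ((\<lambda>s. b (x + s *\<^sub>R e)) has_real_derivative b' x) (at 0)" "continuous_on UNIV b"
      "\<And>x. norm x < R \<Longrightarrow> \<bar>b x\<bar> \<le> L" "\<And>x. norm x < R \<Longrightarrow> \<bar>b' x\<bar> \<le> L" "0 \<le> L"
  shows "integrable lborel (\<lambda>x. a' x * b x)" "integrable lborel (\<lambda>x. a x * b' x)"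
    "(\<integral>x. a' x * b x \<partial>lborel) = - (\<integral>x. a x * b' x \<partial>lborel)"
proof -
  obtain A where A: "\<And>x. \<bar>a x\<bar> \<le> A" using continuous_bounded_if_support[OF a(2,3)] by blast
  have nonneg: "0 \<le> A" "0 \<le> K" "0 \<le> L"
    using A[of undefined] a(5)[of undefined] b(5) by linarith+
  have b_meas: "b \<in> borel_measurable borel" using b(2) by (rule borel_measurable_continuous_onI)
  have 1: "\<bar>a' x * b x\<bar> \<le> K * L" for x
    using a(4,5)[of x] b(3)[of x] nonneg
    by (cases "norm x < R") (auto simp: abs_mult intro!: mult_mono)
  have 2: "\<bar>a x * b' x\<bar> \<le> A * L" for x
    using a(3)[of x] A[of x] b(4)[of x] nonneg
    by (cases "norm x < R") (auto simp: abs_mult intro!: mult_mono)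
  show int1: "integrable lborel (\<lambda>x. a' x * b x)"
    by (rule bounded_support_integrable[OF _ 1, where R=R]) (use a b_meas in auto)
  have deriv: "((\<lambda>s. a (x + s *\<^sub>R e) * b (x + s *\<^sub>R e)) has_real_derivative a' x * b x + a x * b' x) (at 0)" for x
    using DERIV_mult[OF a(1) b(1), of x] by (simp add: mult.commute)
  have bound: "\<bar>a' x * b x + a x * b' x\<bar> \<le> K * L + A * L" for x
    using 1[of x] 2[of x] by linarith
  have cont: "continuous_on UNIV (\<lambda>x. a x * b x)" by (intro continuous_intros a b)
  have zero: "a x * b x = 0" if "R \<le> norm x" for x using a(3)[OF that] by simp
  have D: "(\<lambda>x. a' x * b x + a x * b' x) \<in> borel_measurable borel"
      "(\<integral>x. a' x * b x + a x * b' x \<partial>lborel) = 0"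
    by (rule integral_directional_derivative[OF deriv bound cont], erule zero)+
  \<comment> \<open>Measurability of \<open>a x * b' x\<close> is inherited from the derivative of
    the product, a pointwise limit of difference quotients.\<close>
  have "(\<lambda>x. (a' x * b x + a x * b' x) - a' x * b x) \<in> borel_measurable borel"
    using D(1) a(6) b_meas by (intro borel_measurable_diff borel_measurable_times) auto
  then have "(\<lambda>x. a x * b' x) \<in> borel_measurable borel" by simp
  then show int2: "integrable lborel (\<lambda>x. a x * b' x)"
    by (rule bounded_support_integrable[OF _ 2, where R=R]) (use a in auto)
  show "(\<integral>x. a' x * b x \<partial>lborel) = - (\<integral>x. a x * b' x \<partial>lborel)"
    using D(2) int1 int2 by simp
qed

section \<open>Calculus of test functions\<close>

lemma partial_deriv:
  assumes "f differentiable (at x)"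
  shows "((\<lambda>s. f (x + s *\<^sub>R b)) has_real_derivative partial b f x) (at 0)"
proof -
  have "(f has_derivative frechet_derivative f (at x)) (at x)"
    using assms frechet_derivative_works by blast
  then have "((\<lambda>s. f (x + s *\<^sub>R b)) has_derivative (\<lambda>s. frechet_derivative f (at x) (s *\<^sub>R b))) (at 0)"
    by (intro has_derivative_compose[where f="\<lambda>s. x + s *\<^sub>R b" and g=f, simplified])
      (auto intro!: derivative_eq_intros)
  then have "(\<lambda>s. f (x + s *\<^sub>R b)) differentiable (at 0)"
    using differentiable_def by blast
  then show ?thesis
    unfolding partial_def by (simp add: DERIV_deriv_iff_real_differentiable)
qed

lemma partialI: "((\<lambda>s. f (x + s *\<^sub>R b)) has_real_derivative D) (at 0) \<Longrightarrow> partial b f x = D"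
  unfolding partial_def by (rule DERIV_imp_deriv)

lemma test_function_Ck: "test_function \<phi> \<Longrightarrow> Ck k \<phi>"
  by (simp add: test_function_def)

lemma test_function_differentiable: "test_function \<phi> \<Longrightarrow> \<phi> differentiable (at x)"
  using test_function_Ck[of \<phi> "Suc 0"] by simp

lemma test_function_continuous: "test_function \<phi> \<Longrightarrow> continuous_on UNIV \<phi>"
  using test_function_Ck[of \<phi> 0] by simp

lemma partial_eq_0_outside_support:
  assumes "x \<notin> closure {x. \<phi> x \<noteq> 0}"
  shows "partial b \<phi> x = 0"
proof (rule partialI)
  let ?S = "- closure {x. \<phi> x \<noteq> 0}"
  let ?V = "(\<lambda>s::real. x + s *\<^sub>R b) -` ?S"
  have V: "open ?V" by (intro continuous_open_vimage continuous_intros) auto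
  have zero: "\<phi> y = 0" if "y \<in> ?S" for y
    using that closure_subset[of "{x. \<phi> x \<noteq> 0}"] by blast
  show "((\<lambda>s. \<phi> (x + s *\<^sub>R b)) has_real_derivative 0) (at 0)"
  proof (rule has_field_derivative_transform_within_open[OF _ V])
    show "((\<lambda>s. 0) has_real_derivative 0) (at 0)" by (rule DERIV_const)
    show "0 \<in> ?V" using assms by simp
    show "0 = \<phi> (x + s *\<^sub>R b)" if "s \<in> ?V" for s
      by (rule zero[symmetric]) (use that in \<open>simp only: vimage_eq\<close>)
  qed
qed

lemma test_function_partial:
  assumes "test_function \<phi>" "b \<in> Basis"
  shows "test_function (partial b \<phi>)"
  unfolding test_function_def
proof
  show "\<forall>k. Ck k (partial b \<phi>)"
  proof
    fix k
    have "Ck (Suc k) \<phi>" using assms(1) by (rule test_function_Ck)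
    then show "Ck k (partial b \<phi>)" using assms(2) by simp
  qed
  have "{x. partial b \<phi> x \<noteq> 0} \<subseteq> closure {x. \<phi> x \<noteq> 0}"
    using partial_eq_0_outside_support by blast
  then have "closure {x. partial b \<phi> x \<noteq> 0} \<subseteq> closure {x. \<phi> x \<noteq> 0}"
    by (intro closure_minimal) auto
  then have "closure {x. partial b \<phi> x \<noteq> 0} = closure {x. \<phi> x \<noteq> 0} \<inter> closure {x. partial b \<phi> x \<noteq> 0}"
    by (rule Int_absorb1[symmetric])
  moreover have "compact (closure {x. \<phi> x \<noteq> 0} \<inter> closure {x. partial b \<phi> x \<noteq> 0})"
    using assms(1) by (intro compact_Int_closed closed_closure) (simp add: test_function_def)
  ultimately show "compact (closure {x. partial b \<phi> x \<noteq> 0})" by (simp only:)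
qed

lemma test_function_support:
  assumes "test_function \<phi>"
  obtains R where "\<And>x. R \<le> norm x \<Longrightarrow> \<phi> x = 0 \<and> (\<forall>b. partial b \<phi> x = 0)"
proof -
  have "bounded (closure {x. \<phi> x \<noteq> 0})"
    using assms compact_imp_bounded unfolding test_function_def by blast
  then obtain R where R: "\<And>x. x \<in> closure {x. \<phi> x \<noteq> 0} \<Longrightarrow> norm x \<le> R"
    unfolding bounded_iff by blast
  have "\<phi> x = 0 \<and> (\<forall>b. partial b \<phi> x = 0)" if "R + 1 \<le> norm x" for x
  proof -
    have "x \<notin> closure {x. \<phi> x \<noteq> 0}" using R[of x] that by linarith
    then show ?thesis
      using partial_eq_0_outside_support closure_subset[of "{x. \<phi> x \<noteq> 0}"] by blast
  qed
  then show ?thesis by (rule that)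
qed

lemma continuous_locally_bounded:
  fixes g :: "'a::euclidean_space \<Rightarrow> real"
  assumes "continuous_on UNIV g"
  shows "\<exists>L. \<forall>x. norm x < R \<longrightarrow> \<bar>g x\<bar> \<le> L"
proof -
  obtain L where "\<forall>x\<in>cball 0 R. \<bar>g x\<bar> \<le> L"
    by (rule continuous_bounded_on_compact[OF continuous_on_subset[OF assms subset_UNIV] compact_cball]) (rule that)
  then show ?thesis by (intro exI[of _ L]) auto
qed

text \<open>Local boundedness of \<open>b'\<close> is the condition because the second derivatives
  of the profile enter only through a bound.\<close>

lemma test_function_integration_by_parts:
  fixes \<phi> b b' :: "'a::euclidean_space \<Rightarrow> real"
  assumes \<phi>: "test_function \<phi>" and e: "e \<in> Basis"
    and b: "\<And>x. ((\<lambda>s. b (x + s *\<^sub>R e)) has_real_derivative b' x) (at 0)" "continuous_on UNIV b"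
      "\<And>R. \<exists>L. \<forall>x. norm x < R \<longrightarrow> \<bar>b' x\<bar> \<le> L"
  shows "integrable lborel (\<lambda>x. partial e \<phi> x * b x)" "integrable lborel (\<lambda>x. \<phi> x * b' x)"
    "(\<integral>x. partial e \<phi> x * b x \<partial>lborel) = - (\<integral>x. \<phi> x * b' x \<partial>lborel)"
proof -
  obtain R where R: "\<And>x. R \<le> norm x \<Longrightarrow> \<phi> x = 0 \<and> (\<forall>b. partial b \<phi> x = 0)"
    by (rule test_function_support[OF \<phi>]) (rule that)
  have c: "continuous_on UNIV (partial e \<phi>)"
    by (rule test_function_continuous[OF test_function_partial[OF \<phi> e]])
  have R1: "\<phi> x = 0" and R2: "partial e \<phi> x = 0" if "R \<le> norm x" for x
    using R[OF that] by auto
  obtain K where K: "\<And>x. \<bar>partial e \<phi> x\<bar> \<le> K"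
    by (rule continuous_bounded_if_support[OF c], erule R2, rule that)
  obtain L1 where L1: "\<forall>x. norm x < R \<longrightarrow> \<bar>b x\<bar> \<le> L1" using continuous_locally_bounded[OF b(2)] by blast
  obtain L2 where L2: "\<forall>x. norm x < R \<longrightarrow> \<bar>b' x\<bar> \<le> L2" using b(3) by blast
  define L where "L = max (\<bar>L1\<bar>) (\<bar>L2\<bar>)"
  have L: "\<bar>b x\<bar> \<le> L" "\<bar>b' x\<bar> \<le> L" if "norm x < R" for x
    using L1[rule_format, of x] L2[rule_format, of x] that by (auto simp: L_def)
  have L0: "0 \<le> L" by (simp add: L_def)
  note prems = partial_deriv[OF test_function_differentiable[OF \<phi>], where b=e] test_function_continuous[OF \<phi>]
    R1 R2 K borel_measurable_continuous_onI[OF c] b(1,2) L L0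
  note ibp = integration_by_parts[where a=\<phi> and a'="partial e \<phi>" and b=b and b'=b' and e=e
      and R=R and K=K and L=L]
  show "integrable lborel (\<lambda>x. partial e \<phi> x * b x)" by (rule ibp(1)) (rule prems | assumption)+
  show "integrable lborel (\<lambda>x. \<phi> x * b' x)" by (rule ibp(2)) (rule prems | assumption)+
  show "(\<integral>x. partial e \<phi> x * b x \<partial>lborel) = - (\<integral>x. \<phi> x * b' x \<partial>lborel)" by (rule ibp(3)) (rule prems | assumption)+
qed

text \<open>Both measures are determined by their values on the intervals \<open>{..b}\<close>.\<close>

lemma distr_norm_lborel:
  "distr lborel borel (norm :: real^3 \<Rightarrow> real) = density lborel (\<lambda>r. ennreal (4 * pi * r\<^sup>2 * indicator {0..} r))"
    (is "?M = ?N")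
proof (rule measure_eqI_generator_eq[where E="range (\<lambda>b::real. {..b})" and \<Omega>=UNIV and A="\<lambda>n. {..real n}"])
  show "Int_stable (range (\<lambda>b::real. {..b}))"
    by (auto simp: Int_stable_def)
  have eq: "emeasure ?M {..b} = ennreal (4 / 3 * pi * max 0 b ^ 3)" for b :: real
  proof (cases "0 \<le> b")
    case True
    have "emeasure ?M {..b} = emeasure lborel (cball (0::real^3) b)"
      by (subst emeasure_distr) (auto intro!: arg_cong[where f="emeasure lborel"])
    also have "\<dots> = ennreal (4 / 3 * pi * b ^ 3)"
      using True by (simp add: emeasure_cball unit_ball_vol_3)
    finally show ?thesis using True by simp
  next
    case False
    then have "norm -` {..b} = ({} :: (real^3) set)"
      using order_trans[OF norm_ge_zero] by auto
    then show ?thesis using False by (subst emeasure_distr) auto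
  qed
  have eq': "emeasure ?N {..b} = ennreal (4 / 3 * pi * max 0 b ^ 3)" for b :: real
  proof -
    have "emeasure ?N {..b} = (\<integral>\<^sup>+r. ennreal (4 * pi * r\<^sup>2 * indicator {0..} r) * indicator {..b} r \<partial>lborel)"
      by (rule emeasure_density) auto
    also have "\<dots> = (\<integral>\<^sup>+r. ennreal (4 * pi * r\<^sup>2) * indicator {0..b} r \<partial>lborel)"
      by (intro nn_integral_cong) (auto simp: indicator_def)
    also have "\<dots> = ennreal (4 / 3 * pi * max 0 b ^ 3)"
    proof (cases "0 \<le> b")
      case True
      have "(\<integral>\<^sup>+r. ennreal (4 * pi * r\<^sup>2) * indicator {0..b} r \<partial>lborel)
          = ennreal (4 / 3 * pi * b ^ 3 - 4 / 3 * pi * 0 ^ 3)"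
        by (rule nn_integral_FTC_Icc) (use True in \<open>auto intro!: derivative_eq_intros simp: power2_eq_square\<close>)
      then show ?thesis using True by simp
    next
      case False
      then show ?thesis by simp
    qed
    finally show ?thesis .
  qed
  show "emeasure ?M X = emeasure ?N X" if "X \<in> range (\<lambda>b::real. {..b})" for X
    using that eq eq' by auto
  show "sets ?M = sigma_sets UNIV (range (\<lambda>b::real. {..b}))"
    "sets ?N = sigma_sets UNIV (range (\<lambda>b::real. {..b}))"
    by (simp_all add: borel_eq_atMost)
  show "(\<Union>n. {..real n}) = UNIV"
    using real_arch_simple by auto
  show "emeasure ?M {..real n} \<noteq> \<infinity>" for n by (simp add: eq)
qed auto

text \<open>Polar coordinates turn the integral over space into \<open>4 * pi\<close> times the
  radial one, a supremum over [0, X] by monotone convergence; the common bound \<open>B\<close>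
  makes it finite.\<close>

lemma integrable_radial:
  fixes g :: "real \<Rightarrow> real"
  assumes g: "continuous_on {0..} g" and nonneg: "\<And>r. 0 \<le> r \<Longrightarrow> 0 \<le> g r"
    and bound: "\<And>X::nat. integral {0..real X} (\<lambda>r. r\<^sup>2 * g r) \<le> B"
  shows "integrable lborel (\<lambda>x::real^3. g (norm x))"
proof -
  \<comment> \<open>Extended by 0 to the negative axis, to be measurable on the whole line.\<close>
  define h where "h = (\<lambda>r. if 0 \<le> r then g r else 0)"
  have h_meas: "h \<in> borel_measurable borel"
    unfolding h_def using borel_measurable_continuous_on_if[of "{0..}" g "\<lambda>_. 0"] g by simp
  have h_nonneg: "0 \<le> h r" for r using nonneg by (simp add: h_def)
  let ?k = "\<lambda>r. ennreal (4 * pi * r\<^sup>2 * indicator {0..} r) * ennreal (h r)"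
  have "(\<integral>\<^sup>+x. ennreal (h (norm (x::real^3))) \<partial>lborel) = (\<integral>\<^sup>+r. ennreal (h r) \<partial>distr lborel borel (norm :: real^3 \<Rightarrow> real))"
    using h_meas by (subst nn_integral_distr) auto
  also have "\<dots> = (\<integral>\<^sup>+r. ?k r \<partial>lborel)"
    unfolding distr_norm_lborel using h_meas by (subst nn_integral_density) auto
  also have "\<dots> = (\<integral>\<^sup>+r. (SUP X::nat. ?k r * indicator {0..real X} r) \<partial>lborel)"
  proof (intro nn_integral_cong)
    fix r :: real
    obtain Y :: nat where Y: "r \<le> real Y" using real_arch_simple by blast
    show "?k r = (SUP X::nat. ?k r * indicator {0..real X} r)"
    proof (rule antisym)
      have "?k r \<le> ?k r * indicator {0..real Y} r" using Y by (auto simp: indicator_def)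
      also have "\<dots> \<le> (SUP X::nat. ?k r * indicator {0..real X} r)" by (rule SUP_upper) simp
      finally show "?k r \<le> (SUP X::nat. ?k r * indicator {0..real X} r)" .
    qed (auto intro!: SUP_least simp: indicator_def)
  qed
  also have "\<dots> = (SUP X::nat. \<integral>\<^sup>+r. ?k r * indicator {0..real X} r \<partial>lborel)"
    using h_meas
    by (intro nn_integral_monotone_convergence_SUP)
      (auto intro!: incseq_SucI le_funI simp: indicator_def)
  also have "\<dots> \<le> ennreal (4 * pi * B)"
  proof (rule SUP_least)
    fix X :: nat
    let ?p = "\<lambda>r. r\<^sup>2 * g r"
    have cont: "continuous_on {0..real X} ?p"
      by (intro continuous_intros continuous_on_subset[OF g]) auto
    have "(?p has_integral integral {0..real X} ?p) {0..real X}"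
      using integrable_continuous_real[OF cont] by (rule integrable_integral)
    then have star: "(\<integral>\<^sup>+r. ennreal (?p r) * indicator {0..real X} r \<partial>lborel) = ennreal (integral {0..real X} ?p)"
      by (rule nn_integral_has_integral_lebesgue'[rotated]) (use nonneg in auto)
    have "(\<integral>\<^sup>+r. ?k r * indicator {0..real X} r \<partial>lborel)
        = (\<integral>\<^sup>+r. ennreal (4 * pi) * (ennreal (r\<^sup>2 * h r) * indicator {0..real X} r) \<partial>lborel)"
      by (intro nn_integral_cong) (auto simp: indicator_def h_nonneg ennreal_mult' mult_ac)
    also have "\<dots> = ennreal (4 * pi) * (\<integral>\<^sup>+r. ennreal (r\<^sup>2 * h r) * indicator {0..real X} r \<partial>lborel)"
      using h_meas by (intro nn_integral_cmult borel_measurable_times_ennreal borel_measurable_indicator) auto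
    also have "(\<integral>\<^sup>+r. ennreal (r\<^sup>2 * h r) * indicator {0..real X} r \<partial>lborel)
        = (\<integral>\<^sup>+r. ennreal (?p r) * indicator {0..real X} r \<partial>lborel)"
      by (intro nn_integral_cong) (auto simp: indicator_def h_def)
    also note star
    also have "ennreal (4 * pi) * ennreal (integral {0..real X} ?p) \<le> ennreal (4 * pi * B)"
      using bound[of X] by (subst ennreal_mult'[symmetric]) (auto intro!: ennreal_leI)
    finally show "(\<integral>\<^sup>+r. ?k r * indicator {0..real X} r \<partial>lborel) \<le> ennreal (4 * pi * B)" .
  qed
  finally have fin: "(\<integral>\<^sup>+x. ennreal (h (norm (x::real^3))) \<partial>lborel) < \<infinity>"
    by (simp add: le_less_trans)
  have "integrable lborel (\<lambda>x::real^3. h (norm x))"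
    using h_meas h_nonneg fin by (intro integrableI_nonneg) auto
  then show ?thesis by (simp add: h_def)
qed

section \<open>Radial functions on three-dimensional space\<close>

lemma norm_directional_derivative:
  fixes x e :: "'a::real_inner"
  assumes "x \<noteq> 0"
  shows "((\<lambda>s. norm (x + s *\<^sub>R e)) has_real_derivative (x \<bullet> e) / norm x) (at 0)"
proof -
  have "((\<lambda>s. x + s *\<^sub>R e) has_derivative (\<lambda>s. s *\<^sub>R e)) (at 0)"
    by (auto intro!: derivative_eq_intros)
  moreover have "(norm has_derivative (\<lambda>y. y \<bullet> sgn x)) (at (x + 0 *\<^sub>R e))"
    using assms has_derivative_norm by simp
  ultimately have "((\<lambda>s. norm (x + s *\<^sub>R e)) has_derivative (\<lambda>s. (s *\<^sub>R e) \<bullet> sgn x)) (at 0)"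
    by (rule has_derivative_compose)
  moreover have "(\<lambda>s. (s *\<^sub>R e) \<bullet> sgn x) = (*) ((x \<bullet> e) / norm x)"
    by (auto simp: sgn_div_norm inner_commute fun_eq_iff divide_inverse mult_ac)
  ultimately show ?thesis by (simp add: has_field_derivative_def)
qed

context radial_solution
begin

text \<open>The quotient with its limit at 0 filled in, so that the gradient,
  \<open>q (norm x)\<close> times \<open>x\<close>, has no singularity at the origin.\<close>

definition q :: "real \<Rightarrow> real" where
  "q r = (if r = 0 then - f (w 0) / 3 else v r / r)"

definition U :: "real^3 \<Rightarrow> real" where
  "U x = w (norm x)"

definition gradU :: "real^3 \<Rightarrow> real^3" where
  "gradU x = q (norm x) *\<^sub>R x"

text \<open>The pure second derivatives, enough for the Laplacian. The last summand is the
  derivative \<open>(- f (w r) - 3 q) / r\<close> of \<open>q\<close>, times the derivative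
  \<open>x_i / r\<close> of the norm, times \<open>x_i\<close>.\<close>

definition hess :: "3 \<Rightarrow> real^3 \<Rightarrow> real" where
  "hess i x = (if x = 0 then q 0
     else q (norm x) + (- f (w (norm x)) - 3 * q (norm x)) * (x $ i)\<^sup>2 / (norm x)\<^sup>2)"

lemma v_0: "v 0 = 0"
  using v_le[of 0] by simp

lemma v_q: "v r = r * q r"
  by (simp add: q_def v_0)

lemma q_deriv:
  assumes r: "0 < r"
  shows "(q has_real_derivative (- f (w r) - 3 * q r) / r) (at r)"
proof -
  have "((\<lambda>r. v r / r) has_real_derivative (- f (w r) - 3 * (v r / r)) / r) (at r)"
    by (rule DERIV_cong[OF DERIV_divide[OF v_deriv[OF r] DERIV_ident]])
      (use r in \<open>auto simp: field_simps power2_eq_square\<close>)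
  then have "(q has_real_derivative (- f (w r) - 3 * (v r / r)) / r) (at r)"
    by (rule has_field_derivative_transform_within_open[where S="{0<..}"])
      (use r in \<open>auto simp: q_def\<close>)
  then show ?thesis using r by (simp add: q_def)
qed

lemma q_lim: "(q \<longlongrightarrow> q 0) (at_right 0)"
proof -
  have "\<forall>\<^sub>F r in at_right 0. v r / r = q r"
    by (simp add: eventually_at_filter q_def)
  then show ?thesis
    using v_lim by (auto simp: q_def[of 0] intro: Lim_transform_eventually)
qed

lemma q_cont: "continuous_on {0..} q"
  unfolding continuous_on_eq_continuous_within
proof
  fix r :: real assume "r \<in> {0..}"
  then consider "r = 0" | "0 < r" by fastforce
  then show "continuous (at r within {0..}) q"
  proof cases
    case 1
    have "at (0::real) within {0..} = at_right 0"
      by (rule at_within_Ici_at_right)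
    then show ?thesis using q_lim 1 by (simp add: continuous_within)
  next
    case 2
    then show ?thesis using DERIV_isCont[OF q_deriv] continuous_at_imp_continuous_at_within by blast
  qed
qed

lemma f_w_bounded: obtains F where "\<And>r. 0 \<le> r \<Longrightarrow> \<bar>f (w r)\<bar> \<le> F"
proof -
  obtain F where "\<forall>s\<in>{0..M}. \<bar>f s\<bar> \<le> F"
    by (rule continuous_bounded_on_compact[OF continuous_on_subset[OF f_cont]]) auto
  then show ?thesis using that[of F] w_range by auto
qed

lemma abs_q_le: obtains Q where "\<And>r. 0 \<le> r \<Longrightarrow> \<bar>q r\<bar> \<le> Q"
proof
  fix r :: real assume r: "0 \<le> r"
  show "\<bar>q r\<bar> \<le> max L \<bar>q 0\<bar>"
  proof (cases "r = 0")
    case False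
    then have "\<bar>v r\<bar> / r \<le> L" using v_le[OF r] r by (simp add: divide_le_eq)
    then show ?thesis using False r by (simp add: q_def)
  qed simp
qed

lemma continuous_radial:
  assumes "continuous_on {0..} g"
  shows "continuous_on UNIV (\<lambda>x::real^3. g (norm x))"
  by (rule continuous_on_compose2[OF assms]) (auto intro!: continuous_intros)

lemma U_cont: "continuous_on UNIV U"
  unfolding U_def[abs_def] by (rule continuous_radial[OF w_cont])

lemma gradU_cont: "continuous_on UNIV gradU"
  unfolding gradU_def[abs_def] by (intro continuous_intros continuous_radial[OF q_cont])

lemma U_range: "0 \<le> U x" "U x \<le> M"
  using w_range[of "norm x"] by (auto simp: U_def)

text \<open>From the bound \<open>L r\<close> on \<open>v\<close> by the mean value theorem. It
  gives \<open>U\<close> gradient 0 at the origin, where the norm is not differentiable.\<close>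

lemma w_near_0: "0 \<le> r \<Longrightarrow> \<bar>w r - w 0\<bar> \<le> L * r\<^sup>2"
proof (cases "r = 0")
  case False
  assume "0 \<le> r"
  with False have r: "0 < r" by simp
  obtain l z where z: "0 < z" "z < r" "(w has_real_derivative l) (at z)" "w r - w 0 = (r - 0) * l"
    using MVT[OF r, of w] continuous_on_subset[OF w_cont, of "{0..r}"] w_deriv
    by (auto simp: real_differentiable_def)
  have "l = v z" using DERIV_unique[OF z(3) w_deriv] z(1) by simp
  then have "\<bar>w r - w 0\<bar> = r * \<bar>v z\<bar>" using z(4) r by (simp add: abs_mult)
  also have "\<dots> \<le> r * (L * r)"
  proof -
    have "0 \<le> L" using v_le[of 1] by simp
    then have "L * z \<le> L * r" using z by (intro mult_left_mono) auto
    then show ?thesis using v_le[of z] z r by (intro mult_left_mono) auto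
  qed
  finally show ?thesis by (simp add: power2_eq_square mult_ac)
qed simp

lemma U_deriv: "((\<lambda>s. U (x + s *\<^sub>R e)) has_real_derivative gradU x \<bullet> e) (at 0)"
proof (cases "x = 0")
  case True
  have "((\<lambda>s. (U (s *\<^sub>R e) - U 0) / s) \<longlongrightarrow> 0) (at 0)"
  proof (rule Lim_null_comparison)
    show "\<forall>\<^sub>F s in at 0. norm ((U (s *\<^sub>R e) - U 0) / s) \<le> L * (norm e)\<^sup>2 * \<bar>s\<bar>"
    proof (intro always_eventually allI)
      fix s :: real
      show "norm ((U (s *\<^sub>R e) - U 0) / s) \<le> L * (norm e)\<^sup>2 * \<bar>s\<bar>"
      proof (cases "s = 0")
        case False
        have "\<bar>U (s *\<^sub>R e) - U 0\<bar> \<le> L * (norm (s *\<^sub>R e))\<^sup>2"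
          using w_near_0[of "norm (s *\<^sub>R e)"] by (simp add: U_def)
        also have "\<dots> = (L * (norm e)\<^sup>2 * \<bar>s\<bar>) * \<bar>s\<bar>"
          by (simp add: power_mult_distrib power2_eq_square mult_ac)
        finally show ?thesis using False by (simp add: pos_divide_le_eq)
      qed simp
    qed
    have "((\<lambda>s. L * (norm e)\<^sup>2 * \<bar>s\<bar>) \<longlongrightarrow> L * (norm e)\<^sup>2 * \<bar>0\<bar>) (at 0)"
      by (intro tendsto_intros)
    then show "((\<lambda>s. L * (norm e)\<^sup>2 * \<bar>s\<bar>) \<longlongrightarrow> 0) (at 0)" by simp
  qed
  then show ?thesis using True by (simp add: DERIV_def gradU_def)
next
  case False
  then have r: "0 < norm x" by simp
  have "((\<lambda>s. w (norm (x + s *\<^sub>R e))) has_real_derivative v (norm x) * ((x \<bullet> e) / norm x)) (at 0)"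
    by (rule DERIV_chain2[OF _ norm_directional_derivative[OF False]]) (use w_deriv[OF r] in simp)
  then show ?thesis using r by (simp add: U_def gradU_def q_def)
qed

text \<open>At the origin the difference quotient is \<open>q\<close> at the absolute value of
  \<open>s\<close>, which tends to \<open>q 0\<close>; elsewhere chain and product rule
  apply.\<close>

lemma gradU_deriv:
  "((\<lambda>s. gradU (x + s *\<^sub>R axis i 1) $ i) has_real_derivative hess i x) (at 0)"
proof (cases "x = 0")
  case True
  have "((\<lambda>s. q \<bar>s\<bar>) \<longlongrightarrow> q 0) (at 0)"
  proof -
    have "filterlim (\<lambda>s::real. \<bar>s\<bar>) (at_right 0) (at 0)"
      by (auto simp: filterlim_at eventually_at_filter intro!: tendsto_rabs_zero tendsto_ident_at)
    with q_lim show ?thesis by (rule filterlim_compose)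
  qed
  then have "((\<lambda>s. (q \<bar>s\<bar> * s) / s) \<longlongrightarrow> q 0) (at 0)"
    by (rule Lim_transform_eventually) (auto simp: eventually_at_filter)
  moreover have "gradU (s *\<^sub>R axis i 1) $ i = q \<bar>s\<bar> * s" for s
    by (simp add: gradU_def norm_axis_1 axis_nth)
  moreover have "gradU 0 $ i = 0" by (simp add: gradU_def)
  ultimately show ?thesis using True
    by (simp add: DERIV_def hess_def del: nonzero_mult_div_cancel_right nonzero_eq_divide_eq)
next
  case False
  then have r: "0 < norm x" by simp
  have n: "((\<lambda>s. norm (x + s *\<^sub>R axis i 1)) has_real_derivative x $ i / norm x) (at 0)"
    using norm_directional_derivative[OF False, of "axis i 1"] by (simp add: inner_axis)
  have "((\<lambda>s. q (norm (x + s *\<^sub>R axis i 1))) has_real_derivative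
      (- f (w (norm x)) - 3 * q (norm x)) / norm x * (x $ i / norm x)) (at 0)"
    by (rule DERIV_chain2[OF _ n]) (use q_deriv[OF r] in simp)
  moreover have "((\<lambda>s. x $ i + s) has_real_derivative 1) (at 0)"
    by (auto intro!: derivative_eq_intros)
  ultimately have "((\<lambda>s. q (norm (x + s *\<^sub>R axis i 1)) * (x $ i + s)) has_real_derivative
      (- f (w (norm x)) - 3 * q (norm x)) / norm x * (x $ i / norm x) * (x $ i + 0) + 1 * q (norm (x + 0 *\<^sub>R axis i 1))) (at 0)"
    by (rule DERIV_mult)
  then show ?thesis using False by (simp add: gradU_def hess_def axis_def power2_eq_square add.commute mult.assoc)
qed

text \<open>The squares \<open>x_i^2 / r^2\<close> add up to 1, so the term \<open>- 3 q\<close>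
  cancels the three copies of \<open>q\<close>. At the origin the value \<open>- f (w 0) / 3\<close>
  of \<open>q\<close> gives the same result.\<close>

lemma sum_hess: "(\<Sum>i\<in>UNIV. hess i x) = - f (U x)"
proof (cases "x = 0")
  case True
  then show ?thesis by (simp add: hess_def q_def U_def)
next
  case False
  have "(\<Sum>i\<in>UNIV. (x $ i)\<^sup>2) = (norm x)\<^sup>2"
    unfolding power2_norm_eq_inner by (simp add: inner_vec_def power2_eq_square)
  then have "(\<Sum>i\<in>UNIV. (- f (w (norm x)) - 3 * q (norm x)) * (x $ i)\<^sup>2 / (norm x)\<^sup>2)
      = - f (w (norm x)) - 3 * q (norm x)"
    using False by (simp add: sum_distrib_left[symmetric] sum_divide_distrib[symmetric])
  then show ?thesis using False by (simp add: hess_def sum.distrib U_def)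
qed

lemma hess_bounded: obtains K where "\<And>i x. \<bar>hess i x\<bar> \<le> K"
proof -
  obtain F where F: "\<And>r. 0 \<le> r \<Longrightarrow> \<bar>f (w r)\<bar> \<le> F" by (rule f_w_bounded) (rule that)
  obtain Q where Q: "\<And>r. 0 \<le> r \<Longrightarrow> \<bar>q r\<bar> \<le> Q" by (rule abs_q_le) (rule that)
  have nonneg: "0 \<le> F" "0 \<le> Q" using F[of 0] Q[of 0] by auto
  have "\<bar>hess i x\<bar> \<le> Q + (F + 3 * Q)" for i x
  proof (cases "x = 0")
    case True
    then show ?thesis using Q[of 0] nonneg by (simp add: hess_def)
  next
    case False
    let ?a = "- f (w (norm x)) - 3 * q (norm x)" and ?b = "(x $ i)\<^sup>2 / (norm x)\<^sup>2"
    have "\<bar>x $ i\<bar> \<le> norm x" by (rule component_le_norm_cart)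
    then have "\<bar>x $ i\<bar>\<^sup>2 \<le> (norm x)\<^sup>2" by (intro power_mono) auto
    then have b: "0 \<le> ?b" "?b \<le> 1" using False by (auto simp: divide_le_eq)
    have a: "\<bar>?a\<bar> \<le> F + 3 * Q" using F[of "norm x"] Q[of "norm x"] by (simp add: abs_le_iff)
    have "\<bar>?a * ?b\<bar> \<le> (F + 3 * Q) * 1"
      unfolding abs_mult using a b nonneg by (intro mult_mono) auto
    moreover have "hess i x = q (norm x) + ?a * ?b" using False by (simp add: hess_def)
    ultimately have "\<bar>hess i x\<bar> \<le> \<bar>q (norm x)\<bar> + \<bar>?a * ?b\<bar>" "\<bar>?a * ?b\<bar> \<le> F + 3 * Q"
      using abs_triangle_ineq by (simp_all only: mult_1_right)
    then show ?thesis using Q[of "norm x"] by simp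
  qed
  then show ?thesis by (rule that)
qed

lemma U_square_integrable: "integrable lborel (\<lambda>x. (U x)\<^sup>2)"
  unfolding U_def
  by (rule integrable_radial[where g="\<lambda>r. (w r)\<^sup>2", OF _ _ w_mass])
    (auto intro: continuous_on_power w_cont)

lemma v_cont: "continuous_on {0..} v"
proof -
  have "continuous_on {0..} (\<lambda>r. r * q r)" by (intro continuous_intros q_cont)
  then show ?thesis by (rule continuous_on_eq) (rule v_q[symmetric])
qed

lemma norm_gradU: "norm (gradU x) = \<bar>v (norm x)\<bar>"
  by (simp add: gradU_def v_q[of "norm x"] abs_mult)

lemma gradU_square_integrable: "integrable lborel (\<lambda>x. (norm (gradU x))\<^sup>2)"
  unfolding norm_gradU power2_abs
  by (rule integrable_radial[where g="\<lambda>r. (v r)\<^sup>2", OF _ _ v_mass])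
    (auto intro: continuous_on_power v_cont)


lemma gradU_component_cont: "continuous_on UNIV (\<lambda>x. gradU x $ i)"
  by (intro continuous_intros gradU_cont)

end

section \<open>Weak forms of the equations\<close>

lemma locally_integrable_continuous:
  fixes g :: "'a::euclidean_space \<Rightarrow> 'b::euclidean_space"
  assumes "continuous_on UNIV g"
  shows "locally_integrable g"
  unfolding locally_integrable_def set_integrable_def
  using assms by (intro allI impI borel_integrable_compact) (auto intro: continuous_on_subset)

lemma test_function_mult_integrable:
  fixes g :: "'a::euclidean_space \<Rightarrow> real"
  assumes \<phi>: "test_function \<phi>" and g: "continuous_on UNIV g"
  shows "integrable lborel (\<lambda>x. \<phi> x * g x)"
proof -
  obtain R where R: "\<And>x. R \<le> norm x \<Longrightarrow> \<phi> x = 0 \<and> (\<forall>b. partial b \<phi> x = 0)"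
    by (rule test_function_support[OF \<phi>]) (rule that)
  have zero: "\<phi> x * g x = 0" if "R \<le> norm x" for x using R[OF that] by simp
  have cont: "continuous_on UNIV (\<lambda>x. \<phi> x * g x)"
    by (intro continuous_intros test_function_continuous[OF \<phi>] g)
  obtain K where "\<And>x. \<bar>\<phi> x * g x\<bar> \<le> K"
    by (rule continuous_bounded_if_support[OF cont], erule zero, rule that)
  from bounded_support_integrable[OF borel_measurable_continuous_onI[OF cont] this]
  show ?thesis using zero by blast
qed

context radial_solution
begin

lemma axis_Basis: "(axis i 1 :: real^3) \<in> Basis"
  by (simp add: axis_in_Basis_iff)

lemma weak_gradient_U: "has_weak_gradient U gradU"
  unfolding has_weak_gradient_def
proof (intro conjI allI impI)
  show "locally_integrable U" by (rule locally_integrable_continuous[OF U_cont])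
  show "locally_integrable (\<lambda>x. gradU x $ i)" for i
    by (rule locally_integrable_continuous[OF gradU_component_cont])
  fix \<phi> :: "real^3 \<Rightarrow> real" and i assume \<phi>: "test_function \<phi>"
  have d: "((\<lambda>s. U (x + s *\<^sub>R axis i 1)) has_real_derivative gradU x $ i) (at 0)" for x
    using U_deriv[of x "axis i 1"] by (simp add: inner_axis)
  show "(\<integral>x. partial (axis i 1) \<phi> x *\<^sub>R U x \<partial>lborel) = - (\<integral>x. \<phi> x *\<^sub>R (gradU x $ i) \<partial>lborel)"
    using test_function_integration_by_parts(3)[OF \<phi> axis_Basis d U_cont
        continuous_locally_bounded[OF gradU_component_cont]] by simp
qed

lemma hess_locally_bounded: "\<exists>L. \<forall>x. norm x < R \<longrightarrow> \<bar>hess i x\<bar> \<le> L"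
proof -
  obtain K where "\<And>i x. \<bar>hess i x\<bar> \<le> K" by (rule hess_bounded) (rule that)
  then show ?thesis by blast
qed

lemma weak_laplacian:
  assumes \<phi>: "test_function \<phi>"
  shows "(\<integral>x. gradU x \<bullet> grad \<phi> x \<partial>lborel) = (\<integral>x. f (U x) * \<phi> x \<partial>lborel)"
proof -
  note ibp = test_function_integration_by_parts[OF \<phi> axis_Basis gradU_deriv gradU_component_cont
      hess_locally_bounded]
  have "(\<integral>x. gradU x \<bullet> grad \<phi> x \<partial>lborel)
      = (\<integral>x. (\<Sum>i\<in>UNIV. partial (axis i 1) \<phi> x * gradU x $ i) \<partial>lborel)"
    by (simp add: inner_vec_def grad_def mult.commute)
  also have "\<dots> = (\<Sum>i\<in>UNIV. \<integral>x. partial (axis i 1) \<phi> x * gradU x $ i \<partial>lborel)"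
    by (intro Bochner_Integration.integral_sum ibp(1))
  also have "\<dots> = - (\<Sum>i\<in>UNIV. \<integral>x. \<phi> x * hess i x \<partial>lborel)"
    by (simp add: ibp(3) sum_negf)
  also have "(\<Sum>i\<in>UNIV. \<integral>x. \<phi> x * hess i x \<partial>lborel) = (\<integral>x. (\<Sum>i\<in>UNIV. \<phi> x * hess i x) \<partial>lborel)"
    by (intro Bochner_Integration.integral_sum[symmetric] ibp(2))
  also have "\<dots> = (\<integral>x. - (f (U x) * \<phi> x) \<partial>lborel)"
    by (simp add: sum_distrib_left[symmetric] sum_hess mult.commute)
  finally show ?thesis by simp
qed

text \<open>Two integrations by parts in each direction move the wave operator onto \<open>U\<close>
  times \<open>c\<close>: in time \<open>c'' = - \<omega>^2 c\<close>, in space the Laplacian of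
  \<open>U\<close> is \<open>- f (U x)\<close>. A real time factor \<open>c\<close> serves both
  components of the phase.\<close>

lemma weak_wave:
  fixes \<phi> :: "real \<times> (real^3) \<Rightarrow> real" and c c' :: "real \<Rightarrow> real"
  assumes \<phi>: "test_function \<phi>"
    and c: "\<And>t. (c has_real_derivative c' t) (at t)"
    and c': "\<And>t. (c' has_real_derivative - \<omega>\<^sup>2 * c t) (at t)"
  shows "integrable lborel (\<lambda>p. wave_operator \<phi> p * (U (snd p) * c (fst p)))"
    "(\<integral>p. wave_operator \<phi> p * (U (snd p) * c (fst p)) \<partial>lborel)
       = (\<integral>p. \<phi> p * ((f (U (snd p)) - \<omega>\<^sup>2 * U (snd p)) * c (fst p)) \<partial>lborel)"
proof -
  let ?e = "(1, 0) :: real \<times> (real^3)" and ?a = "\<lambda>i. (0, axis i 1) :: real \<times> (real^3)"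
  have basis: "?e \<in> Basis" "?a i \<in> Basis" for i
    using axis_Basis by (auto simp: Basis_prod_def)
  have c_cont: "continuous_on UNIV c" and c'_cont: "continuous_on UNIV c'"
    using c c' by (meson DERIV_continuous_on has_field_derivative_at_within)+
  have lift: "continuous_on UNIV (\<lambda>p::real \<times> (real^3). g (snd p) * k (fst p))"
    if "continuous_on UNIV g" "continuous_on UNIV k" for g :: "real^3 \<Rightarrow> real" and k :: "real \<Rightarrow> real"
    by (intro continuous_on_mult continuous_on_compose2[OF that(1)] continuous_on_compose2[OF that(2)]
        continuous_on_fst continuous_on_snd continuous_on_id) auto
  have dt: "((\<lambda>s. U (snd (p + s *\<^sub>R ?e)) * k (fst (p + s *\<^sub>R ?e))) has_real_derivative U (snd p) * k') (at 0)"
    if k: "(k has_real_derivative k') (at (fst p))" for k k' p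
  proof -
    have "((\<lambda>s. k (fst p + s)) has_real_derivative k') (at 0)"
      using k DERIV_shift[of k k' 0 "fst p"] by (simp add: add.commute)
    then show ?thesis using DERIV_cmult[of _ _ _ _ "U (snd p)"] by simp
  qed
  have dx: "((\<lambda>s. g (snd (p + s *\<^sub>R ?a i)) * c (fst (p + s *\<^sub>R ?a i))) has_real_derivative g' * c (fst p)) (at 0)"
    if "((\<lambda>s. g (snd p + s *\<^sub>R axis i 1)) has_real_derivative g') (at 0)" for g :: "real^3 \<Rightarrow> real" and g' p i
    using DERIV_cmult_right[OF that, of "c (fst p)"] by simp
  have dxU: "((\<lambda>s. U (x + s *\<^sub>R axis i 1)) has_real_derivative gradU x $ i) (at 0)" for x i
    using U_deriv[of x "axis i 1"] by (simp add: inner_axis)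
  note cont = lift[OF U_cont c_cont] lift[OF U_cont c'_cont] lift[OF gradU_component_cont c_cont]
  have ddc: "continuous_on UNIV (\<lambda>t. - \<omega>\<^sup>2 * c t)" by (intro continuous_intros c_cont)
  \<comment> \<open>\<open>T1\<close> and \<open>T2\<close> move the first and the second time
    derivative, \<open>X1\<close> and \<open>X2\<close> likewise for each space direction.\<close>
  note T1 = test_function_integration_by_parts[OF test_function_partial[OF \<phi> basis(1)] basis(1)
      dt[OF c] cont(1) continuous_locally_bounded[OF cont(2)]]
  note T2 = test_function_integration_by_parts[OF \<phi> basis(1) dt[OF c'] cont(2)
      continuous_locally_bounded[OF lift[OF U_cont ddc]]]
  note X1 = test_function_integration_by_parts[OF test_function_partial[OF \<phi> basis(2)] basis(2)
      dx[OF dxU] cont(1) continuous_locally_bounded[OF cont(3)]]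
  have hess_bound: "\<exists>L. \<forall>p. norm p < R \<longrightarrow> \<bar>hess i (snd p) * c (fst p)\<bar> \<le> L" for R i
  proof -
    obtain K where K: "\<And>i x. \<bar>hess i x\<bar> \<le> K" by (rule hess_bounded) (rule that)
    obtain D where D: "\<forall>t. norm t < R \<longrightarrow> \<bar>c t\<bar> \<le> D" using continuous_locally_bounded[OF c_cont] by blast
    have "\<bar>hess i (snd p) * c (fst p)\<bar> \<le> K * D" if "norm p < R" for p :: "real \<times> (real^3)"
    proof -
      have "norm (fst p) < R" using norm_fst_le[of "fst p" "snd p"] that by simp
      then have "\<bar>c (fst p)\<bar> \<le> D" using D by blast
      moreover have "0 \<le> K" using K[of i 0] by linarith
      ultimately show ?thesis unfolding abs_mult using K by (intro mult_mono) auto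
    qed
    then show ?thesis by blast
  qed
  note X2 = test_function_integration_by_parts[OF \<phi> basis(2) dx[OF gradU_deriv] cont(3) hess_bound]
  let ?p = "\<lambda>p. U (snd p) * c (fst p)"
  have split: "wave_operator \<phi> p * ?p p = partial ?e (partial ?e \<phi>) p * ?p p
      - (\<Sum>i\<in>UNIV. partial (?a i) (partial (?a i) \<phi>) p * ?p p)" for p
    by (simp add: wave_operator_def left_diff_distrib sum_distrib_right)
  show "integrable lborel (\<lambda>p. wave_operator \<phi> p * ?p p)"
    unfolding split by (intro Bochner_Integration.integrable_diff Bochner_Integration.integrable_sum T1(1) X1(1))
  have "(\<integral>p. wave_operator \<phi> p * ?p p \<partial>lborel)
      = (\<integral>p. partial ?e (partial ?e \<phi>) p * ?p p \<partial>lborel)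
        - (\<Sum>i\<in>UNIV. \<integral>p. partial (?a i) (partial (?a i) \<phi>) p * ?p p \<partial>lborel)"
    unfolding split
    by (subst Bochner_Integration.integral_diff)
      (intro Bochner_Integration.integrable_sum Bochner_Integration.integral_sum T1(1) X1(1) arg_cong2[where f="(-)"] refl)+
  also have "\<dots> = (\<integral>p. \<phi> p * (U (snd p) * (- \<omega>\<^sup>2 * c (fst p))) \<partial>lborel)
      - (\<Sum>i\<in>UNIV. \<integral>p. \<phi> p * (hess i (snd p) * c (fst p)) \<partial>lborel)"
    by (simp only: T1(3) T2(3) X1(3) X2(3) minus_minus)
  also have "\<dots> = (\<integral>p. \<phi> p * (U (snd p) * (- \<omega>\<^sup>2 * c (fst p))) - (\<Sum>i\<in>UNIV. \<phi> p * (hess i (snd p) * c (fst p))) \<partial>lborel)"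
    by (subst Bochner_Integration.integral_diff)
      (intro Bochner_Integration.integrable_sum Bochner_Integration.integral_sum[symmetric] T2(2) X2(2) arg_cong2[where f="(-)"] refl)+
  also have "\<dots> = (\<integral>p. \<phi> p * ((f (U (snd p)) - \<omega>\<^sup>2 * U (snd p)) * c (fst p)) \<partial>lborel)"
  proof (intro Bochner_Integration.integral_cong refl)
    fix p
    have "(\<Sum>i\<in>UNIV. \<phi> p * (hess i (snd p) * c (fst p))) = \<phi> p * ((\<Sum>i\<in>UNIV. hess i (snd p)) * c (fst p))"
      by (simp only: sum_distrib_left sum_distrib_right)
    then show "\<phi> p * (U (snd p) * (- \<omega>\<^sup>2 * c (fst p))) - (\<Sum>i\<in>UNIV. \<phi> p * (hess i (snd p) * c (fst p)))
        = \<phi> p * ((f (U (snd p)) - \<omega>\<^sup>2 * U (snd p)) * c (fst p))"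
      by (simp add: sum_hess algebra_simps)
  qed
  finally show "(\<integral>p. wave_operator \<phi> p * ?p p \<partial>lborel)
       = (\<integral>p. \<phi> p * ((f (U (snd p)) - \<omega>\<^sup>2 * U (snd p)) * c (fst p)) \<partial>lborel)" .
qed

end

section \<open>Standing waves\<close>

text \<open>First \<open>g' x - D x\<close>, then \<open>g x - D x^2 / 2\<close> is nonincreasing.
  It serves once to make \<open>P\<close> negative near 0 and once to bound \<open>W\<close> by a
  multiple of the square.\<close>

lemma quadratic_bound:
  fixes g g' g'' :: "real \<Rightarrow> real"
  assumes g: "\<And>x. (g has_real_derivative g' x) (at x)" "\<And>x. (g' has_real_derivative g'' x) (at x)"
    and 0: "g 0 = 0" "g' 0 = 0" and D: "\<And>x. 0 \<le> x \<Longrightarrow> x \<le> b \<Longrightarrow> g'' x \<le> D"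
    and s: "0 \<le> s" "s \<le> b"
  shows "g s \<le> D / 2 * s\<^sup>2"
proof -
  have 1: "g' x \<le> D * x" if x: "0 \<le> x" "x \<le> b" for x
  proof -
    have "g' x - D * x \<le> g' 0 - D * 0"
    proof (rule DERIV_nonpos_imp_nonincreasing[OF x(1)])
      fix y assume y: "0 \<le> y" "y \<le> x"
      have "((\<lambda>y. g' y - D * y) has_real_derivative g'' y - D) (at y)"
        by (auto intro!: derivative_eq_intros g(2))
      then show "\<exists>z. ((\<lambda>y. g' y - D * y) has_real_derivative z) (at y) \<and> z \<le> 0"
        using D[of y] x y by (intro exI[of _ "g'' y - D"]) auto
    qed
    then show ?thesis using 0 by simp
  qed
  have "g s - D / 2 * s\<^sup>2 \<le> g 0 - D / 2 * 0\<^sup>2"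
  proof (rule DERIV_nonpos_imp_nonincreasing[OF s(1)])
    fix y assume y: "0 \<le> y" "y \<le> s"
    have "((\<lambda>y. g y - D / 2 * y\<^sup>2) has_real_derivative g' y - D * y) (at y)"
      by (auto intro!: derivative_eq_intros g(1))
    then show "\<exists>z. ((\<lambda>y. g y - D / 2 * y\<^sup>2) has_real_derivative z) (at y) \<and> z \<le> 0"
      using 1[of y] s y by (intro exI[of _ "g' y - D * y"]) auto
  qed
  then show ?thesis using 0 by simp
qed

section \<open>Consequences of phase invariance\<close>

locale invariant_potential =
  fixes W :: "complex \<Rightarrow> real"
  assumes C2: "Ck 2 W"
    and invariant: "\<And>(\<theta>::real) \<psi>. W (exp (\<i> * complex_of_real \<theta>) * \<psi>) = W \<psi>"
begin

definition dW :: "real \<Rightarrow> real" where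
  "dW s = partial 1 W (complex_of_real s)"

definition ddW :: "real \<Rightarrow> real" where
  "ddW s = partial 1 (partial 1 W) (complex_of_real s)"

lemma W_differentiable: "W differentiable (at z)"
  and partial_C1: "b \<in> Basis \<Longrightarrow> partial b W differentiable (at z)"
  and partial_partial_cont: "b \<in> Basis \<Longrightarrow> b' \<in> Basis \<Longrightarrow> continuous_on UNIV (partial b' (partial b W))"
  using C2 by (auto simp: numeral_2_eq_2)

lemma Basis_mem: "(1::complex) \<in> Basis" "\<i> \<in> Basis"
  by (auto simp: Basis_complex_def)

lemma real_line_deriv:
  fixes h :: "complex \<Rightarrow> real"
  assumes "\<And>z. h differentiable (at z)"
  shows "((\<lambda>s. h (complex_of_real s)) has_real_derivative partial 1 h (complex_of_real s)) (at s)"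
proof -
  have "((\<lambda>t. h (complex_of_real s + t *\<^sub>R 1)) has_real_derivative partial 1 h (complex_of_real s)) (at 0)"
    by (rule partial_deriv[OF assms])
  then have "((\<lambda>t. h (complex_of_real (t + s))) has_real_derivative partial 1 h (complex_of_real s)) (at 0)"
    by (simp add: scaleR_conv_of_real add.commute)
  then show ?thesis
    using DERIV_shift[of "\<lambda>s. h (complex_of_real s)" _ 0 s] by simp
qed

lemma W_real_deriv: "(restrict_real W has_real_derivative dW s) (at s)"
  using real_line_deriv[OF W_differentiable] by (simp add: restrict_real_def[abs_def] dW_def)

lemma deriv_restrict_real: "deriv (restrict_real W) = dW"
  using W_real_deriv DERIV_imp_deriv by blast

lemma dW_deriv: "(dW has_real_derivative ddW s) (at s)"
  using real_line_deriv[OF partial_C1[OF Basis_mem(1)]] by (simp add: dW_def[abs_def] ddW_def)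

lemma deriv_dW: "deriv dW = ddW"
  using dW_deriv DERIV_imp_deriv by blast

lemma ddW_cont: "continuous_on UNIV ddW"
  unfolding ddW_def[abs_def]
  by (rule continuous_on_compose2[OF partial_partial_cont[OF Basis_mem(1,1)]])
    (auto intro!: continuous_intros)

lemma dW_cont: "continuous_on UNIV dW"
  using dW_deriv by (meson DERIV_continuous_on has_field_derivative_at_within)

text \<open>Rotation by the argument of \<open>z\<close>. The symmetries under negation and
  conjugation are read off from it.\<close>

lemma W_norm: "W z = restrict_real W (cmod z)"
proof (cases "z = 0")
  case False
  then have "z = exp (\<i> * complex_of_real (Arg z)) * complex_of_real (cmod z)"
    using Arg_eq[of z] by (simp add: mult.commute)
  then show ?thesis
    using invariant[of "Arg z" "complex_of_real (cmod z)"] by (simp add: restrict_real_def)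
qed (simp add: restrict_real_def)

lemma W_even: "restrict_real W (- s) = restrict_real W s"
  using W_norm[of "complex_of_real s"] W_norm[of "complex_of_real (- s)"]
  by (simp add: restrict_real_def)

lemma W_cnj: "W (cnj z) = W z"
  using W_norm[of z] W_norm[of "cnj z"] by simp

text \<open>The parameters \<open>t\<close> and \<open>- t\<close> give conjugate points, so
  \<open>W\<close> is even along the vertical line and its derivative at the real axis
  vanishes.\<close>

lemma partial_ii_real: "partial \<i> W (complex_of_real s) = 0"
proof -
  have d: "((\<lambda>t. W (complex_of_real s + t *\<^sub>R \<i>)) has_real_derivative partial \<i> W (complex_of_real s)) (at 0)"
    by (rule partial_deriv[OF W_differentiable])
  have "((\<lambda>t. W (complex_of_real s + (- t) *\<^sub>R \<i>)) has_real_derivative partial \<i> W (complex_of_real s) * (- 1)) (at 0)"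
    by (rule DERIV_chain2[where g="\<lambda>t. - t"]) (use d in \<open>auto intro!: derivative_eq_intros\<close>)
  moreover have "W (complex_of_real s + (- t) *\<^sub>R \<i>) = W (complex_of_real s + t *\<^sub>R \<i>)" for t
    using W_cnj[of "complex_of_real s + t *\<^sub>R \<i>"] by simp
  ultimately have "((\<lambda>t. W (complex_of_real s + t *\<^sub>R \<i>)) has_real_derivative - partial \<i> W (complex_of_real s)) (at 0)"
    by simp
  from DERIV_unique[OF this d] show ?thesis by simp
qed

text \<open>Evaluating the Frechet derivative in each direction identifies it with the partial
  derivatives; the chain rule for rotations needs it in this form.\<close>

lemma frechet_W: "(W has_derivative (\<lambda>h. partial 1 W z * Re h + partial \<i> W z * Im h)) (at z)"
proof -
  let ?D = "frechet_derivative W (at z)"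
  have D: "(W has_derivative ?D) (at z)" using W_differentiable frechet_derivative_works by blast
  then interpret bounded_linear ?D by (rule has_derivative_bounded_linear)
  have dir: "?D b = partial b W z" for b
  proof -
    have "((\<lambda>s. z + s *\<^sub>R b) has_derivative (\<lambda>s. s *\<^sub>R b)) (at 0)"
      by (auto intro!: derivative_eq_intros)
    moreover have "(W has_derivative ?D) (at (z + 0 *\<^sub>R b))" using D by simp
    ultimately have "((\<lambda>s. W (z + s *\<^sub>R b)) has_derivative (\<lambda>s. ?D (s *\<^sub>R b))) (at 0)"
      by (rule has_derivative_compose)
    then have "((\<lambda>s. W (z + s *\<^sub>R b)) has_real_derivative ?D b) (at 0)"
      by (simp add: has_field_derivative_def scale mult.commute[of _ "?D b"] lambda_one)
    from DERIV_unique[OF this partial_deriv[OF W_differentiable]] show ?thesis .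
  qed
  have "?D h = partial 1 W z * Re h + partial \<i> W z * Im h" for h
  proof -
    have "h = Re h *\<^sub>R 1 + Im h *\<^sub>R \<i>" by (simp add: complex_eq_iff)
    then have "?D h = Re h *\<^sub>R ?D 1 + Im h *\<^sub>R ?D \<i>" by (metis add scale)
    then show ?thesis by (simp add: dir mult.commute)
  qed
  then have "?D = (\<lambda>h. partial 1 W z * Re h + partial \<i> W z * Im h)" by (rule ext)
  with D show ?thesis by simp
qed

text \<open>Differentiating \<open>W(Ry) = W(y)\<close> at a real point in the directions \<open>1\<close> and \<open>\<i>\<close> gives two linear
  equations for the partial derivatives at the rotated point.\<close>

lemma cgrad_rotation:
  "cgrad W (exp (\<i> * complex_of_real \<theta>) * complex_of_real s) = exp (\<i> * complex_of_real \<theta>) * complex_of_real (dW s)"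
proof -
  let ?R = "exp (\<i> * complex_of_real \<theta>)" and ?z = "complex_of_real s"
  let ?a = "partial 1 W (?R * ?z)" and ?b = "partial \<i> W (?R * ?z)"
  have R: "?R = Complex (cos \<theta>) (sin \<theta>)" by (simp add: exp_Euler complex_eq_iff cos_of_real sin_of_real)
  have "((\<lambda>y. ?R * y) has_derivative (\<lambda>h. ?R * h)) (at ?z)"
    by (auto intro!: derivative_eq_intros)
  then have "((\<lambda>y. W (?R * y)) has_derivative (\<lambda>h. ?a * Re (?R * h) + ?b * Im (?R * h))) (at ?z)"
    by (rule has_derivative_compose[OF _ frechet_W])
  then have "(W has_derivative (\<lambda>h. ?a * Re (?R * h) + ?b * Im (?R * h))) (at ?z)"
    by (simp add: invariant)
  from has_derivative_unique[OF this frechet_W]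
  have eq: "?a * Re (?R * h) + ?b * Im (?R * h) = partial 1 W ?z * Re h + partial \<i> W ?z * Im h" for h
    by (rule fun_cong)
  have 1: "?a * cos \<theta> + ?b * sin \<theta> = dW s" using eq[of 1] by (simp add: R dW_def)
  have 2: "- ?a * sin \<theta> + ?b * cos \<theta> = 0" using eq[of \<i>] by (simp add: R partial_ii_real)
  have unit: "cos \<theta> * cos \<theta> + sin \<theta> * sin \<theta> = 1"
    using sin_cos_squared_add[of \<theta>] by (simp add: power2_eq_square)
  \<comment> \<open>Multiplication by the transposed rotation matrix recovers both partial
    derivatives from the two equations.\<close>
  have solve: "a * (c * c + s * s) = (a * c + b * s) * c - (- a * s + b * c) * s"
    "b * (c * c + s * s) = (a * c + b * s) * s + (- a * s + b * c) * c" for a b c s :: real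
    by (simp_all add: algebra_simps)
  have a: "?a = dW s * cos \<theta>"
    using solve(1)[of ?a "cos \<theta>" "sin \<theta>" ?b] unfolding 1 2 unit by simp
  have b: "?b = dW s * sin \<theta>"
    using solve(2)[of ?b "cos \<theta>" "sin \<theta>" ?a] unfolding 1 2 unit by simp
  show ?thesis unfolding cgrad_def a b by (simp add: R complex_eq_iff mult.commute)
qed

lemma cgrad_solitary_wave:
  "cgrad W (solitary_wave \<omega> u t x) = complex_of_real (dW (u x)) * exp (- \<i> * complex_of_real (\<omega> * t))"
  using cgrad_rotation[of "- (\<omega> * t)" "u x"] by (simp add: solitary_wave_def mult.commute)

lemma W_solitary_wave: "W (solitary_wave \<omega> u t x) = restrict_real W (u x)"
proof -
  have "cmod (solitary_wave \<omega> u t x) = \<bar>u x\<bar>"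
    by (simp add: solitary_wave_def norm_mult norm_exp_eq_Re)
  then show ?thesis
    using W_norm[of "solitary_wave \<omega> u t x"] W_even[of "u x"] by (auto simp: abs_if)
qed

end

lemma solitary_wave_eq:
  "solitary_wave \<omega> u t x = Complex (u x * cos (\<omega> * t)) (u x * - sin (\<omega> * t))"
proof -
  have "exp (- \<i> * complex_of_real (\<omega> * t)) = Complex (cos (\<omega> * t)) (- sin (\<omega> * t))"
    using cis_conv_exp[of "- (\<omega> * t)"] by (simp add: complex_eq_iff)
  then show ?thesis by (simp add: solitary_wave_def complex_eq_iff)
qed

section \<open>The radial profile as a solitary wave\<close>

locale standing_wave = invariant_potential W + radial_solution f w v M L B
  for W :: "complex \<Rightarrow> real" and f w v :: "real \<Rightarrow> real" and M L B :: real +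
  fixes \<omega> :: real
  assumes f_eq: "\<And>s. f s = \<omega>\<^sup>2 * s - dW s"
    and W_0: "restrict_real W 0 = 0" and dW_0: "dW 0 = 0"
    and W_nonneg: "\<And>s. 0 \<le> restrict_real W s"
begin

lemma dW_U_cont: "continuous_on UNIV (\<lambda>x. dW (U x))"
  by (rule continuous_on_compose2[OF dW_cont U_cont]) auto

lemma U_H1: "U \<in> H1"
  using U_square_integrable gradU_square_integrable weak_gradient_U
    borel_measurable_continuous_onI[OF U_cont]
  by (auto simp: H1_def)

lemma stationary: "weak_stationary_solution W \<omega> U"
  unfolding weak_stationary_solution_def deriv_restrict_real
proof (intro conjI exI[of _ gradU] allI impI)
  show "locally_integrable (\<lambda>x. dW (U x))" by (rule locally_integrable_continuous[OF dW_U_cont])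
  show "has_weak_gradient U gradU" by (rule weak_gradient_U)
  fix \<phi> :: "real^3 \<Rightarrow> real" assume \<phi>: "test_function \<phi>"
  have int: "integrable lborel (\<lambda>x. U x * \<phi> x)" "integrable lborel (\<lambda>x. dW (U x) * \<phi> x)"
    using test_function_mult_integrable[OF \<phi> U_cont] test_function_mult_integrable[OF \<phi> dW_U_cont]
    by (simp_all add: mult.commute)
  have "(\<integral>x. gradU x \<bullet> grad \<phi> x \<partial>lborel) = (\<integral>x. \<omega>\<^sup>2 * (U x * \<phi> x) - dW (U x) * \<phi> x \<partial>lborel)"
    unfolding weak_laplacian[OF \<phi>] by (simp add: f_eq algebra_simps)
  also have "\<dots> = \<omega>\<^sup>2 * (\<integral>x. U x * \<phi> x \<partial>lborel) - (\<integral>x. dW (U x) * \<phi> x \<partial>lborel)"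
    using int by simp
  finally show "(\<integral>x. gradU x \<bullet> grad \<phi> x \<partial>lborel) + (\<integral>x. dW (U x) * \<phi> x \<partial>lborel)
      = \<omega>\<^sup>2 * (\<integral>x. U x * \<phi> x \<partial>lborel)" by simp
qed

text \<open>\<open>f (U x) - \<omega>^2 * U x\<close> is \<open>- dW (U x)\<close>, so the two terms
  of \<open>g\<close> cancel after integration by parts.\<close>

lemma component_equation:
  fixes \<phi> :: "real \<times> (real^3) \<Rightarrow> real" and c c' :: "real \<Rightarrow> real"
  assumes \<phi>: "test_function \<phi>"
    and c: "\<And>t. (c has_real_derivative c' t) (at t)" "\<And>t. (c' has_real_derivative - \<omega>\<^sup>2 * c t) (at t)"
  defines "g \<equiv> \<lambda>p. wave_operator \<phi> p * (U (snd p) * c (fst p)) + \<phi> p * (dW (U (snd p)) * c (fst p))"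
  shows "integrable lborel g" "integral\<^sup>L lborel g = 0"
proof -
  have c_cont: "continuous_on UNIV c"
    using c(1) by (meson DERIV_continuous_on has_field_derivative_at_within)
  have cont: "continuous_on UNIV (\<lambda>p::real \<times> (real^3). dW (U (snd p)) * c (fst p))"
    by (intro continuous_on_mult continuous_on_compose2[OF dW_U_cont] continuous_on_compose2[OF c_cont]
        continuous_on_fst continuous_on_snd continuous_on_id) auto
  note W1 = weak_wave[where \<omega>=\<omega>, OF \<phi> c]
  have int: "integrable lborel (\<lambda>p. \<phi> p * (dW (U (snd p)) * c (fst p)))"
    by (rule test_function_mult_integrable[OF \<phi> cont])
  show "integrable lborel g" unfolding g_def by (intro Bochner_Integration.integrable_add W1(1) int)
  have "integral\<^sup>L lborel g = (\<integral>p. wave_operator \<phi> p * (U (snd p) * c (fst p)) \<partial>lborel)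
      + (\<integral>p. \<phi> p * (dW (U (snd p)) * c (fst p)) \<partial>lborel)"
    unfolding g_def by (intro Bochner_Integration.integral_add W1(1) int)
  also have "\<dots> = 0" unfolding W1(2) by (simp add: f_eq)
  finally show "integral\<^sup>L lborel g = 0" .
qed

lemma wave_solution: "weak_wave_solution W (solitary_wave \<omega> U)"
  unfolding weak_wave_solution_def cgrad_solitary_wave
proof (intro conjI allI impI)
  let ?E = "\<lambda>t. exp (- \<i> * complex_of_real (\<omega> * t))"
  have lift: "continuous_on UNIV (\<lambda>(t, x). complex_of_real (g x) * ?E t)"
    if "continuous_on UNIV g" for g :: "real^3 \<Rightarrow> real"
    unfolding case_prod_unfold
    by (intro continuous_intros continuous_on_compose2[OF that]) auto
  show "locally_integrable (\<lambda>(t, x). solitary_wave \<omega> U t x)"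
    unfolding solitary_wave_def by (rule locally_integrable_continuous[OF lift[OF U_cont]])
  show "locally_integrable (\<lambda>(t, x). complex_of_real (dW (U x)) * ?E t)"
    by (rule locally_integrable_continuous[OF lift[OF dW_U_cont]])
  fix \<phi> :: "real \<times> (real^3) \<Rightarrow> real" assume \<phi>: "test_function \<phi>"
  \<comment> \<open>Real part, with time factor cos; the imaginary part \<open>D\<close> has the
    factor - sin. Both factors solve \<open>c'' = - \<omega>^2 c\<close>.\<close>
  define A where "A = (\<lambda>p. wave_operator \<phi> p * (U (snd p) * cos (\<omega> * fst p)) + \<phi> p * (dW (U (snd p)) * cos (\<omega> * fst p)))"
  define D where "D = (\<lambda>p. wave_operator \<phi> p * (U (snd p) * - sin (\<omega> * fst p)) + \<phi> p * (dW (U (snd p)) * - sin (\<omega> * fst p)))"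
  have A: "integrable lborel A" "integral\<^sup>L lborel A = 0"
    unfolding A_def
    by (rule component_equation[OF \<phi>, where c="\<lambda>t. cos (\<omega> * t)" and c'="\<lambda>t. - \<omega> * sin (\<omega> * t)"];
        auto intro!: derivative_eq_intros simp: power2_eq_square)+
  have D: "integrable lborel D" "integral\<^sup>L lborel D = 0"
    unfolding D_def
    by (rule component_equation[OF \<phi>, where c="\<lambda>t. - sin (\<omega> * t)" and c'="\<lambda>t. - \<omega> * cos (\<omega> * t)"];
        auto intro!: derivative_eq_intros simp: power2_eq_square)+
  have "(\<integral>(t, x). wave_operator \<phi> (t, x) *\<^sub>R solitary_wave \<omega> U t x
        + \<phi> (t, x) *\<^sub>R (complex_of_real (dW (U x)) * ?E t) \<partial>lborel)
      = (\<integral>p. complex_of_real (A p) + \<i> * complex_of_real (D p) \<partial>lborel)"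
  proof (intro Bochner_Integration.integral_cong refl)
    fix p :: "real \<times> (real^3)"
    have "complex_of_real (dW (U (snd p))) * ?E (fst p)
        = Complex (dW (U (snd p)) * cos (\<omega> * fst p)) (dW (U (snd p)) * - sin (\<omega> * fst p))"
      using solitary_wave_eq[of \<omega> "\<lambda>x. dW (U x)" "fst p" "snd p"] by (simp add: solitary_wave_def)
    then show "(case p of (t, x) \<Rightarrow> wave_operator \<phi> (t, x) *\<^sub>R solitary_wave \<omega> U t x
        + \<phi> (t, x) *\<^sub>R (complex_of_real (dW (U x)) * ?E t))
        = complex_of_real (A p) + \<i> * complex_of_real (D p)"
      by (simp add: case_prod_unfold solitary_wave_eq A_def D_def complex_eq_iff)
  qed
  also have "\<dots> = complex_of_real (integral\<^sup>L lborel A) + \<i> * complex_of_real (integral\<^sup>L lborel D)"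
    using A(1) D(1) by simp
  finally show "(\<integral>(t, x). wave_operator \<phi> (t, x) *\<^sub>R solitary_wave \<omega> U t x
        + \<phi> (t, x) *\<^sub>R (complex_of_real (dW (U x)) * ?E t) \<partial>lborel) = 0"
    by (simp add: A D)
qed

text \<open>\<open>U\<close> takes values in [0, M], where the second derivative of \<open>W\<close>
  is bounded, so \<open>W\<close> is at most a multiple of \<open>U^2\<close> along the
  profile.\<close>

lemma W_U_integrable: "integrable lborel (\<lambda>x. restrict_real W (U x))"
proof -
  obtain K where K: "\<forall>s\<in>{0..M}. \<bar>ddW s\<bar> \<le> K"
    by (rule continuous_bounded_on_compact[OF continuous_on_subset[OF ddW_cont]]) auto
  have bound: "restrict_real W (U x) \<le> K / 2 * (U x)\<^sup>2" for x
  proof (rule quadratic_bound[OF W_real_deriv dW_deriv W_0 dW_0])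
    show "ddW s \<le> K" if "0 \<le> s" "s \<le> M" for s
      using K that by (auto dest!: bspec[of _ _ s])
  qed (use U_range in auto)
  have "continuous_on UNIV (restrict_real W)"
    using W_real_deriv by (meson DERIV_continuous_on has_field_derivative_at_within)
  then have "continuous_on UNIV (\<lambda>x. restrict_real W (U x))"
    by (rule continuous_on_compose2[OF _ U_cont]) auto
  then have meas: "(\<lambda>x. restrict_real W (U x)) \<in> borel_measurable lborel"
    using borel_measurable_continuous_onI by simp
  show ?thesis
  proof (rule Bochner_Integration.integrable_bound[OF _ meas])
    show "integrable lborel (\<lambda>x. K / 2 * (U x)\<^sup>2)"
      using U_square_integrable by (rule integrable_mult_right)
    show "AE x in lborel. norm (restrict_real W (U x)) \<le> norm (K / 2 * (U x)\<^sup>2)"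
      using order_trans[OF bound abs_ge_self] W_nonneg by (intro AE_I2) simp
  qed
qed

text \<open>The phase has modulus 1 and its time derivative has the modulus of
  \<open>\<omega>\<close>, so the energy density does not depend on \<open>t\<close> and one value
  of the energy serves all times.\<close>

lemma energy:
  "has_energy W (solitary_wave \<omega> U) t
     (\<integral>x. 1/2 * (\<omega>\<^sup>2 * (U x)\<^sup>2) + 1/2 * (norm (gradU x))\<^sup>2 + restrict_real W (U x) \<partial>lborel)"
proof -
  let ?E = "exp (- \<i> * complex_of_real (\<omega> * t))"
  define \<psi>t where "\<psi>t = (\<lambda>x. - \<i> * complex_of_real \<omega> * solitary_wave \<omega> U t x)"
  define G where "G = (\<lambda>x. \<chi> i. complex_of_real (gradU x $ i) * ?E)"
  have E: "norm ?E = 1" by (simp add: norm_exp_eq_Re)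
  have "((\<lambda>s. solitary_wave \<omega> U s x) has_vector_derivative \<psi>t x) (at t)" for x
  proof -
    have "((\<lambda>z. complex_of_real (U x) * exp (- \<i> * complex_of_real \<omega> * z)) has_field_derivative \<psi>t x) (at (complex_of_real t))"
      by (auto intro!: derivative_eq_intros simp: \<psi>t_def solitary_wave_def mult_ac)
    from has_vector_derivative_real_field[OF this] show ?thesis
      by (simp add: solitary_wave_def mult_ac)
  qed
  moreover have "has_weak_gradient (solitary_wave \<omega> U t) G"
    unfolding has_weak_gradient_def
  proof (intro conjI allI impI)
    show "locally_integrable (solitary_wave \<omega> U t)"
      unfolding solitary_wave_def[abs_def]
      by (intro locally_integrable_continuous continuous_intros U_cont)
    show "locally_integrable (\<lambda>x. G x $ i)" for i
      unfolding G_def vec_lambda_beta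
      by (intro locally_integrable_continuous continuous_intros gradU_component_cont)
    fix \<phi> :: "real^3 \<Rightarrow> real" and i assume \<phi>: "test_function \<phi>"
    have wg: "(\<integral>x. partial (axis i 1) \<phi> x * U x \<partial>lborel) = - (\<integral>x. \<phi> x * gradU x $ i \<partial>lborel)"
      using weak_gradient_U \<phi> by (auto simp: has_weak_gradient_def)
    have "(\<integral>x. partial (axis i 1) \<phi> x *\<^sub>R solitary_wave \<omega> U t x \<partial>lborel)
        = (\<integral>x. complex_of_real (partial (axis i 1) \<phi> x * U x) * ?E \<partial>lborel)"
      by (simp add: solitary_wave_def scaleR_conv_of_real mult.assoc)
    also have "\<dots> = complex_of_real (\<integral>x. partial (axis i 1) \<phi> x * U x \<partial>lborel) * ?E"
      by (simp only: integral_mult_left_zero integral_complex_of_real)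
    also have "\<dots> = - (complex_of_real (\<integral>x. \<phi> x * gradU x $ i \<partial>lborel) * ?E)"
      unfolding wg by simp
    also have "complex_of_real (\<integral>x. \<phi> x * gradU x $ i \<partial>lborel) * ?E
        = (\<integral>x. complex_of_real (\<phi> x * gradU x $ i) * ?E \<partial>lborel)"
      by (simp only: integral_mult_left_zero integral_complex_of_real)
    also have "\<dots> = (\<integral>x. \<phi> x *\<^sub>R (G x $ i) \<partial>lborel)"
      by (simp add: G_def scaleR_conv_of_real mult.assoc)
    finally show "(\<integral>x. partial (axis i 1) \<phi> x *\<^sub>R solitary_wave \<omega> U t x \<partial>lborel)
        = - (\<integral>x. \<phi> x *\<^sub>R (G x $ i) \<partial>lborel)" .
  qed
  moreover have "has_bochner_integral lborel
      (\<lambda>x. 1/2 * (norm (\<psi>t x))\<^sup>2 + 1/2 * (norm (G x))\<^sup>2 + W (solitary_wave \<omega> U t x))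
      (\<integral>x. 1/2 * (\<omega>\<^sup>2 * (U x)\<^sup>2) + 1/2 * (norm (gradU x))\<^sup>2 + restrict_real W (U x) \<partial>lborel)"
  proof -
    have n1: "(norm (\<psi>t x))\<^sup>2 = \<omega>\<^sup>2 * (U x)\<^sup>2" for x
      by (simp add: \<psi>t_def solitary_wave_def norm_mult E power_mult_distrib)
    have n2: "norm (G x) = norm (gradU x)" for x
      by (simp add: norm_vec_def L2_set_def G_def norm_mult E)
    have "integrable lborel (\<lambda>x. 1/2 * (\<omega>\<^sup>2 * (U x)\<^sup>2) + 1/2 * (norm (gradU x))\<^sup>2 + restrict_real W (U x))"
      by (intro Bochner_Integration.integrable_add integrable_mult_right
          U_square_integrable gradU_square_integrable W_U_integrable)
    from has_bochner_integral_integrable[OF this] show ?thesis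
      unfolding W_solitary_wave n1 n2 .
  qed
  ultimately show ?thesis unfolding has_energy_def by blast
qed

text \<open>\<open>U\<close> is continuous, and a nonempty open set is not negligible.\<close>

lemma nontrivial:
  assumes "\<exists>r\<ge>0. w r \<noteq> 0"
  shows "\<not> (AE x in lborel. U x = 0)"
proof
  assume ae: "AE x in lborel. U x = 0"
  obtain r where r: "0 \<le> r" "w r \<noteq> 0" using assms by blast
  then have ne: "r *\<^sub>R axis 1 1 \<in> {x. U x \<noteq> 0}" by (simp add: U_def)
  have op: "open {x. U x \<noteq> 0}"
    by (intro open_Collect_neq U_cont continuous_on_const)
  have "{x. U x \<noteq> 0} \<in> null_sets lborel"
    using ae op by (subst AE_iff_null_sets) (auto simp: eventually_mono)
  then have "negligible {x. U x \<noteq> 0}"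
    using null_sets_completionI negligible_iff_null_sets by blast
  then show False using open_not_negligible[OF op] ne by blast
qed

end

theorem theorem2:
  fixes W :: "complex \<Rightarrow> real" and m0 m1 \<omega>0 :: real
  assumes C2: "Ck 2 W"
    and invariant: "\<And>(\<theta>::real) \<psi>. W (exp (\<i> * complex_of_real \<theta>) * \<psi>) = W \<psi>"
    and W_nonneg: "\<And>u::real. 0 \<le> restrict_real W u"
    and W_0: "restrict_real W 0 = 0"
    and W'_0: "deriv (restrict_real W) 0 = 0"
    and W''_0: "deriv (deriv (restrict_real W)) 0 = m0\<^sup>2"
    and m0_pos: "0 < m0"
    and W_below: "\<exists>u0::real. 0 < u0 \<and> restrict_real W u0 < 1/2 * m0\<^sup>2 * u0\<^sup>2"
    and m1: "m1 = Inf {m::real. 0 < m \<and> (\<exists>u::real. 0 < u \<and> restrict_real W u - 1/2 * m\<^sup>2 * u\<^sup>2 < 0)}"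
    and \<omega>0: "m1 < \<omega>0" "\<omega>0 < m0"
  shows "\<exists>u :: real^3 \<Rightarrow> real.
           (\<forall>x. 0 \<le> u x) \<and> \<not> (AE x in lborel. u x = 0) \<and>
           weak_wave_solution W (solitary_wave \<omega>0 u) \<and>
           weak_stationary_solution W \<omega>0 u \<and>
           u \<in> H1 \<and> (\<exists>E. \<forall>t. has_energy W (solitary_wave \<omega>0 u) t E)"
proof -
  interpret invariant_potential W using C2 invariant by unfold_locales
  let ?S = "{m::real. 0 < m \<and> (\<exists>u::real. 0 < u \<and> restrict_real W u - 1/2 * m\<^sup>2 * u\<^sup>2 < 0)}"
  have "m0 \<in> ?S" using m0_pos W_below by auto
  then have "?S \<noteq> {}" by blast
  \<comment> \<open>As \<open>m1\<close> is an infimum, some admissible \<open>m\<close> lies below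
    \<open>\<omega>0\<close>; its witness \<open>\<zeta>\<close> makes \<open>P\<close> positive for
    the larger frequency too.\<close>
  then obtain m where m: "m \<in> ?S" "m < \<omega>0" using cInf_lessD[of ?S \<omega>0] \<omega>0(1) m1 by blast
  then obtain \<zeta> where \<zeta>: "0 < \<zeta>" "restrict_real W \<zeta> - 1/2 * m\<^sup>2 * \<zeta>\<^sup>2 < 0" and m_pos: "0 < m" by blast
  have \<omega>_pos: "0 < \<omega>0" using m m_pos by linarith
  have dW_0: "dW 0 = 0" using W'_0 by (simp add: deriv_restrict_real)
  have ddW_0: "ddW 0 = m0\<^sup>2" using W''_0 by (simp add: deriv_restrict_real deriv_dW)
  define P where "P = (\<lambda>s. \<omega>0\<^sup>2 / 2 * s\<^sup>2 - restrict_real W s)"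
  define f where "f = (\<lambda>s. \<omega>0\<^sup>2 * s - dW s)"
  have P_der: "(P has_real_derivative f s) (at s)" for s
    unfolding P_def f_def by (auto intro!: derivative_eq_intros W_real_deriv)
  have f_der: "(f has_real_derivative \<omega>0\<^sup>2 - ddW s) (at s)" for s
    unfolding f_def by (auto intro!: derivative_eq_intros dW_deriv)
  have f_cont: "continuous_on UNIV f" unfolding f_def by (intro continuous_intros dW_cont)
  have P_even: "P (- s) = P s" for s by (simp add: P_def W_even)
  \<comment> \<open>Near 0 the second derivative of \<open>W\<close> exceeds
    \<open>m0^2 - 2 c\<close>, so that of \<open>P\<close> is below
    \<open>\<omega>0^2 - m0^2 + 2 c = - 2 c\<close>, and integrating twice gives
    \<open>- c s^2\<close>.\<close>
  define c where "c = (m0\<^sup>2 - \<omega>0\<^sup>2) / 4"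
  have c: "0 < c" using \<omega>0(2) \<omega>_pos by (simp add: c_def power_strict_mono)
  obtain \<epsilon> where \<epsilon>: "0 < \<epsilon>" "\<And>s. \<bar>s\<bar> < \<epsilon> \<Longrightarrow> \<bar>ddW s - m0\<^sup>2\<bar> < 2 * c"
    using ddW_cont[unfolded continuous_on_iff, rule_format, of 0 "2 * c"] c
    by (auto simp: dist_real_def ddW_0)
  \<comment> \<open>Halving \<open>\<epsilon>\<close> turns the open neighbourhood into a closed
    interval; evenness covers negative arguments.\<close>
  have P_small: "P s \<le> - c * s\<^sup>2" if "\<bar>s\<bar> \<le> \<epsilon> / 2" for s
  proof -
    have "P \<bar>s\<bar> \<le> (- 2 * c) / 2 * \<bar>s\<bar>\<^sup>2"
    proof (rule quadratic_bound[OF P_der f_der])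
      show "P 0 = 0" "f 0 = 0" by (simp_all add: P_def f_def W_0 dW_0)
      show "\<omega>0\<^sup>2 - ddW x \<le> - 2 * c" if "0 \<le> x" "x \<le> \<epsilon> / 2" for x
      proof -
        have "\<bar>ddW x - m0\<^sup>2\<bar> < 2 * c" using \<epsilon>(2)[of x] that \<epsilon>(1) by simp
        moreover have "4 * c = m0\<^sup>2 - \<omega>0\<^sup>2" by (simp add: c_def)
        ultimately show ?thesis by linarith
      qed
    qed (use that in auto)
    then show ?thesis using P_even[of s] by (cases "0 \<le> s") auto
  qed
  interpret P: potential P f "\<omega>0\<^sup>2 / 2" c "\<epsilon> / 2"
  proof unfold_locales
    show "P 0 = 0" by (simp add: P_def W_0)
    show "P s \<le> \<omega>0\<^sup>2 / 2 * s\<^sup>2" for s using W_nonneg[of s] by (simp add: P_def)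
    show "0 < \<omega>0\<^sup>2 / 2" "0 < \<epsilon> / 2" using \<omega>_pos \<epsilon>(1) by simp_all
  qed (rule P_der f_cont P_even P_small c | assumption)+
  have "m\<^sup>2 * \<zeta>\<^sup>2 < \<omega>0\<^sup>2 * \<zeta>\<^sup>2"
    using m(2) m_pos \<zeta>(1) by (intro mult_strict_right_mono power_strict_mono) auto
  then have P\<zeta>: "0 < P \<zeta>" using \<zeta>(2) by (simp add: P_def)
  obtain w v M L B where sol: "radial_solution f w v M L B" and nz: "\<exists>r\<ge>0. w r \<noteq> 0"
    by (rule P.radial_profile[OF \<zeta>(1) P\<zeta>]) (rule that)
  interpret R: radial_solution f w v M L B by (rule sol)
  interpret S: standing_wave W f w v M L B \<omega>0
    by unfold_locales (simp add: f_def, rule W_0, rule dW_0, rule W_nonneg)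
  show ?thesis
    using R.U_range(1) S.nontrivial[OF nz] S.wave_solution S.stationary S.U_H1 S.energy
    by (intro exI[of _ R.U]) blast
qed

end
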